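(* \textsc{3-SAT} is polynomial-time reducible to \textsc{$\alpha$-Globally Optimal Assignment} restricted to instances with $\alpha=\ell=3$ and $d=3$; and \textsc{3-SAT} is also polynomial-time reducible to \textsc{$\alpha$-Globally Optimal Assignment} restricted to instances with $\alpha=\ell=4$ and $d=m$.
   Context: An instance of \textsc{$\alpha$-Globally Optimal Assignment} is a tuple $(A,I,P_1,\ldots,P_\ell,\alpha)$ where $A$ is a set of $n$ agents, $I$ is a set of $m$ items, $\alpha\in\{1,\ldots,\ell\}$, and for each layer $j\in\{1,\ldots,\ell\}$ the preference profile $P_j$ assigns to every agent $a$ a preference list $<^{(j)}_a$, which is a strict linear order over a subset of $I$ (the items acceptable to $a$ in layer $j$; lists may be incomplete). A special item $b_\emptyset\notin I$ is regarded as the least preferred item of every agent. An assignment is a map $p:A\to I\cup\{b_\emptyset\}$ such that no item of $I$ is assigned to two different agents; it is legal in layer $j$ if every agent receives either $b_\emptyset$ or an item acceptable to it in layer $j$. A legal assignment $p$ is Pareto optimal in layer $j$ if there is no other legal assignment $q$ (for layer $j$) with $p(a)\le^{(j)}_a q(a)$ for all $a\in A$ and $p(a)<^{(j)}_a q(a)$ for some $a\in A$. An assignment is $\alpha$-globally optimal if there exist $\alpha$ distinct layers in each of which it is Pareto optimal. The problem asks whether an $\alpha$-globally optimal assignment exists. The parameter $d$ denotes the maximum length (number of items) of a preference list over all agents and layers. \textsc{3-SAT}: given a CNF formula whose clauses each have 3 literals, decide whether it is satisfiable. *)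

theory Defs
  imports Main "HOL-Computational_Algebra.Polynomial"
begin

section \<open>Turing machines and polynomial-time reductions\<close>

text \<open>Deterministic multi-tape Turing machines in the textbook sense: a finite set of states, a
  finite tape alphabet and a total transition function. Symbols are natural numbers and 0 is the
  blank. Tapes are two-way infinite. Tape 0 holds the input, and the result is read from tape 1.\<close>

datatype move = Go_Left | Stay | Go_Right

record tm =
  num_tapes :: nat
  states :: "nat set"
  symbols :: "nat set"
  start_state :: nat
  halt_state :: nat
  delta :: "nat \<Rightarrow> nat list \<Rightarrow> nat \<times> (nat \<times> move) list"

definition turing_machine :: "tm \<Rightarrow> bool" where
  "turing_machine M \<longleftrightarrow>
     num_tapes M \<ge> 2 \<and> finite (states M) \<and> finite (symbols M) \<and> 0 \<in> symbols M \<and>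
     start_state M \<in> states M \<and> halt_state M \<in> states M \<and>
     (\<forall>q \<in> states M. \<forall>ss. length ss = num_tapes M \<and> set ss \<subseteq> symbols M \<longrightarrow>
        fst (delta M q ss) \<in> states M \<and>
        length (snd (delta M q ss)) = num_tapes M \<and>
        fst ` set (snd (delta M q ss)) \<subseteq> symbols M)"

text \<open>A tape is its contents together with the position of the head.\<close>

type_synonym tape = "(int \<Rightarrow> nat) \<times> int"

type_synonym config = "nat \<times> tape list"

fun tape_read :: "tape \<Rightarrow> nat" where
  "tape_read (c, h) = c h"

fun move_head :: "move \<Rightarrow> int \<Rightarrow> int" where
  "move_head Go_Left h = h - 1"
| "move_head Stay h = h"
| "move_head Go_Right h = h + 1"

fun tape_act :: "nat \<times> move \<Rightarrow> tape \<Rightarrow> tape" where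
  "tape_act (s, d) (c, h) = (c(h := s), move_head d h)"

fun tm_step :: "tm \<Rightarrow> config \<Rightarrow> config" where
  "tm_step M (q, ts) =
     (if q = halt_state M then (q, ts)
      else let (q', as) = delta M q (map tape_read ts) in (q', map2 tape_act as ts))"

definition contents :: "nat list \<Rightarrow> int \<Rightarrow> nat" where
  "contents w i = (if 0 \<le> i \<and> i < int (length w) then w ! nat i else 0)"

definition init_config :: "tm \<Rightarrow> nat list \<Rightarrow> config" where
  "init_config M w = (start_state M, (contents w, 0) # replicate (num_tapes M - 1) (contents [], 0))"

definition halted_with_output :: "tm \<Rightarrow> config \<Rightarrow> nat list \<Rightarrow> bool" where
  "halted_with_output M C w \<longleftrightarrow> fst C = halt_state M \<and> fst (snd C ! 1) = contents w"

record 'x decision_problem =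
  instances :: "'x set"
  is_yes :: "'x \<Rightarrow> bool"
  encode :: "'x \<Rightarrow> nat list"

definition poly_time_computable ::
  "'x decision_problem \<Rightarrow> 'y decision_problem \<Rightarrow> ('x \<Rightarrow> 'y) \<Rightarrow> bool"
where
  "poly_time_computable X Y f \<longleftrightarrow>
     (\<exists>M (p :: nat poly). turing_machine M \<and>
        (\<forall>x \<in> instances X. set (encode X x) \<subseteq> symbols M \<and>
           (\<exists>t \<le> poly p (length (encode X x)).
              halted_with_output M ((tm_step M ^^ t) (init_config M (encode X x)))
                (encode Y (f x)))))"

definition poly_time_reducible :: "'x decision_problem \<Rightarrow> 'y decision_problem \<Rightarrow> bool"
  (infix \<open>\<le>\<^sub>p\<close> 50)
where
  "X \<le>\<^sub>p Y \<longleftrightarrow>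
     (\<exists>f. (\<forall>x \<in> instances X. f x \<in> instances Y \<and> (is_yes X x \<longleftrightarrow> is_yes Y (f x))) \<and>
          poly_time_computable X Y f)"

section \<open>Encodings\<close>

text \<open>Instances are written over the symbols 1 to 5: 1 and 2 are the binary digits zero and one
  (numbers are in binary, least significant digit first), 3 ends a number, and 4 and 5 are the
  brackets around a list. The blank 0 does not occur in an encoding.\<close>

fun binary :: "nat \<Rightarrow> nat list" where
  "binary n = (if n = 0 then [] else (if even n then 1 else 2) # binary (n div 2))"

declare binary.simps [simp del]

definition enc_nat :: "nat \<Rightarrow> nat list" where
  "enc_nat n = binary n @ [3]"

definition enc_bool :: "bool \<Rightarrow> nat list" where
  "enc_bool b = [if b then 2 else 1]"

definition enc_list :: "('x \<Rightarrow> nat list) \<Rightarrow> 'x list \<Rightarrow> nat list" where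
  "enc_list e xs = 4 # concat (map e xs) @ [5]"

section \<open>3-SAT\<close>

text \<open>A literal is a variable with its sign (True for a positive literal). A formula is the
  conjunction of its clauses, a clause the disjunction of its literals.\<close>

type_synonym literal = "nat \<times> bool"
type_synonym cnf = "literal list list"

definition satisfies :: "(nat \<Rightarrow> bool) \<Rightarrow> cnf \<Rightarrow> bool" where
  "satisfies \<beta> \<phi> \<longleftrightarrow> (\<forall>C \<in> set \<phi>. \<exists>(x, s) \<in> set C. \<beta> x = s)"

definition enc_literal :: "literal \<Rightarrow> nat list" where
  "enc_literal l = enc_bool (snd l) @ enc_nat (fst l)"

definition enc_cnf :: "cnf \<Rightarrow> nat list" where
  "enc_cnf = enc_list (enc_list enc_literal)"

definition three_sat :: "cnf decision_problem" where
  "three_sat =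
     \<lparr>instances = {\<phi>. \<forall>C \<in> set \<phi>. length C = 3},
      is_yes = (\<lambda>\<phi>. \<exists>\<beta>. satisfies \<beta> \<phi>),
      encode = enc_cnf\<rparr>"

section \<open>Globally optimal assignments\<close>

text \<open>The sets of agents and items are given by duplicate-free enumerations. A profile maps each
  agent to its preference list, the acceptable items from most to least preferred. The special
  item \<open>b\<^sub>\<emptyset>\<close> is \<^term>\<open>None\<close>.\<close>

type_synonym ('a, 'b) profile = "'a \<Rightarrow> 'b list"

record ('a, 'b) goa =
  agents :: "'a list"
  items :: "'b list"
  profiles :: "('a, 'b) profile list"
  alpha :: nat

definition goa_instance :: "('a, 'b) goa \<Rightarrow> bool" where
  "goa_instance G \<longleftrightarrow>
     distinct (agents G) \<and> distinct (items G) \<and>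
     (\<forall>P \<in> set (profiles G). \<forall>a \<in> set (agents G). distinct (P a) \<and> set (P a) \<subseteq> set (items G)) \<and>
     1 \<le> alpha G \<and> alpha G \<le> length (profiles G)"

definition max_pref_length :: "('a, 'b) goa \<Rightarrow> nat" where
  "max_pref_length G =
     Max (insert 0 {length (P a) | P a. P \<in> set (profiles G) \<and> a \<in> set (agents G)})"

definition pref_less :: "'b list \<Rightarrow> 'b option \<Rightarrow> 'b option \<Rightarrow> bool" where
  "pref_less xs u v \<longleftrightarrow>
     (u = None \<and> (\<exists>b \<in> set xs. v = Some b)) \<or>
     (\<exists>i j. i < j \<and> j < length xs \<and> v = Some (xs ! i) \<and> u = Some (xs ! j))"

definition pref_le :: "'b list \<Rightarrow> 'b option \<Rightarrow> 'b option \<Rightarrow> bool" where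
  "pref_le xs u v \<longleftrightarrow> u = v \<or> pref_less xs u v"

definition is_assignment :: "('a, 'b) goa \<Rightarrow> ('a \<Rightarrow> 'b option) \<Rightarrow> bool" where
  "is_assignment G p \<longleftrightarrow>
     (\<forall>a \<in> set (agents G). p a = None \<or> (\<exists>b \<in> set (items G). p a = Some b)) \<and>
     (\<forall>a \<in> set (agents G). \<forall>a' \<in> set (agents G). a \<noteq> a' \<and> p a \<noteq> None \<longrightarrow> p a \<noteq> p a')"

definition legal :: "('a, 'b) goa \<Rightarrow> ('a, 'b) profile \<Rightarrow> ('a \<Rightarrow> 'b option) \<Rightarrow> bool" where
  "legal G P p \<longleftrightarrow>
     is_assignment G p \<and>
     (\<forall>a \<in> set (agents G). p a = None \<or> (\<exists>b \<in> set (P a). p a = Some b))"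

definition pareto_optimal :: "('a, 'b) goa \<Rightarrow> ('a, 'b) profile \<Rightarrow> ('a \<Rightarrow> 'b option) \<Rightarrow> bool" where
  "pareto_optimal G P p \<longleftrightarrow>
     legal G P p \<and>
     \<not> (\<exists>q. legal G P q \<and>
            (\<forall>a \<in> set (agents G). pref_le (P a) (p a) (q a)) \<and>
            (\<exists>a \<in> set (agents G). pref_less (P a) (p a) (q a)))"

definition globally_optimal :: "('a, 'b) goa \<Rightarrow> ('a \<Rightarrow> 'b option) \<Rightarrow> bool" where
  "globally_optimal G p \<longleftrightarrow>
     is_assignment G p \<and>
     (\<exists>J \<subseteq> {..<length (profiles G)}.
        card J = alpha G \<and> (\<forall>j \<in> J. pareto_optimal G (profiles G ! j) p))"

text \<open>For the encoding, agents and items are named by natural numbers. A profile is written as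
  the list of the preference lists of the agents, in the order of the enumeration of the agents.\<close>

definition enc_goa :: "(nat, nat) goa \<Rightarrow> nat list" where
  "enc_goa G =
     enc_list enc_nat (agents G) @ enc_list enc_nat (items G) @
     enc_list (enc_list (enc_list enc_nat)) (map (\<lambda>P. map P (agents G)) (profiles G)) @
     enc_nat (alpha G)"

definition goa_restricted_to :: "((nat, nat) goa \<Rightarrow> bool) \<Rightarrow> (nat, nat) goa decision_problem" where
  "goa_restricted_to R =
     \<lparr>instances = {G. goa_instance G \<and> R G},
      is_yes = (\<lambda>G. \<exists>p. globally_optimal G p),
      encode = enc_goa\<rparr>"

section \<open>The encodings are unambiguous\<close>

definition decodable :: "('x \<Rightarrow> nat list) \<Rightarrow> bool" where
  "decodable e \<longleftrightarrow>
     (\<forall>x. e x \<noteq> [] \<and> hd (e x) \<noteq> 5) \<and> (\<forall>x y u v. e x @ u = e y @ v \<longrightarrow> x = y \<and> u = v)"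

lemma decodableD: "decodable e \<Longrightarrow> e x @ u = e y @ v \<Longrightarrow> x = y \<and> u = v"
  unfolding decodable_def by blast

lemma decodable_hd: "decodable e \<Longrightarrow> e x \<noteq> [] \<and> hd (e x) \<noteq> 5"
  unfolding decodable_def by blast

lemma binary_inject: "binary m @ 3 # u = binary n @ 3 # v \<Longrightarrow> m = n \<and> u = v"
proof (induction m arbitrary: n rule: binary.induct)
  case (1 m)
  show ?case
  proof (cases "m = 0 \<or> n = 0")
    case True
    with "1.prems" show ?thesis
      by (auto simp: binary.simps [of m] binary.simps [of n] split: if_splits)
  next
    case False
    have par: "even m \<longleftrightarrow> even n"
      and rest: "binary (m div 2) @ 3 # u = binary (n div 2) @ 3 # v"
      using "1.prems" False
      by (auto simp: binary.simps [of m] binary.simps [of n] split: if_splits)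
    from "1.IH" [OF _ rest] False have "m div 2 = n div 2" "u = v" by auto
    with par show ?thesis by (metis bit_eq_rec)
  qed
qed

lemma decodable_enc_nat: "decodable enc_nat"
proof -
  have "hd (enc_nat n) \<noteq> 5" for n
    by (simp add: enc_nat_def binary.simps [of n])
  moreover have "m = n \<and> u = v" if "enc_nat m @ u = enc_nat n @ v" for m n u v
    using that binary_inject [of m u n v] by (simp add: enc_nat_def)
  moreover have "enc_nat n \<noteq> []" for n
    by (simp add: enc_nat_def)
  ultimately show ?thesis
    unfolding decodable_def by blast
qed

lemma decodable_enc_literal: "decodable enc_literal"
  unfolding decodable_def
proof (intro conjI allI impI)
  fix l l' :: literal and u v
  assume *: "enc_literal l @ u = enc_literal l' @ v"
  then have "snd l = snd l'" "enc_nat (fst l) @ u = enc_nat (fst l') @ v"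
    by (auto simp: enc_literal_def enc_bool_def split: if_splits)
  with decodableD [OF decodable_enc_nat this(2)] show "l = l'" "u = v"
    by (auto simp: prod_eq_iff)
qed (auto simp: enc_literal_def enc_bool_def)

lemma concat_map_inject:
  assumes "decodable e"
  shows "concat (map e xs) @ 5 # u = concat (map e ys) @ 5 # v \<Longrightarrow> xs = ys \<and> u = v"
proof (induction xs arbitrary: ys)
  case Nil
  show ?case
  proof (cases ys)
    case (Cons y ys')
    with Nil assms decodable_hd [of e y] show ?thesis by (cases "e y") auto
  qed (use Nil in auto)
next
  case (Cons x xs)
  show ?case
  proof (cases ys)
    case Nil
    with Cons.prems assms decodable_hd [of e x] show ?thesis by (cases "e x") auto
  next
    case (Cons y ys')
    with Cons.prems have "e x @ (concat (map e xs) @ 5 # u) = e y @ (concat (map e ys') @ 5 # v)"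
      by simp
    from decodableD [OF assms this] Cons.IH Cons show ?thesis by blast
  qed
qed

lemma decodable_enc_list:
  assumes "decodable e"
  shows "decodable (enc_list e)"
  unfolding decodable_def
proof (intro conjI allI impI)
  fix xs ys u v
  assume "enc_list e xs @ u = enc_list e ys @ v"
  then have "concat (map e xs) @ 5 # u = concat (map e ys) @ 5 # v"
    by (simp add: enc_list_def)
  from concat_map_inject [OF assms this] show "xs = ys" "u = v" by simp_all
qed (simp_all add: enc_list_def)

lemma inj_enc_cnf: "inj enc_cnf"
proof (rule injI)
  fix \<phi> \<psi> :: cnf
  assume "enc_cnf \<phi> = enc_cnf \<psi>"
  then have "enc_list (enc_list enc_literal) \<phi> @ [] = enc_list (enc_list enc_literal) \<psi> @ []"
    by (simp add: enc_cnf_def)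
  from decodableD [OF decodable_enc_list [OF decodable_enc_list [OF decodable_enc_literal]] this]
  show "\<phi> = \<psi>" by simp
qed

text \<open>An instance is determined by its encoding up to the values of the profiles outside the set
  of agents, which are irrelevant.\<close>

lemma enc_goa_inject:
  assumes "enc_goa G = enc_goa H"
  shows "agents G = agents H" "items G = items H" "alpha G = alpha H"
    "map (\<lambda>P. map P (agents G)) (profiles G) = map (\<lambda>P. map P (agents H)) (profiles H)"
proof -
  note nat = decodable_enc_nat
  note l1 = decodable_enc_list [OF nat]
  note l3 = decodable_enc_list [OF decodable_enc_list [OF l1]]
  note 1 = decodableD [OF l1 assms [unfolded enc_goa_def]]
  note 2 = decodableD [OF l1 conjunct2 [OF 1]]
  note 3 = decodableD [OF l3 conjunct2 [OF 2]]
  have 4: "alpha G = alpha H"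
    using decodableD [OF nat, of "alpha G" "[]" "alpha H" "[]"] 3 by simp
  from 1 2 3 4 show "agents G = agents H" "items G = items H" "alpha G = alpha H"
    "map (\<lambda>P. map P (agents G)) (profiles G) = map (\<lambda>P. map P (agents H)) (profiles H)"
    by auto
qed

end

theory Submission
  imports Defs "HOL-Library.Countable"
begin

text \<open>From the literals \<open>l\<^sub>0, \<dots>, l\<^sub>m\<^sub>-\<^sub>1\<close> of a formula (clauses are triples of consecutive literals)
  build a grid of \<open>m \<times> m\<close> cells. Each cell has two agents and two items; both agents rank the first
  item of their cell at the top and the second one at the bottom. If all layers are Pareto optimal,
  then the two agents of a cell share the two items of the cell, so a cell holds one bit, and the
  only way to violate Pareto optimality is a trading cycle. In every layer, an agent may rank the
  second item of one further cell in between. Cycles of length three along a clause exclude that no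
  literal of the clause is chosen, cycles of length two between adjacent cells propagate the bit
  \<open>l\<^sub>i is chosen\<close> along row \<open>i\<close>, and cycles of length two between \<open>(i, j)\<close> and \<open>(j, i)\<close> exclude
  that two complementary literals \<open>l\<^sub>i, l\<^sub>j\<close> are both chosen. One additional agent with favourite
  item 0 brings the lengths of the lists to the prescribed values.

  The names of the agents and items of cell \<open>(i, j)\<close> are, in binary, unary codings of \<open>i\<close> and \<open>j\<close>, so
  the instance is printed by two nested loops over the literals with two unary counters. The
  program is written in a while language over tapes, which is compiled to a Turing machine whose
  states are the continuations of the program.\<close>

section \<open>A while language over tapes and its compilation\<close>

text \<open>With lists of length three an agent has room for one foreign item per layer, whereas a
  literal may be in conflict with many others. This is why a literal gets a whole row: the copy in
  column j is reserved for the conflict with literal number j. The row layer enforces the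
  implication from left to right, which suffices because the chosen literals are read off in column
  0. That a cell holds just one bit rests on legality in several layers at once: in the clause layer
  only the first agent of a cell has a foreign item, in the conflict layer only the second one, so
  the items acceptable to an agent everywhere are the two of its cell. Only the agent without the
  favourite can take part in a trade. Hence in each layer a cell has at most one active outgoing
  edge, selected by its bit, and Pareto optimality of a bit pattern comes down to a partial function
  on cells having no cycle. All layers count because \<open>alpha\<close> equals their number. The
  fourth layer of the second instance repeats the conflict layer, with a list of all items for the
  additional agent.\<close>

type_synonym zipper = "nat list \<times> nat list"
type_synonym store = "nat \<Rightarrow> zipper"

text \<open>A tape is represented by the reversed symbols to the left of the head and the symbols from the
  head on. Position 0 is the leftmost represented cell, so programs must not move left on an empty
  left part.\<close>

definition tape_of :: "zipper \<Rightarrow> tape" where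
  "tape_of z = (contents (rev (fst z) @ snd z), int (length (fst z)))"

fun zread :: "zipper \<Rightarrow> nat" where
  "zread (l, []) = 0"
| "zread (l, x # r) = x"

text \<open>Blanking the last represented cell removes it. So writing back a blank read beyond the
  right end changes nothing, and erasing a counter from the right leaves no trailing blanks.\<close>

fun zwrite :: "nat \<Rightarrow> zipper \<Rightarrow> zipper" where
  "zwrite s (l, r) = (l, if s = 0 \<and> tl r = [] then [] else s # tl r)"

fun zmove :: "move \<Rightarrow> zipper \<Rightarrow> zipper" where
  "zmove Stay z = z"
| "zmove Go_Right (l, r) = (zread (l, r) # l, tl r)"
| "zmove Go_Left (l, r) = (tl l, hd l # r)"

lemma tape_read_tape_of: "tape_read (tape_of z) = zread z"
  by (cases z; cases "snd z") (auto simp: tape_of_def contents_def nth_append)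

lemma contents_write:
  "(contents (rev l @ r))(int (length l) := s) = contents (rev l @ snd (zwrite s (l, r)))"
proof (rule ext)
  fix i
  show "((contents (rev l @ r))(int (length l) := s)) i
    = contents (rev l @ snd (zwrite s (l, r))) i"
    by (cases r) (auto simp: contents_def nth_append nth_Cons' nat_less_iff nth_tl split: if_splits)
qed

lemma tape_act_tape_of:
  assumes "d = Go_Left \<longrightarrow> fst z \<noteq> []"
  shows "tape_act (s, d) (tape_of z) = tape_of (zmove d (zwrite s z))"
proof -
  obtain l r where z: "z = (l, r)" by fastforce
  \<comment> \<open>Moving right off the represented cells pushes a blank onto the left part;
    \<open>contents\<close> does not see trailing blanks.\<close>
  have c: "contents (w @ [0]) = contents w" for w
    by (rule ext) (auto simp: contents_def nth_append)
  show ?thesis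
  proof (cases d)
    case Go_Left
    with assms z obtain x l' where "l = x # l'" by (cases l) auto
    with Go_Left z contents_write [of l r s] show ?thesis by (simp add: tape_of_def)
  next
    case Stay
    with z contents_write [of l r s] show ?thesis by (simp add: tape_of_def)
  next
    case Go_Right
    with z contents_write [of l r s] c [of "rev l"] show ?thesis
      by (auto simp: tape_of_def)
  qed
qed

section \<open>Syntax and timed semantics of programs\<close>

datatype expr = Const nat | Read nat

datatype cond = In nat "nat list" | Same nat nat | Both cond cond

datatype com =
    Skip
  | Put nat expr move
  | Seq com com  (infixr \<open>;;\<close> 60)
  | Branch cond com com
  | While cond com

fun val :: "expr \<Rightarrow> (nat \<Rightarrow> nat) \<Rightarrow> nat" where
  "val (Const s) \<rho> = s"
| "val (Read k) \<rho> = \<rho> k"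

fun holds :: "cond \<Rightarrow> (nat \<Rightarrow> nat) \<Rightarrow> bool" where
  "holds (In k ss) \<rho> \<longleftrightarrow> \<rho> k \<in> set ss"
| "holds (Same k k') \<rho> \<longleftrightarrow> \<rho> k = \<rho> k'"
| "holds (Both b b') \<rho> \<longleftrightarrow> holds b \<rho> \<and> holds b' \<rho>"

abbreviation heads :: "store \<Rightarrow> nat \<Rightarrow> nat" where
  "heads \<sigma> \<equiv> (\<lambda>k. zread (\<sigma> k))"

text \<open>The number is the exact count of machine steps after compilation: \<open>Skip\<close>,
  the unfolding of a \<open>Seq\<close> and every test take one step each that leaves the tapes
  alone.\<close>

inductive exec :: "com \<Rightarrow> store \<Rightarrow> nat \<Rightarrow> store \<Rightarrow> bool" where
  exec_Skip: "exec Skip \<sigma> 1 \<sigma>"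
| exec_Put: "(d = Go_Left \<Longrightarrow> fst (\<sigma> k) \<noteq> []) \<Longrightarrow>
    exec (Put k e d) \<sigma> 1 (\<sigma>(k := zmove d (zwrite (val e (heads \<sigma>)) (\<sigma> k))))"
| exec_Seq: "exec c \<sigma> t \<sigma>' \<Longrightarrow> exec c' \<sigma>' t' \<sigma>'' \<Longrightarrow> exec (c ;; c') \<sigma> (Suc (t + t')) \<sigma>''"
| exec_Branch: "exec (if holds b (heads \<sigma>) then c else c') \<sigma> t \<sigma>' \<Longrightarrow> exec (Branch b c c') \<sigma> (Suc t) \<sigma>'"
| exec_While_end: "\<not> holds b (heads \<sigma>) \<Longrightarrow> exec (While b c) \<sigma> 1 \<sigma>"
| exec_While_step: "holds b (heads \<sigma>) \<Longrightarrow> exec c \<sigma> t \<sigma>' \<Longrightarrow> exec (While b c) \<sigma>' t' \<sigma>'' \<Longrightarrow>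
    exec (While b c) \<sigma> (Suc (t + t')) \<sigma>''"

fun wf_expr :: "nat \<Rightarrow> nat \<Rightarrow> expr \<Rightarrow> bool" where
  "wf_expr K S (Const s) \<longleftrightarrow> s < S"
| "wf_expr K S (Read k) \<longleftrightarrow> k < K"

fun wf_cond :: "nat \<Rightarrow> cond \<Rightarrow> bool" where
  "wf_cond K (In k ss) \<longleftrightarrow> k < K"
| "wf_cond K (Same k k') \<longleftrightarrow> k < K \<and> k' < K"
| "wf_cond K (Both b b') \<longleftrightarrow> wf_cond K b \<and> wf_cond K b'"

fun wf_com :: "nat \<Rightarrow> nat \<Rightarrow> com \<Rightarrow> bool" where
  "wf_com K S Skip \<longleftrightarrow> True"
| "wf_com K S (Put k e d) \<longleftrightarrow> k < K \<and> wf_expr K S e"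
| "wf_com K S (c ;; c') \<longleftrightarrow> wf_com K S c \<and> wf_com K S c'"
| "wf_com K S (Branch b c c') \<longleftrightarrow> wf_cond K b \<and> wf_com K S c \<and> wf_com K S c'"
| "wf_com K S (While b c) \<longleftrightarrow> wf_cond K b \<and> wf_com K S c"

text \<open>A machine reads a list of \<open>K\<close> symbols, a store has a head for every number.
  Well-formed programs inspect only indices below \<open>K\<close>, where the two views
  agree.\<close>

lemma val_cong: "wf_expr K S e \<Longrightarrow> (\<And>k. k < K \<Longrightarrow> \<rho> k = \<rho>' k) \<Longrightarrow> val e \<rho> = val e \<rho>'"
  by (cases e) auto

lemma holds_cong: "wf_cond K b \<Longrightarrow> (\<And>k. k < K \<Longrightarrow> \<rho> k = \<rho>' k) \<Longrightarrow> holds b \<rho> = holds b \<rho>'"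
  by (induction b) auto

text \<open>The control state of the compiled machine is the list of commands still to be executed.
  Only finitely many such lists occur, namely those in \<open>conts c []\<close> and the empty list.\<close>

fun next_cont :: "com list \<Rightarrow> (nat \<Rightarrow> nat) \<Rightarrow> com list" where
  "next_cont [] \<rho> = []"
| "next_cont (Skip # cs) \<rho> = cs"
| "next_cont (Put k e d # cs) \<rho> = cs"
| "next_cont ((c ;; c') # cs) \<rho> = c # c' # cs"
| "next_cont (Branch b c c' # cs) \<rho> = (if holds b \<rho> then c else c') # cs"
| "next_cont (While b c # cs) \<rho> = (if holds b \<rho> then c # While b c # cs else cs)"

fun action :: "com list \<Rightarrow> (nat \<Rightarrow> nat) \<Rightarrow> nat \<Rightarrow> nat \<times> move" where
  "action (Put k e d # cs) \<rho> i = (if i = k then (val e \<rho>, d) else (\<rho> i, Stay))"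
| "action cs \<rho> i = (\<rho> i, Stay)"

fun conts :: "com \<Rightarrow> com list \<Rightarrow> com list set" where
  "conts (c ;; c') cs = insert ((c ;; c') # cs) (conts c (c' # cs) \<union> conts c' cs)"
| "conts (Branch b c c') cs = insert (Branch b c c' # cs) (conts c cs \<union> conts c' cs)"
| "conts (While b c) cs = insert (While b c # cs) (conts c (While b c # cs))"
| "conts c cs = {c # cs}"

lemma finite_conts: "finite (conts c cs)"
  by (induction c arbitrary: cs) auto

lemma conts_start: "c # cs \<in> conts c cs"
  by (cases c) auto

lemma next_cont_conts: "x \<in> conts c cs \<Longrightarrow> next_cont x \<rho> \<in> insert cs (conts c cs)"
proof (induction c arbitrary: cs x)
  case (Seq c c')
  then show ?case
    using conts_start [of c "c' # cs"] conts_start [of c' cs] by fastforce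
next
  case (Branch b c c')
  then consider "x = Branch b c c' # cs" | "x \<in> conts c cs" | "x \<in> conts c' cs" by auto
  then show ?case
    by cases (use Branch.IH conts_start [of c cs] conts_start [of c' cs] in auto)
next
  case (While b c)
  then show ?case
    using conts_start [of c "While b c # cs"] by fastforce
qed auto

lemma conts_wf:
  "x \<in> conts c cs \<Longrightarrow> wf_com K S c \<Longrightarrow> list_all (wf_com K S) cs \<Longrightarrow> list_all (wf_com K S) x"
  by (induction c arbitrary: cs x) fastforce+

section \<open>Translation into Turing machines and simulation\<close>

instance move :: countable by countable_datatype
instance expr :: countable by countable_datatype
instance cond :: countable by countable_datatype
instance com :: countable by countable_datatype

text \<open>Machine states are natural numbers, so continuations are coded by \<open>to_nat\<close>,
  and the empty continuation is the halting state. \<open>delta\<close> is total, but its values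
  matter only on codes in \<open>states\<close>.\<close>

definition compile :: "nat \<Rightarrow> nat \<Rightarrow> com \<Rightarrow> tm" where
  "compile K S c =
     \<lparr>num_tapes = K, states = to_nat ` insert [] (conts c []), symbols = {..<S},
      start_state = to_nat [c], halt_state = to_nat ([] :: com list),
      delta = (\<lambda>q ss. (to_nat (next_cont (from_nat q) (nth ss)),
                       map (action (from_nat q) (nth ss)) [0..<K]))\<rparr>"

lemma action_less:
  assumes "list_all (wf_com K S) cs" "\<And>k. k < K \<Longrightarrow> \<rho> k < S" "i < K"
  shows "fst (action cs \<rho> i) < S"
proof -
  have "val e \<rho> < S" if "wf_expr K S e" for e
    using that assms(2) by (cases e) auto
  with assms show ?thesis
    by (induction cs \<rho> i rule: action.induct) auto
qed

lemma turing_machine_compile: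
  assumes "wf_com K S c" "2 \<le> K" "0 < S"
  shows "turing_machine (compile K S c)"
  unfolding turing_machine_def
proof (intro conjI ballI allI impI)
  fix q ss
  assume "q \<in> states (compile K S c)"
    and ss: "length ss = num_tapes (compile K S c) \<and> set ss \<subseteq> symbols (compile K S c)"
  then obtain cs where q: "q = to_nat cs" and cs: "cs \<in> insert [] (conts c [])"
    by (auto simp: compile_def)
  from cs next_cont_conts [of cs c "[]"]
  have "next_cont cs (nth ss) \<in> insert [] (conts c [])" by auto
  with q show "fst (delta (compile K S c) q ss) \<in> states (compile K S c)"
    by (auto simp: compile_def)
  have "list_all (wf_com K S) cs"
    using cs conts_wf [of cs c "[]" K S] assms(1) by auto
  then have "fst (action cs (nth ss) i) < S" if "i < K" for i
    using that ss nth_mem [of _ ss] by (intro action_less) (auto simp: compile_def subset_iff)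
  with q show "fst ` set (snd (delta (compile K S c) q ss)) \<subseteq> symbols (compile K S c)"
    by (auto simp: compile_def)
qed (use assms conts_start [of c "[]"] in \<open>auto simp: compile_def finite_conts\<close>)

definition tapes :: "nat \<Rightarrow> store \<Rightarrow> tape list" where
  "tapes K \<sigma> = map (\<lambda>k. tape_of (\<sigma> k)) [0..<K]"

lemma map2_tapes:
  "map2 tape_act (map f [0..<K]) (tapes K \<sigma>) = map (\<lambda>k. tape_act (f k) (tape_of (\<sigma> k))) [0..<K]"
  by (rule nth_equalityI) (auto simp: tapes_def)

lemma tape_act_same: "tape_act (zread z, Stay) (tape_of z) = tape_of z"
proof -
  have "tape_act (tape_read t, Stay) t = t" for t by (cases t) auto
  from this [of "tape_of z"] show ?thesis by (simp add: tape_read_tape_of)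
qed

lemma action_cong:
  assumes "\<And>k. k < K \<Longrightarrow> \<rho> k = \<rho>' k" "list_all (wf_com K S) cs" "i < K"
  shows "action cs \<rho> i = action cs \<rho>' i"
  using assms by (cases "(cs, \<rho>, i)" rule: action.cases) (auto intro: val_cong)

lemma next_cont_cong:
  assumes "\<And>k. k < K \<Longrightarrow> \<rho> k = \<rho>' k" "list_all (wf_com K S) cs"
  shows "next_cont cs \<rho> = next_cont cs \<rho>'"
  using assms holds_cong [of K _ \<rho> \<rho>']
  by (cases "(cs, \<rho>)" rule: next_cont.cases) auto

lemma tm_step_compile:
  assumes "list_all (wf_com K S) (c # cs)"
  shows "tm_step (compile K S c0) (to_nat (c # cs), tapes K \<sigma>) =
    (to_nat (next_cont (c # cs) (heads \<sigma>)),
     map (\<lambda>k. tape_act (action (c # cs) (heads \<sigma>) k) (tape_of (\<sigma> k))) [0..<K])"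
proof -
  let ?\<rho> = "nth (map tape_read (tapes K \<sigma>))"
  have *: "?\<rho> k = zread (\<sigma> k)" if "k < K" for k
    using that by (simp add: tapes_def tape_read_tape_of)
  have "next_cont (c # cs) ?\<rho> = next_cont (c # cs) (heads \<sigma>)"
    by (rule next_cont_cong) (use * assms in auto)
  moreover have "map (action (c # cs) ?\<rho>) [0..<K] = map (action (c # cs) (heads \<sigma>)) [0..<K]"
    using * assms by (intro map_cong refl action_cong) auto
  moreover have "to_nat (c # cs) \<noteq> to_nat ([] :: com list)"
    by simp
  ultimately show ?thesis
    by (simp add: compile_def map2_tapes)
qed

lemma tm_step_control:
  assumes "list_all (wf_com K S) (c # cs)" "\<And>k e d. c \<noteq> Put k e d"
  shows "tm_step (compile K S c0) (to_nat (c # cs), tapes K \<sigma>) =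
    (to_nat (next_cont (c # cs) (heads \<sigma>)), tapes K \<sigma>)"
proof -
  have "action (c # cs) \<rho> i = (\<rho> i, Stay)" for \<rho> i
    using assms(2) by (cases c) auto
  with assms(1) show ?thesis
    by (simp add: tm_step_compile tape_act_same del: next_cont.simps tm_step.simps action.simps) (simp add: tapes_def)
qed

lemma funpow_Suc_add: "(f ^^ Suc (t + t')) x = (f ^^ t') ((f ^^ t) (f x))"
  by (metis add.commute comp_apply funpow_Suc_right funpow_add)

text \<open>The arbitrary list \<open>cs\<close> of pending commands carries the induction:
  \<open>Seq\<close> and \<open>While\<close> push a command, and the first part is then simulated
  with the rest still pending.\<close>

lemma exec_compile:
  assumes "exec c \<sigma> t \<sigma>'" "wf_com K S c" "list_all (wf_com K S) cs"
  shows "(tm_step (compile K S c0) ^^ t) (to_nat (c # cs), tapes K \<sigma>) = (to_nat cs, tapes K \<sigma>')"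
  using assms
proof (induction arbitrary: cs rule: exec.induct)
  case (exec_Put d \<sigma> k e)
  let ?\<sigma> = "\<sigma>(k := zmove d (zwrite (val e (heads \<sigma>)) (\<sigma> k)))"
  have "tape_act (action (Put k e d # cs) (heads \<sigma>) i) (tape_of (\<sigma> i)) = tape_of (?\<sigma> i)" for i
    using exec_Put tape_act_tape_of [of d "\<sigma> k" "val e (heads \<sigma>)"]
    by (auto simp: tape_act_same)
  with exec_Put show ?case
    by (simp add: tm_step_compile del: action.simps tm_step.simps) (simp add: tapes_def)
next
  case (exec_Seq c \<sigma> t \<sigma>' c' t' \<sigma>'')
  then show ?case
    by (simp add: tm_step_control funpow_Suc_add del: tm_step.simps funpow.simps)
next
  case (exec_Branch b \<sigma> c c' t \<sigma>')
  then show ?case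
    by (auto simp: tm_step_control funpow_Suc_right simp del: tm_step.simps funpow.simps split: if_splits)
next
  case (exec_While_step b \<sigma> c t \<sigma>' t' \<sigma>'')
  then show ?case
    by (simp add: tm_step_control funpow_Suc_add del: tm_step.simps funpow.simps)
qed (simp_all add: tm_step_control del: tm_step.simps)

section \<open>Upper bounds on running times\<close>

definition runs :: "com \<Rightarrow> store \<Rightarrow> nat \<Rightarrow> store \<Rightarrow> bool" where
  "runs c \<sigma> T \<sigma>' \<longleftrightarrow> (\<exists>t\<le>T. exec c \<sigma> t \<sigma>')"

definition initial :: "nat list \<Rightarrow> store" where
  "initial w = (\<lambda>_. ([], []))(0 := ([], w))"

lemma poly_time_computable_runs:
  assumes c: "wf_com K S c" "2 \<le> K" "0 < S"
    and run: "\<And>x. x \<in> instances X \<Longrightarrow> set (encode X x) \<subseteq> {..<S} \<and>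
       (\<exists>\<sigma>. \<sigma> 1 = (rev (encode Y (f x)), []) \<and>
            runs c (initial (encode X x)) (poly p (length (encode X x))) \<sigma>)"
  shows "poly_time_computable X Y f"
  unfolding poly_time_computable_def
proof (rule exI, rule exI [of _ p], intro conjI ballI)
  let ?M = "compile K S c"
  show "turing_machine ?M"
    using c by (rule turing_machine_compile)
  fix x assume x: "x \<in> instances X"
  let ?w = "encode X x"
  from run [OF x] show "set ?w \<subseteq> symbols ?M"
    by (simp add: compile_def)
  from run [OF x] obtain \<sigma> t where t: "t \<le> poly p (length ?w)"
    and out: "\<sigma> 1 = (rev (encode Y (f x)), [])" and e: "exec c (initial ?w) t \<sigma>"
    by (auto simp: runs_def)
  obtain K' where K': "K = Suc K'" using c(2) by (cases K) auto
  have "init_config ?M ?w = (to_nat [c], tapes K (initial ?w))"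
    unfolding K' init_config_def tapes_def
    by (rule prod_eqI, simp add: compile_def, rule nth_equalityI)
      (auto simp: compile_def initial_def tape_of_def nth_Cons' simp del: upt_Suc)
  with exec_compile [OF e c(1), of "[]" c]
  have fin: "(tm_step ?M ^^ t) (init_config ?M ?w) = (to_nat ([] :: com list), tapes K \<sigma>)"
    by simp
  have "halted_with_output ?M (to_nat ([] :: com list), tapes K \<sigma>) (encode Y (f x))"
    using c(2) out by (simp add: halted_with_output_def compile_def tapes_def tape_of_def)
  with t fin
  show "\<exists>t\<le>poly p (length ?w). halted_with_output ?M ((tm_step ?M ^^ t) (init_config ?M ?w)) (encode Y (f x))"
    by auto
qed

lemma runs_mono: "runs c \<sigma> T \<sigma>' \<Longrightarrow> T \<le> T' \<Longrightarrow> runs c \<sigma> T' \<sigma>'"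
  unfolding runs_def using le_trans by blast

lemma runs_Skip: "runs Skip \<sigma> 1 \<sigma>"
  unfolding runs_def using exec_Skip by blast

lemma runs_Put:
  assumes "d = Go_Left \<longrightarrow> fst (\<sigma> k) \<noteq> []" "\<sigma>' = \<sigma>(k := zmove d (zwrite (val e (heads \<sigma>)) (\<sigma> k)))"
  shows "runs (Put k e d) \<sigma> 1 \<sigma>'"
  unfolding runs_def using exec_Put [of d \<sigma> k e] assms by blast

lemma runs_Seq:
  assumes "runs c \<sigma> T \<sigma>'" "runs c' \<sigma>' T' \<sigma>''"
  shows "runs (c ;; c') \<sigma> (T + T' + 1) \<sigma>''"
  using assms unfolding runs_def
  by (metis Suc_eq_plus1 Suc_le_mono add_mono exec_Seq)

lemma runs_Branch:
  assumes "runs (if holds b (heads \<sigma>) then c else c') \<sigma> T \<sigma>'"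
  shows "runs (Branch b c c') \<sigma> (T + 1) \<sigma>'"
  using assms unfolding runs_def
  by (metis Suc_eq_plus1 Suc_le_mono exec_Branch)

text \<open>The family \<open>s\<close> gives the stores at the successive loop tests. The induction
  is on the number of remaining iterations, because \<open>exec_While_step\<close> detaches the
  first one.\<close>

lemma runs_While:
  assumes "\<And>n. n < N \<Longrightarrow> holds b (heads (s n)) \<and> runs c (s n) T (s (Suc n))"
    and "\<not> holds b (heads (s N))"
  shows "runs (While b c) (s 0) (N * (T + 1) + 1) (s N)"
proof -
  have "runs (While b c) (s (N - n)) (n * (T + 1) + 1) (s N)" if "n \<le> N" for n
    using that
  proof (induction n)
    case 0
    with assms(2) show ?case unfolding runs_def using exec_While_end by fastforce
  next
    case (Suc n)
    then have "Suc (N - Suc n) = N - n" "N - Suc n < N" by auto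
    with assms(1) [of "N - Suc n"] obtain t where t: "holds b (heads (s (N - Suc n)))"
      "t \<le> T" "exec c (s (N - Suc n)) t (s (N - n))"
      unfolding runs_def by metis
    from Suc obtain t' where "t' \<le> n * (T + 1) + 1" "exec (While b c) (s (N - n)) t' (s N)"
      unfolding runs_def by auto
    with t exec_While_step [OF t(1,3)] show ?case
      unfolding runs_def by (intro exI [of _ "Suc (t + t')"]) auto
  qed
  from this [of N] show ?thesis by simp
qed

section \<open>Heads on fixed words, output and unary counters\<close>

definition zat :: "nat list \<Rightarrow> nat \<Rightarrow> zipper" where
  "zat w p = (rev (take p w), drop p w)"

lemma zread_zat: "zread (zat w p) = (if p < length w then w ! p else 0)"
  by (cases "drop p w") (auto simp: zat_def hd_drop_conv_nth [symmetric])

lemma zwrite_zread: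
  assumes "0 \<notin> set (snd z)"
  shows "zwrite (zread z) z = z"
  using assms by (cases z; cases "snd z") auto

lemma zwrite_zat: "0 \<notin> set w \<Longrightarrow> zwrite (zread (zat w p)) (zat w p) = zat w p"
  by (rule zwrite_zread) (auto simp: zat_def dest: in_set_dropD)

lemma zat_left: "p < length w \<Longrightarrow> zmove Go_Left (zat w (Suc p)) = zat w p"
  by (simp add: zat_def take_Suc_conv_app_nth Cons_nth_drop_Suc)

lemma zat_right: "p < length w \<Longrightarrow> zmove Go_Right (zat w p) = zat w (Suc p)"
  by (simp add: zat_def take_Suc_conv_app_nth Cons_nth_drop_Suc [symmetric])

definition moveL :: "nat \<Rightarrow> com" where "moveL k = Put k (Read k) Go_Left"
definition moveR :: "nat \<Rightarrow> com" where "moveR k = Put k (Read k) Go_Right"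

lemma runs_moveL:
  assumes "\<sigma> k = zat w (Suc p)" "p < length w" "0 \<notin> set w"
  shows "runs (moveL k) \<sigma> 1 (\<sigma>(k := zat w p))"
  unfolding moveL_def
proof (rule runs_Put)
  show "Go_Left = Go_Left \<longrightarrow> fst (\<sigma> k) \<noteq> []"
    using assms by (cases w) (auto simp: zat_def)
qed (use assms in \<open>simp add: zwrite_zat zat_left\<close>)

lemma runs_moveR:
  assumes "\<sigma> k = zat w p" "p < length w" "0 \<notin> set w"
  shows "runs (moveR k) \<sigma> 1 (\<sigma>(k := zat w (Suc p)))"
  unfolding moveR_def
  by (rule runs_Put) (use assms in \<open>simp_all add: zwrite_zat zat_right\<close>)

lemma runs_walk_left:
  assumes "\<sigma> k = zat w p" "q \<le> p" "p < length w" "0 \<notin> set w"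
    and "\<And>r. q < r \<Longrightarrow> r \<le> p \<Longrightarrow> w ! r \<in> set S" "w ! q \<notin> set S"
  shows "runs (While (In k S) (moveL k)) \<sigma> (2 * (p - q) + 1) (\<sigma>(k := zat w q))"
proof -
  let ?s = "\<lambda>n. \<sigma>(k := zat w (p - n))"
  have "runs (While (In k S) (moveL k)) (?s 0) ((p - q) * (1 + 1) + 1) (?s (p - q))"
  proof (rule runs_While)
    fix n assume n: "n < p - q"
    then have "Suc (p - Suc n) = p - n" by simp
    with n assms runs_moveL [of "?s n" k w "p - Suc n"]
    show "holds (In k S) (heads (?s n)) \<and> runs (moveL k) (?s n) 1 (?s (Suc n))"
      by (auto simp: zread_zat)
  qed (use assms in \<open>auto simp: zread_zat\<close>)
  moreover have "?s 0 = \<sigma>" using assms(1) by auto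
  ultimately show ?thesis using assms(2) by (auto elim: runs_mono)
qed

lemma runs_walk_right:
  assumes "\<sigma> k = zat w p" "p \<le> q" "q \<le> length w" "0 \<notin> set w"
    and "\<And>r. p \<le> r \<Longrightarrow> r < q \<Longrightarrow> w ! r \<in> set S"
    and "(if q < length w then w ! q else 0) \<notin> set S"
  shows "runs (While (In k S) (moveR k)) \<sigma> (2 * (q - p) + 1) (\<sigma>(k := zat w q))"
proof -
  let ?s = "\<lambda>n. \<sigma>(k := zat w (p + n))"
  have "runs (While (In k S) (moveR k)) (?s 0) ((q - p) * (1 + 1) + 1) (?s (q - p))"
  proof (rule runs_While)
    fix n assume n: "n < q - p"
    with assms runs_moveR [of "?s n" k w "p + n"]
    show "holds (In k S) (heads (?s n)) \<and> runs (moveR k) (?s n) 1 (?s (Suc n))"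
      by (auto simp: zread_zat)
  qed (use assms in \<open>auto simp: zread_zat\<close>)
  moreover have "?s 0 = \<sigma>" using assms(1) by auto
  ultimately show ?thesis using assms(2) by (auto elim: runs_mono)
qed

fun emit :: "nat list \<Rightarrow> com" where
  "emit [] = Skip"
| "emit (x # xs) = Put 1 (Const x) Go_Right ;; emit xs"

lemma runs_emit:
  "\<sigma> 1 = (rev out, []) \<Longrightarrow> 0 \<notin> set xs \<Longrightarrow>
    runs (emit xs) \<sigma> (2 * length xs + 1) (\<sigma>(1 := (rev (out @ xs), [])))"
proof (induction xs arbitrary: \<sigma> out)
  case Nil
  then have "\<sigma>(1 := (rev (out @ []), [])) = \<sigma>" by auto
  then show ?case using runs_Skip [of \<sigma>] by simp
next
  case (Cons x xs)
  let ?\<sigma> = "\<sigma>(1 := (rev (out @ [x]), []))"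
  have "runs (Put 1 (Const x) Go_Right) \<sigma> 1 ?\<sigma>"
    by (rule runs_Put) (use Cons.prems in auto)
  from runs_Seq [OF this Cons.IH [of ?\<sigma> "out @ [x]"]] Cons.prems
  show ?case by (simp add: fun_upd_def cong: if_cong)
qed

fun lefts :: "nat \<Rightarrow> nat \<Rightarrow> com" where
  "lefts 0 k = Skip"
| "lefts (Suc d) k = moveL k ;; lefts d k"

lemma runs_lefts:
  "\<sigma> k = zat w (d + p) \<Longrightarrow> d + p \<le> length w \<Longrightarrow> 0 \<notin> set w \<Longrightarrow>
    runs (lefts d k) \<sigma> (2 * d + 1) (\<sigma>(k := zat w p))"
proof (induction d arbitrary: \<sigma>)
  case 0
  then have "\<sigma>(k := zat w p) = \<sigma>" by auto
  then show ?case using runs_Skip [of \<sigma>] by simp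
next
  case (Suc d)
  have "runs (moveL k) \<sigma> 1 (\<sigma>(k := zat w (d + p)))"
    by (rule runs_moveL) (use Suc.prems in auto)
  from runs_Seq [OF this Suc.IH] Suc.prems show ?case by (simp add: fun_upd_def cong: if_cong)
qed

text \<open>A counter holds its value in unary above the end marker 4.\<close>

definition ctr :: "nat \<Rightarrow> zipper" where
  "ctr n = zat (4 # replicate n 1) (Suc n)"

text \<open>Starting \<open>Suc d\<close> cells left of the head omits \<open>d\<close> of the ones,
  so the value minus \<open>d\<close> is printed and the counter itself stays intact. The last loop
  walks back over the ones and the marker.\<close>

definition emit_ctr :: "nat \<Rightarrow> nat \<Rightarrow> com" where
  "emit_ctr d k = lefts (Suc d) k ;; While (In k [1]) (emit [1] ;; moveL k) ;;
     While (In k [1, 4]) (moveR k)"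

lemma runs_emit_ctr:
  assumes "\<sigma> k = ctr n" "\<sigma> 1 = (rev out, [])" "d \<le> n" "k \<noteq> 1"
  shows "runs (emit_ctr d k) \<sigma> (10 * (n + 1)) (\<sigma>(1 := (rev (out @ replicate (n - d) 1), [])))"
proof -
  let ?w = "4 # replicate n 1 :: nat list"
  let ?s = "\<lambda>r. \<sigma>(1 := (rev (out @ replicate r 1), []), k := zat ?w (n - d - r))"
  have nz: "0 \<notin> set ?w" by simp
  have "runs (lefts (Suc d) k) \<sigma> (2 * Suc d + 1) (\<sigma>(k := zat ?w (n - d)))"
    by (rule runs_lefts) (use assms in \<open>auto simp: ctr_def\<close>)
  also have "\<sigma>(k := zat ?w (n - d)) = ?s 0"
    using assms by (auto simp: fun_eq_iff)
  finally have 1: "runs (lefts (Suc d) k) \<sigma> (2 * Suc d + 1) (?s 0)" .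
  have 2: "runs (While (In k [1]) (emit [1] ;; moveL k)) (?s 0) ((n - d) * (5 + 1) + 1) (?s (n - d))"
  proof (rule runs_While)
    fix r assume r: "r < n - d"
    then have p: "Suc (n - d - Suc r) = n - d - r" by simp
    let ?t = "(?s r)(1 := (rev ((out @ replicate r 1) @ [1]), []))"
    have "runs (emit [1]) (?s r) 3 ?t"
      using runs_emit [of "?s r" "out @ replicate r 1" "[1]"] assms(4) by simp
    moreover have "runs (moveL k) ?t 1 (?t(k := zat ?w (n - d - Suc r)))"
      by (rule runs_moveL) (use p assms r nz in auto)
    ultimately have "runs (emit [1] ;; moveL k) (?s r) (3 + 1 + 1) (?t(k := zat ?w (n - d - Suc r)))"
      by (rule runs_Seq)
    also have "?t(k := zat ?w (n - d - Suc r)) = ?s (Suc r)"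
      using assms(4) by (auto simp: fun_eq_iff replicate_append_same)
    finally have "runs (emit [1] ;; moveL k) (?s r) (3 + 1 + 1) (?s (Suc r))" .
    moreover have "holds (In k [1]) (heads (?s r))"
      using r by (auto simp: zread_zat nth_Cons')
    moreover have "(3 + 1 + 1 :: nat) = 5" by simp
    ultimately show "holds (In k [1]) (heads (?s r)) \<and> runs (emit [1] ;; moveL k) (?s r) 5 (?s (Suc r))"
      by metis
  qed (simp add: zread_zat)
  let ?t = "(?s (n - d))(k := zat ?w (Suc n))"
  have 3: "runs (While (In k [1, 4]) (moveR k)) (?s (n - d)) (2 * (Suc n - 0) + 1) ?t"
    by (rule runs_walk_right) (use nz in \<open>auto simp: nth_Cons'\<close>)
  have "?t = \<sigma>(1 := (rev (out @ replicate (n - d) 1), []))"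
    using assms by (auto simp: fun_eq_iff ctr_def)
  with runs_Seq [OF 1 runs_Seq [OF 2 3]] show ?thesis
    unfolding emit_ctr_def using assms(3) by (auto elim: runs_mono)
qed

definition inc :: "nat \<Rightarrow> com" where
  "inc k = Put k (Const 1) Go_Right"

lemma runs_inc: "\<sigma> k = ctr n \<Longrightarrow> runs (inc k) \<sigma> 1 (\<sigma>(k := ctr (Suc n)))"
  unfolding inc_def by (rule runs_Put) (auto simp: ctr_def zat_def replicate_app_Cons_same)

definition reset :: "nat \<Rightarrow> com" where
  "reset k = moveL k ;; While (In k [1]) (Put k (Const 0) Go_Left) ;; moveR k"

lemma runs_reset:
  assumes "\<sigma> k = ctr n"
  shows "runs (reset k) \<sigma> (2 * n + 5) (\<sigma>(k := ctr 0))"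
proof -
  \<comment> \<open>A blank written at the right end is dropped by \<open>zwrite\<close>, so after
    \<open>r\<close> rounds the word is really shorter by \<open>r\<close> symbols.\<close>
  let ?s = "\<lambda>r. \<sigma>(k := zat (4 # replicate (n - r) 1) (n - r))"
  have 1: "runs (moveL k) \<sigma> 1 (?s 0)"
    using runs_moveL [of \<sigma> k "4 # replicate n 1" n] assms by (simp add: ctr_def)
  have 2: "runs (While (In k [1]) (Put k (Const 0) Go_Left)) (?s 0) (n * (1 + 1) + 1) (?s n)"
  proof (rule runs_While)
    fix r assume "r < n"
    then obtain q where q: "n - r = Suc q" "n - Suc r = q" by (metis Suc_diff_Suc)
    have "runs (Put k (Const 0) Go_Left) (?s r) 1 (?s (Suc r))"
      by (rule runs_Put)
        (auto simp: q zat_def fun_eq_iff replicate_append_same [symmetric] take_Cons' drop_Cons' hd_append rev_nth)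
    then show "holds (In k [1]) (heads (?s r)) \<and> runs (Put k (Const 0) Go_Left) (?s r) 1 (?s (Suc r))"
      using q by (auto simp: zread_zat nth_Cons')
  qed (simp add: zread_zat)
  have 3: "runs (moveR k) (?s n) 1 (\<sigma>(k := ctr 0))"
    using runs_moveR [of "?s n" k "[4]" 0] by (simp add: ctr_def)
  from runs_Seq [OF 1 runs_Seq [OF 2 3]] show ?thesis
    unfolding reset_def by (rule runs_mono) simp
qed

section \<open>The literal tapes\<close>

definition lit_word :: "literal list \<Rightarrow> nat list" where
  "lit_word ls = concat (map enc_literal ls)"

text \<open>The leading 4 stops walks to the left. As every literal ends with 3, the symbol in front
  of a literal is never a digit.\<close>

definition lit_tape :: "literal list \<Rightarrow> nat list" where
  "lit_tape ls = 4 # lit_word ls"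

definition pos :: "literal list \<Rightarrow> nat \<Rightarrow> nat" where
  "pos ls i = Suc (length (lit_word (take i ls)))"

definition body :: "literal \<Rightarrow> nat list" where
  "body l = (if snd l then 2 else 1) # binary (fst l)"

lemma set_binary: "set (binary n) \<subseteq> {1, 2}"
proof (induction n rule: binary.induct)
  case (1 n)
  then show ?case by (subst binary.simps) auto
qed

lemma enc_literal_body: "enc_literal l = body l @ [3]"
  by (simp add: enc_literal_def body_def enc_bool_def enc_nat_def)

lemma set_body: "set (body l) \<subseteq> {1, 2}"
  using set_binary by (auto simp: body_def)

lemma body_nth: "r < length (body l) \<Longrightarrow> body l ! r \<in> {1, 2}"
  using nth_mem set_body by blast

lemma set_enc_literal: "set (enc_literal l) \<subseteq> {1, 2, 3}"
  using set_body [of l] by (auto simp: enc_literal_body)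

lemma set_lit_word: "set (lit_word ls) \<subseteq> {1, 2, 3}"
  using set_enc_literal by (force simp: lit_word_def)

lemma lit_tape_nz [simp]: "0 \<notin> set (lit_tape ls)"
  using set_lit_word [of ls] by (auto simp: lit_tape_def)

lemma lit_tape_split:
  assumes "i < length ls"
  shows "lit_tape ls = lit_tape (take i ls) @ body (ls ! i) @ 3 # lit_word (drop (Suc i) ls)"
proof -
  have "lit_word ls = lit_word (take i ls @ ls ! i # drop (Suc i) ls)"
    using assms by (simp add: id_take_nth_drop [symmetric])
  then show ?thesis by (simp add: lit_tape_def lit_word_def enc_literal_body)
qed

lemma length_lit_tape_take: "length (lit_tape (take i ls)) = pos ls i"
  by (simp add: lit_tape_def pos_def)

lemma pos_Suc: "i < length ls \<Longrightarrow> pos ls (Suc i) = Suc (pos ls i + length (body (ls ! i)))"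
  by (simp add: pos_def take_Suc_conv_app_nth lit_word_def enc_literal_body)

lemma pos_0 [simp]: "pos ls 0 = 1"
  by (simp add: pos_def lit_word_def)

lemma pos_length: "pos ls (length ls) = length (lit_tape ls)"
  by (simp add: pos_def lit_tape_def)

lemma lit_tape_length:
  "i < length ls \<Longrightarrow> pos ls i + length (body (ls ! i)) < length (lit_tape ls)"
  by (subst lit_tape_split) (auto simp: length_lit_tape_take)

lemma lit_tape_body:
  "i < length ls \<Longrightarrow> r < length (body (ls ! i)) \<Longrightarrow> lit_tape ls ! (pos ls i + r) = body (ls ! i) ! r"
  by (subst lit_tape_split) (auto simp: length_lit_tape_take [symmetric] nth_append)

lemma lit_tape_end:
  "i < length ls \<Longrightarrow> lit_tape ls ! (pos ls i + length (body (ls ! i))) = 3"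
  by (subst lit_tape_split) (auto simp: length_lit_tape_take [symmetric] nth_append)

lemma lit_tape_before:
  assumes "i \<le> length ls"
  shows "lit_tape ls ! (pos ls i - 1) \<in> {3, 4}"
proof (cases i)
  case 0
  then show ?thesis by (simp add: lit_tape_def)
next
  case (Suc n)
  with assms lit_tape_end [of n ls] show ?thesis by (simp add: pos_Suc)
qed

lemma length_lit_word: "2 * length ls \<le> length (lit_word ls)"
  by (induction ls) (auto simp: lit_word_def enc_literal_body body_def)

lemma body_not_Nil: "body l \<noteq> []"
  by (simp add: body_def)

text \<open>A literal begins with its sign digit, so there is a digit to read even for variable 0,
  whose binary word is empty; behind the last literal the head sees a blank. The loops of the
  program test for this.\<close>

lemma zread_pos:
  assumes "i \<le> length ls"
  shows "zread (zat (lit_tape ls) (pos ls i)) \<in> {1, 2} \<longleftrightarrow> i < length ls"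
proof (cases "i < length ls")
  case True
  with lit_tape_body [of i ls 0] lit_tape_length [of i ls] body_nth [of 0 "ls ! i"] body_not_Nil
  show ?thesis by (auto simp: zread_zat)
next
  case False
  with assms have "i = length ls" by simp
  then show ?thesis by (simp add: zread_zat pos_length)
qed

definition next_lit :: "nat \<Rightarrow> com" where
  "next_lit k = While (In k [1, 2]) (moveR k) ;; moveR k"

lemma runs_next_lit:
  assumes "\<sigma> k = zat (lit_tape ls) (pos ls i)" "i < length ls"
  shows "runs (next_lit k) \<sigma> (2 * length (lit_word ls) + 3) (\<sigma>(k := zat (lit_tape ls) (pos ls (Suc i))))"
proof -
  let ?w = "lit_tape ls" and ?n = "length (body (ls ! i))"
  let ?q = "pos ls i + ?n"
  have len: "?q < length ?w" using assms(2) by (rule lit_tape_length)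
  have "runs (While (In k [1, 2]) (moveR k)) \<sigma> (2 * (?q - pos ls i) + 1) (\<sigma>(k := zat ?w ?q))"
  proof (rule runs_walk_right)
    fix r assume "pos ls i \<le> r" "r < ?q"
    then obtain s where s: "r = pos ls i + s" "s < ?n" by (auto simp: le_iff_add)
    with lit_tape_body [OF assms(2) s(2)] body_nth [OF s(2)] show "?w ! r \<in> set [1, 2]"
      by simp
  qed (use assms len lit_tape_end [OF assms(2)] in auto)
  moreover have "runs (moveR k) (\<sigma>(k := zat ?w ?q)) 1 ((\<sigma>(k := zat ?w ?q))(k := zat ?w (Suc ?q)))"
    by (rule runs_moveR) (use len in auto)
  ultimately show ?thesis
    unfolding next_lit_def using runs_Seq len assms(2)
    by (fastforce simp: pos_Suc lit_tape_def elim: runs_mono)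
qed

text \<open>The first \<open>moveL\<close> skips the symbol under the head, which may already be the
  end symbol 3; thus it works from anywhere inside a literal, its first digit and end symbol
  included.\<close>

definition lit_start :: "nat \<Rightarrow> com" where
  "lit_start k = moveL k ;; While (In k [1, 2]) (moveL k) ;; moveR k"

lemma runs_lit_start:
  assumes "\<sigma> k = zat (lit_tape ls) (pos ls i + r)" "i < length ls" "r \<le> length (body (ls ! i))"
  shows "runs (lit_start k) \<sigma> (2 * length (lit_word ls) + 5) (\<sigma>(k := zat (lit_tape ls) (pos ls i)))"
proof -
  let ?w = "lit_tape ls"
  obtain q where q: "pos ls i = Suc q" by (simp add: pos_def)
  have len: "q + r < length ?w" using lit_tape_length [OF assms(2)] assms(3) q by simp
  have 1: "runs (moveL k) \<sigma> 1 (\<sigma>(k := zat ?w (q + r)))"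
    by (rule runs_moveL) (use assms(1) len q in auto)
  have 2: "runs (While (In k [1, 2]) (moveL k)) (\<sigma>(k := zat ?w (q + r))) (2 * (q + r - q) + 1)
      ((\<sigma>(k := zat ?w (q + r)))(k := zat ?w q))"
  proof (rule runs_walk_left)
    fix s assume s: "q < s" "s \<le> q + r"
    with q have u: "s = pos ls i + (s - pos ls i)" "s - pos ls i < r" by auto
    with assms(3) lit_tape_body [OF assms(2), of "s - pos ls i"] body_nth [of "s - pos ls i" "ls ! i"]
    show "?w ! s \<in> set [1, 2]" by simp
  next
    show "?w ! q \<notin> set [1, 2]" using lit_tape_before [of i ls] assms(2) q by auto
  qed (use len in auto)
  have 3: "runs (moveR k) ((\<sigma>(k := zat ?w (q + r)))(k := zat ?w q)) 1 (\<sigma>(k := zat ?w (pos ls i)))"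
    using runs_moveR [of "(\<sigma>(k := zat ?w (q + r)))(k := zat ?w q)" k ?w q] len q by simp
  from len have "r \<le> length (lit_word ls)" by (simp add: lit_tape_def)
  then show ?thesis
    unfolding lit_start_def by (intro runs_mono [OF runs_Seq [OF 1 runs_Seq [OF 2 3]]]) simp
qed

definition prev_lit :: "nat \<Rightarrow> com" where
  "prev_lit k = moveL k ;; lit_start k"

lemma runs_prev_lit:
  assumes "\<sigma> k = zat (lit_tape ls) (pos ls (Suc i))" "i < length ls"
  shows "runs (prev_lit k) \<sigma> (2 * length (lit_word ls) + 7) (\<sigma>(k := zat (lit_tape ls) (pos ls i)))"
proof -
  let ?w = "lit_tape ls" and ?q = "pos ls i + length (body (ls ! i))"
  have "runs (moveL k) \<sigma> 1 (\<sigma>(k := zat ?w ?q))"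
    by (rule runs_moveL) (use assms lit_tape_length [of i ls] in \<open>auto simp: pos_Suc\<close>)
  from runs_Seq [OF this runs_lit_start [where r = "length (body (ls ! i))" and k = k, OF _ assms(2)]]
  show ?thesis
    unfolding prev_lit_def by (auto elim: runs_mono)
qed

definition rewind :: "nat \<Rightarrow> com" where
  "rewind k = moveL k ;; While (In k [1, 2, 3]) (moveL k) ;; moveR k"

lemma runs_rewind:
  assumes "\<sigma> k = zat (lit_tape ls) (length (lit_tape ls))"
  shows "runs (rewind k) \<sigma> (2 * length (lit_word ls) + 5) (\<sigma>(k := zat (lit_tape ls) 1))"
proof -
  let ?w = "lit_tape ls" and ?q = "length (lit_word ls)"
  have 1: "runs (moveL k) \<sigma> 1 (\<sigma>(k := zat ?w ?q))"
    by (rule runs_moveL) (use assms lit_tape_nz [of ls] in \<open>auto simp: lit_tape_def\<close>)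
  have 2: "runs (While (In k [1, 2, 3]) (moveL k)) (\<sigma>(k := zat ?w ?q)) (2 * (?q - 0) + 1)
      ((\<sigma>(k := zat ?w ?q))(k := zat ?w 0))"
  proof (rule runs_walk_left)
    fix s assume "0 < s" "s \<le> ?q"
    then have "?w ! s \<in> set (lit_word ls)" by (auto simp: lit_tape_def nth_Cons')
    with set_lit_word show "?w ! s \<in> set [1, 2, 3]" by auto
  qed (use lit_tape_nz [of ls] in \<open>auto simp: lit_tape_def\<close>)
  have 3: "runs (moveR k) ((\<sigma>(k := zat ?w ?q))(k := zat ?w 0)) 1 (\<sigma>(k := zat ?w 1))"
    using runs_moveR [of "(\<sigma>(k := zat ?w ?q))(k := zat ?w 0)" k ?w 0] lit_tape_nz [of ls] by (simp add: lit_tape_def)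
  from runs_Seq [OF 1 runs_Seq [OF 2 3]] show ?thesis
    unfolding rewind_def by (rule runs_mono) simp
qed

section \<open>The reduction as a program\<close>

text \<open>From the least significant digit on, the binary form is the digit \<open>b\<close>, then
  \<open>i\<close> zeros, a one, \<open>j\<close> zeros and a final one, so that the counters are
  printed verbatim. All names exceed 2, which leaves 0, 1 and 2 for the additional agent and its
  items.\<close>

definition nm :: "nat \<times> nat \<Rightarrow> bool \<Rightarrow> nat" where
  "nm = (\<lambda>(i, j) b. of_bool b + 2 * (2 ^ i * (1 + 2 * 2 ^ j)))"

lemma binary_bit: "n > 0 \<Longrightarrow> binary (of_bool b + 2 * n) = (if b then 2 else 1) # binary n"
  by (subst binary.simps) auto

lemma binary_power_mult: "n > 0 \<Longrightarrow> binary (2 ^ i * n) = replicate i 1 @ binary n"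
proof (induction i)
  case (Suc i)
  then show ?case using binary_bit [of "2 ^ i * n" False] by (simp add: mult.assoc)
qed simp

lemma binary_nm:
  "binary (nm (i, j) b) = (if b then 2 else 1) # replicate i 1 @ 2 # replicate j 1 @ [2]"
proof -
  have "binary (2 ^ j * 1) = replicate j 1 @ [2]"
    by (subst binary_power_mult) (simp_all add: binary.simps)
  then have "binary (1 + 2 * 2 ^ j) = 2 # replicate j 1 @ [2]"
    using binary_bit [of "2 ^ j" True] by simp
  moreover have "1 + 2 * 2 ^ j > (0 :: nat)" by simp
  ultimately show ?thesis
    by (simp only: nm_def case_prod_conv) (subst binary_bit, simp, subst binary_power_mult, simp_all)
qed

lemma enc_nat_nm:
  "enc_nat (nm (i, j) b) = (if b then 2 else 1) # replicate i 1 @ 2 # replicate j 1 @ [2, 3]"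
  by (simp add: enc_nat_def binary_nm)

type_synonym idx = "nat \<times> nat"

definition pref :: "(idx \<Rightarrow> bool \<Rightarrow> idx option) \<Rightarrow> idx \<Rightarrow> bool \<Rightarrow> nat list" where
  "pref nx o1 b = nm o1 True # (case nx o1 b of None \<Rightarrow> [] | Some o2 \<Rightarrow> [nm o2 False]) @ [nm o1 False]"

definition cnext :: "nat \<Rightarrow> nat" where
  "cnext i = (if i mod 3 = 2 then i - 2 else Suc i)"

definition conflict :: "literal \<Rightarrow> literal \<Rightarrow> bool" where
  "conflict l l' \<longleftrightarrow> fst l = fst l' \<and> snd l \<noteq> snd l'"

text \<open>In a cell of a chosen literal the agent with \<open>b = True\<close> holds the favourite
  and the one with \<open>b = False\<close> is left wanting; otherwise it is the other way round. So
  these edges are active exactly in cells that are not chosen, and a clause without chosen literal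
  yields a triangle.\<close>

definition nx_clause :: "idx \<Rightarrow> bool \<Rightarrow> idx option" where
  "nx_clause = (\<lambda>(i, j) b. if b then Some (cnext i, j) else None)"

text \<open>Chosen cells point to the right, the others to the left. A chosen cell followed by one
  that is not chosen gives two edges facing each other; in the reverse order they point
  apart.\<close>

definition nx_row :: "nat \<Rightarrow> idx \<Rightarrow> bool \<Rightarrow> idx option" where
  "nx_row m = (\<lambda>(i, j) b.
     if b then (if j > 0 then Some (i, j - 1) else None)
     else (if Suc j < m then Some (i, Suc j) else None))"

definition nx_conflict :: "literal list \<Rightarrow> idx \<Rightarrow> bool \<Rightarrow> idx option" where
  "nx_conflict ls = (\<lambda>(i, j) b. if \<not> b \<and> conflict (ls ! i) (ls ! j) then Some (j, i) else None)"

section \<open>The store invariant and the printing of names\<close>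

text \<open>Both indices are kept twice: as positions on the literal tapes 2 and 3, for comparing
  literals and detecting the end, and in unary on tapes 4 and 5, for printing. Tape 0 is the
  consumed input.\<close>

definition st :: "zipper \<Rightarrow> literal list \<Rightarrow> nat \<Rightarrow> nat \<Rightarrow> nat list \<Rightarrow> store" where
  "st w ls i j out = (\<lambda>_. ([], []))
     (0 := w, 1 := (rev out, []), 2 := zat (lit_tape ls) (pos ls i),
      3 := zat (lit_tape ls) (pos ls j), 4 := ctr i, 5 := ctr j)"

lemma st_simps [simp]:
  "st w ls i j out 0 = w"
  "st w ls i j out (Suc 0) = (rev out, [])"
  "st w ls i j out 2 = zat (lit_tape ls) (pos ls i)"
  "st w ls i j out 3 = zat (lit_tape ls) (pos ls j)"
  "st w ls i j out 4 = ctr i"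
  "st w ls i j out 5 = ctr j"
  by (simp_all add: st_def)

lemma st_out: "(st w ls i j out)(Suc 0 := (rev out', [])) = st w ls i j out'"
  by (auto simp: st_def fun_eq_iff)

abbreviation size1 :: "literal list \<Rightarrow> nat" where
  "size1 ls \<equiv> Suc (length (lit_word ls))"

text \<open>Everything but the output is restored and the earlier output is arbitrary, so commands
  compose by concatenating what they print.\<close>

definition emits ::
  "zipper \<Rightarrow> literal list \<Rightarrow> nat \<Rightarrow> nat \<Rightarrow> com \<Rightarrow> nat list \<Rightarrow> nat \<Rightarrow> bool"
where
  "emits w ls i j c xs T \<longleftrightarrow> (\<forall>out. runs c (st w ls i j out) T (st w ls i j (out @ xs)))"

lemma emits_mono: "emits w ls i j c xs T \<Longrightarrow> T \<le> T' \<Longrightarrow> emits w ls i j c xs T'"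
  unfolding emits_def by (blast intro: runs_mono)

lemma emits_Skip: "emits w ls i j Skip [] 1"
  by (simp add: emits_def runs_Skip [simplified])

lemma emits_Seq:
  assumes "emits w ls i j c xs T" "emits w ls i j c' ys T'"
  shows "emits w ls i j (c ;; c') (xs @ ys) (T + T' + 1)"
  unfolding emits_def
proof
  fix out
  show "runs (c ;; c') (st w ls i j out) (T + T' + 1) (st w ls i j (out @ xs @ ys))"
    using runs_Seq [of c _ T "st w ls i j (out @ xs)" c' T'] assms
    by (simp add: emits_def flip: append_assoc)
qed

lemma emits_emit: "0 \<notin> set xs \<Longrightarrow> emits w ls i j (emit xs) xs (2 * length xs + 1)"
  unfolding emits_def using runs_emit [of "st w ls i j _" _ xs]
  by (auto simp: st_out simp flip: rev_append)

lemma emits_emit_ctr: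
  assumes "k = 4 \<and> n = i \<or> k = 5 \<and> n = j" "d \<le> n" "i \<le> length ls" "j \<le> length ls"
  shows "emits w ls i j (emit_ctr d k) (replicate (n - d) 1) (10 * size1 ls)"
  unfolding emits_def
proof
  fix out
  have "n \<le> length (lit_word ls)"
    using assms length_lit_word [of ls] by auto
  moreover have "runs (emit_ctr d k) (st w ls i j out) (10 * (n + 1))
      (st w ls i j (out @ replicate (n - d) 1))"
    using runs_emit_ctr [of "st w ls i j out" k n out d] assms
    by (auto simp: st_out simp flip: rev_append)
  ultimately show "runs (emit_ctr d k) (st w ls i j out) (10 * size1 ls)
      (st w ls i j (out @ replicate (n - d) 1))"
    by (elim runs_mono) simp
qed

text \<open>The triple \<open>(a, d, k)\<close> stands for the value of counter \<open>k\<close> plus \<open>a\<close> minus \<open>d\<close>.\<close>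

type_synonym index_expr = "nat \<times> nat \<times> nat"

fun emit_name :: "bool \<Rightarrow> index_expr \<Rightarrow> index_expr \<Rightarrow> com" where
  "emit_name b (a, d, k) (a', d', k') =
     emit ((if b then 2 else 1) # replicate a 1) ;; emit_ctr d k ;;
     emit (2 # replicate a' 1) ;; emit_ctr d' k' ;; emit [2, 3]"

lemma emits_emit_name:
  assumes "k = 4 \<and> n = i \<or> k = 5 \<and> n = j" "k' = 4 \<and> n' = i \<or> k' = 5 \<and> n' = j"
    and "i \<le> length ls" "j \<le> length ls" "d \<le> n" "d' \<le> n'" "a \<le> 1" "a' \<le> 1"
  shows "emits w ls i j (emit_name b (a, d, k) (a', d', k'))
    (enc_nat (nm (a + (n - d), a' + (n' - d')) b)) (50 * size1 ls)"
proof -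
  note 1 = emits_emit [of "(if b then 2 else 1) # replicate a 1" w ls i j]
  note 2 = emits_emit_ctr [OF assms(1,5,3,4), of w]
  note 3 = emits_emit [of "2 # replicate a' 1" w ls i j]
  note 4 = emits_emit_ctr [OF assms(2,6,3,4), of w]
  note 5 = emits_emit [of "[2, 3]" w ls i j]
  have "emits w ls i j (emit_name b (a, d, k) (a', d', k')) (enc_nat (nm (a + (n - d), a' + (n' - d')) b))
    (2 * (1 + a) + 1 + (10 * size1 ls + (2 * (1 + a') + 1 + (10 * size1 ls + 5 + 1) + 1) + 1) + 1)"
    using emits_Seq [OF 1 emits_Seq [OF 2 emits_Seq [OF 3 emits_Seq [OF 4 5]]]]
    by (simp add: enc_nat_nm replicate_add)
  then show ?thesis
    by (rule emits_mono) (use assms in simp)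
qed

definition here :: "bool \<Rightarrow> com" where
  "here b = emit_name b (0, 0, 4) (0, 0, 5)"

lemma emits_here:
  assumes "i < length ls" "j < length ls"
  shows "emits w ls i j (here b) (enc_nat (nm (i, j) b)) (50 * size1 ls)"
  unfolding here_def using emits_emit_name [of 4 i i j 5 j ls 0 0 0 0 w b] assms by simp

definition names :: com where
  "names = here True ;; here False"

lemma emits_names:
  assumes "i < length ls" "j < length ls"
  shows "emits w ls i j names (enc_nat (nm (i, j) True) @ enc_nat (nm (i, j) False)) (500 * size1 ls)"
  unfolding names_def
  by (rule emits_mono [OF emits_Seq [OF emits_here emits_here]]) (use assms in simp_all)

section \<open>Printing the preference lists of one cell\<close>

definition cell :: "com \<Rightarrow> com \<Rightarrow> com" where
  "cell c c' = emit [4] ;; here True ;; c ;; here False ;; emit [5, 4] ;;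
     here True ;; c' ;; here False ;; emit [5]"

definition enc_ext :: "idx option \<Rightarrow> nat list" where
  "enc_ext e = (case e of None \<Rightarrow> [] | Some o2 \<Rightarrow> enc_nat (nm o2 False))"

lemma emits_cell:
  assumes "i < length ls" "j < length ls"
    and "emits w ls i j c (enc_ext (nx (i, j) True)) (100 * size1 ls)"
    and "emits w ls i j c' (enc_ext (nx (i, j) False)) (100 * size1 ls)"
  shows "emits w ls i j (cell c c')
    (enc_list enc_nat (pref nx (i, j) True) @ enc_list enc_nat (pref nx (i, j) False)) (500 * size1 ls)"
proof -
  note t = emits_here [OF assms(1,2), of w True]
  note f = emits_here [OF assms(1,2), of w False]
  have e: "emits w ls i j (emit [4]) [4] 3" "emits w ls i j (emit [5]) [5] 3"
    "emits w ls i j (emit [5, 4]) [5, 4] 5"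
    using emits_emit [of "[4]" w ls i j] emits_emit [of "[5]" w ls i j] emits_emit [of "[5, 4]" w ls i j]
    by (simp_all del: emit.simps)
  have "enc_list enc_nat (pref nx (i, j) True) @ enc_list enc_nat (pref nx (i, j) False) =
    [4] @ enc_nat (nm (i, j) True) @ enc_ext (nx (i, j) True) @ enc_nat (nm (i, j) False) @ [5, 4] @
    enc_nat (nm (i, j) True) @ enc_ext (nx (i, j) False) @ enc_nat (nm (i, j) False) @ [5]"
    by (auto simp: enc_list_def pref_def enc_ext_def split: option.splits)
  moreover have "emits w ls i j (cell c c') ([4] @ enc_nat (nm (i, j) True) @ enc_ext (nx (i, j) True) @
    enc_nat (nm (i, j) False) @ [5, 4] @ enc_nat (nm (i, j) True) @ enc_ext (nx (i, j) False) @
    enc_nat (nm (i, j) False) @ [5])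
    (3 + (50 * size1 ls + (100 * size1 ls + (50 * size1 ls + (5 + (50 * size1 ls + (100 * size1 ls + (50 * size1 ls + 3 + 1) + 1) + 1) + 1) + 1) + 1) + 1) + 1)"
    unfolding cell_def
    by (intro emits_Seq t f assms(3,4) e)
  ultimately show ?thesis by (auto elim!: emits_mono)
qed

text \<open>The residue \<open>p\<close> of the row index modulo 3 is a parameter of the program
  text and is never computed on a tape. \<open>(0, 2, 4)\<close> denotes the index i - 2 and
  \<open>(1, 0, 4)\<close> the index i + 1, the two cases of \<open>cnext\<close>.\<close>

definition clause_cell :: "nat \<Rightarrow> com" where
  "clause_cell p = cell (emit_name False (if p = 2 then (0, 2, 4) else (1, 0, 4)) (0, 0, 5)) Skip"

lemma emits_clause_cell:
  assumes "i < length ls" "j < length ls"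
  shows "emits w ls i j (clause_cell (i mod 3))
    (enc_list enc_nat (pref nx_clause (i, j) True) @ enc_list enc_nat (pref nx_clause (i, j) False)) (500 * size1 ls)"
  unfolding clause_cell_def
proof (rule emits_cell [OF assms])
  have "2 \<le> i" if "i mod 3 = 2"
    using that mod_less_eq_dividend [of i 3] by simp
  then show "emits w ls i j (emit_name False (if i mod 3 = 2 then (0, 2, 4) else (1, 0, 4)) (0, 0, 5))
     (enc_ext (nx_clause (i, j) True)) (100 * size1 ls)"
    using assms emits_emit_name [of 4 i i j 5 j ls 2 0 0 0 w False]
      emits_emit_name [of 4 i i j 5 j ls 0 0 1 0 w False]
    by (auto simp: nx_clause_def cnext_def enc_ext_def elim!: emits_mono)
  show "emits w ls i j Skip (enc_ext (nx_clause (i, j) False)) (100 * size1 ls)"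
    using emits_Skip [of w ls i j] by (auto simp: nx_clause_def enc_ext_def elim!: emits_mono)
qed

text \<open>Whether j is positive is seen on its counter: the cell left of the head contains a 1 or
  the marker 4.\<close>

definition row_prev :: com where
  "row_prev = moveL 5 ;;
     Branch (In 5 [1]) (moveR 5 ;; emit_name False (0, 0, 4) (0, 1, 5)) (moveR 5)"

text \<open>The number of literals is stored on no counter; whether j + 1 is still an index is seen
  by looking at the start of the next literal and returning.\<close>

definition row_next :: com where
  "row_next = next_lit 3 ;;
     Branch (In 3 [1, 2]) (prev_lit 3 ;; emit_name False (0, 0, 4) (1, 0, 5)) (prev_lit 3)"

lemma emits_row_prev:
  assumes "i < length ls" "j < length ls"
  shows "emits w ls i j row_prev (enc_ext (nx_row m (i, j) True)) (100 * size1 ls)"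
  unfolding emits_def
proof
  fix out
  let ?s = "st w ls i j"
  let ?w = "4 # replicate j 1"
  let ?t = "(?s out)(5 := zat ?w j)"
  have 1: "runs (moveL 5) (?s out) 1 ?t"
    by (rule runs_moveL) (auto simp: ctr_def)
  have "?t(5 := zat ?w (Suc j)) = ?s out"
    by (auto simp: ctr_def fun_eq_iff)
  with runs_moveR [of ?t 5 ?w j] have 2: "runs (moveR 5) ?t 1 (?s out)"
    by simp
  have rd: "heads ?t 5 = (if j = 0 then 4 else 1)"
    by (simp add: zread_zat nth_Cons')
  show "runs row_prev (?s out) (100 * size1 ls) (?s (out @ enc_ext (nx_row m (i, j) True)))"
  proof (cases "j = 0")
    case True
    with 2 rd have "runs (Branch (In 5 [1]) (moveR 5 ;; emit_name False (0, 0, 4) (0, 1, 5)) (moveR 5)) ?t (1 + 1) (?s out)"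
      by (intro runs_Branch) simp
    from runs_Seq [OF 1 this] True show ?thesis
      by (auto simp: row_prev_def nx_row_def enc_ext_def elim!: runs_mono)
  next
    case False
    with assms emits_emit_name [of 4 i i j 5 j ls 0 1 0 0 w False]
    have "runs (emit_name False (0, 0, 4) (0, 1, 5)) (?s out) (50 * size1 ls) (?s (out @ enc_nat (nm (i, j - 1) False)))"
      by (simp add: emits_def)
    from runs_Seq [OF 2 this] rd False
    have "runs (Branch (In 5 [1]) (moveR 5 ;; emit_name False (0, 0, 4) (0, 1, 5)) (moveR 5)) ?t
        (1 + 50 * size1 ls + 1 + 1) (?s (out @ enc_nat (nm (i, j - 1) False)))"
      by (intro runs_Branch) simp
    from runs_Seq [OF 1 this] False show ?thesis
      by (auto simp: row_prev_def nx_row_def enc_ext_def elim!: runs_mono)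
  qed
qed

lemma emits_row_next:
  assumes "i < length ls" "j < length ls"
  shows "emits w ls i j row_next (enc_ext (nx_row (length ls) (i, j) False)) (100 * size1 ls)"
  unfolding emits_def
proof
  fix out
  let ?s = "st w ls i j"
  let ?w = "lit_tape ls" and ?L = "length (lit_word ls)"
  let ?t = "(?s out)(3 := zat ?w (pos ls (Suc j)))"
  have 1: "runs (next_lit 3) (?s out) (2 * ?L + 3) ?t"
    by (rule runs_next_lit) (use assms in auto)
  have "?t(3 := zat ?w (pos ls j)) = ?s out"
    by (auto simp: fun_eq_iff)
  with runs_prev_lit [of ?t 3 ls j] assms have 2: "runs (prev_lit 3) ?t (2 * ?L + 7) (?s out)"
    by simp
  have rd: "heads ?t 3 \<in> {1, 2} \<longleftrightarrow> Suc j < length ls"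
    using zread_pos [of "Suc j" ls] assms by simp
  show "runs row_next (?s out) (100 * size1 ls) (?s (out @ enc_ext (nx_row (length ls) (i, j) False)))"
  proof (cases "Suc j < length ls")
    case False
    with 2 rd have "runs (Branch (In 3 [1, 2]) (prev_lit 3 ;; emit_name False (0, 0, 4) (1, 0, 5)) (prev_lit 3)) ?t
        (2 * ?L + 7 + 1) (?s out)"
      by (intro runs_Branch) simp
    from runs_Seq [OF 1 this] False show ?thesis
      by (auto simp: row_next_def nx_row_def enc_ext_def elim!: runs_mono)
  next
    case True
    with assms emits_emit_name [of 4 i i j 5 j ls 0 0 0 1 w False]
    have "runs (emit_name False (0, 0, 4) (1, 0, 5)) (?s out) (50 * size1 ls) (?s (out @ enc_nat (nm (i, Suc j) False)))"
      by (simp add: emits_def)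
    from runs_Seq [OF 2 this] rd True
    have "runs (Branch (In 3 [1, 2]) (prev_lit 3 ;; emit_name False (0, 0, 4) (1, 0, 5)) (prev_lit 3)) ?t
        (2 * ?L + 7 + 50 * size1 ls + 1 + 1) (?s (out @ enc_nat (nm (i, Suc j) False)))"
      by (intro runs_Branch) simp
    from runs_Seq [OF 1 this] True show ?thesis
      by (auto simp: row_next_def nx_row_def enc_ext_def elim!: runs_mono)
  qed
qed

text \<open>Equal sign digits exclude a conflict at once. Otherwise the variables are compared digit
  by digit until the words differ or both end; only in the latter case do the heads agree, both on
  3. The counters are printed in exchanged order, as the target is cell (j, i).\<close>

definition conflict_test :: com where
  "conflict_test = Branch (Same 2 3) Skip
     ((moveR 2 ;; moveR 3) ;;
      While (Both (Same 2 3) (In 2 [1, 2])) (moveR 2 ;; moveR 3) ;;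
      Branch (Same 2 3)
        (lit_start 2 ;; lit_start 3 ;; emit_name False (0, 0, 5) (0, 0, 4))
        (lit_start 2 ;; lit_start 3))"

text \<open>The witness \<open>c\<close> is the length of the longest common prefix. The appended 3
  is an end mark that is no digit: at \<open>c\<close> the padded words agree only if both are
  exhausted.\<close>

lemma common_prefix:
  fixes xs ys :: "nat list"
  assumes "set xs \<subseteq> {1, 2}" "set ys \<subseteq> {1, 2}"
  shows "\<exists>c. c \<le> length xs \<and> c \<le> length ys \<and> (\<forall>r<c. xs ! r = ys ! r \<and> ys ! r \<in> {1, 2}) \<and>
     \<not> ((xs @ [3]) ! c = (ys @ [3]) ! c \<and> (xs @ [3]) ! c \<in> {1, 2}) \<and>
     ((xs @ [3]) ! c = (ys @ [3]) ! c \<longleftrightarrow> xs = ys)"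
  using assms
proof (induction xs arbitrary: ys)
    case Nil
    then show ?case by (cases ys) auto
  next
    case (Cons x xs)
    show ?case
    proof (cases "\<exists>zs. ys = x # zs")
      case True
      then obtain zs where ys: "ys = x # zs" by blast
      with Cons.prems Cons.IH [of zs] obtain c where "c \<le> length xs" "c \<le> length zs"
        "\<forall>r<c. xs ! r = zs ! r \<and> zs ! r \<in> {1, 2}"
        "\<not> ((xs @ [3]) ! c = (zs @ [3]) ! c \<and> (xs @ [3]) ! c \<in> {1, 2})"
        "(xs @ [3]) ! c = (zs @ [3]) ! c \<longleftrightarrow> xs = zs"
        by auto
      with ys Cons.prems show ?thesis
        by (intro exI [of _ "Suc c"]) (auto simp: nth_Cons split: nat.splits)
    next
      case False
      with Cons.prems show ?thesis
        by (intro exI [of _ 0]) (cases ys; auto)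
    qed
qed

lemma lit_tape_body_end:
  assumes "i < length ls" "r \<le> length (binary (fst (ls ! i)))"
  shows "lit_tape ls ! (pos ls i + Suc r) = (binary (fst (ls ! i)) @ [3]) ! r"
  using lit_tape_body [OF assms(1), of "Suc r"] lit_tape_end [OF assms(1)] assms(2)
  by (auto simp: body_def nth_append order_le_less)

lemma inj_binary: "binary a = binary b \<Longrightarrow> a = b"
  using binary_inject [of a "[]" b "[]"] by simp

lemma emits_conflict_test:
  assumes i: "i < length ls" and j: "j < length ls"
  shows "emits w ls i j conflict_test (enc_ext (nx_conflict ls (i, j) False)) (100 * size1 ls)"
  unfolding emits_def
proof
  fix out
  let ?s = "st w ls i j"
  let ?w = "lit_tape ls" and ?L = "length (lit_word ls)"
  let ?p = "pos ls i" and ?q = "pos ls j"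
  let ?xs = "binary (fst (ls ! i))" and ?ys = "binary (fst (ls ! j))"
  let ?xl = "enc_ext (nx_conflict ls (i, j) False)"
  \<comment> \<open>Both heads have passed the sign digit, hence \<open>Suc r\<close>, and
    \<open>r\<close> digits of the variables.\<close>
  let ?t = "\<lambda>r. (?s out)(2 := zat ?w (?p + Suc r), 3 := zat ?w (?q + Suc r))"
  have len: "?p + Suc (length ?xs) < length ?w" "?q + Suc (length ?ys) < length ?w"
    using lit_tape_length [OF i] lit_tape_length [OF j] by (auto simp: body_def)
  from common_prefix [OF set_binary [of "fst (ls ! i)"] set_binary [of "fst (ls ! j)"]]
  obtain c where "c \<le> length ?xs \<and> c \<le> length ?ys \<and> (\<forall>r<c. ?xs ! r = ?ys ! r \<and> ?ys ! r \<in> {1, 2}) \<and>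
     \<not> ((?xs @ [3]) ! c = (?ys @ [3]) ! c \<and> (?xs @ [3]) ! c \<in> {1, 2}) \<and>
     ((?xs @ [3]) ! c = (?ys @ [3]) ! c \<longleftrightarrow> ?xs = ?ys)" ..
  then have c: "c \<le> length ?xs" "c \<le> length ?ys"
    "\<forall>r<c. ?xs ! r = ?ys ! r \<and> ?ys ! r \<in> {1, 2}"
    "\<not> ((?xs @ [3]) ! c = (?ys @ [3]) ! c \<and> (?xs @ [3]) ! c \<in> {1, 2})"
    "(?xs @ [3]) ! c = (?ys @ [3]) ! c \<longleftrightarrow> ?xs = ?ys"
    by simp_all
  have rd: "heads (?t r) 2 = (?xs @ [3]) ! r" "heads (?t r) 3 = (?ys @ [3]) ! r" if "r \<le> c" for r
    using that len c(1,2) lit_tape_body_end [OF i, of r] lit_tape_body_end [OF j, of r]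
    by (auto simp: zread_zat)
  have sgn: "heads (?s out) 2 = heads (?s out) 3 \<longleftrightarrow> snd (ls ! i) = snd (ls ! j)"
    using lit_tape_body [OF i, of 0] lit_tape_body [OF j, of 0] len
    by (auto simp: zread_zat body_def)
  have step: "runs (moveR 2 ;; moveR 3) \<sigma> 3 (\<sigma>(2 := zat ?w (Suc p), 3 := zat ?w (Suc q)))"
    if "\<sigma> 2 = zat ?w p" "\<sigma> 3 = zat ?w q" "p < length ?w" "q < length ?w" for \<sigma> p q
  proof -
    have "runs (moveR 2) \<sigma> 1 (\<sigma>(2 := zat ?w (Suc p)))"
      using that by (intro runs_moveR) auto
    moreover have "runs (moveR 3) (\<sigma>(2 := zat ?w (Suc p))) 1 (\<sigma>(2 := zat ?w (Suc p), 3 := zat ?w (Suc q)))"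
      using that by (intro runs_moveR) auto
    ultimately have "runs (moveR 2 ;; moveR 3) \<sigma> (1 + 1 + 1) (\<sigma>(2 := zat ?w (Suc p), 3 := zat ?w (Suc q)))"
      by (rule runs_Seq)
    then show ?thesis by (rule runs_mono) simp
  qed
  have 1: "runs (moveR 2 ;; moveR 3) (?s out) 3 (?t 0)"
    using step [of "?s out" ?p ?q] len by simp
  have 2: "runs (While (Both (Same 2 3) (In 2 [1, 2])) (moveR 2 ;; moveR 3)) (?t 0) (c * (3 + 1) + 1) (?t c)"
  proof (rule runs_While)
    fix r assume r: "r < c"
    have "(?t r)(2 := zat ?w (Suc (?p + Suc r)), 3 := zat ?w (Suc (?q + Suc r))) = ?t (Suc r)"
      by (auto simp: fun_eq_iff)
    with step [of "?t r" "?p + Suc r" "?q + Suc r"] r c(1,2) len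
    have "runs (moveR 2 ;; moveR 3) (?t r) 3 (?t (Suc r))" by simp
    moreover have "holds (Both (Same 2 3) (In 2 [1, 2])) (heads (?t r))"
      using rd [of r] r c(1,2) c(3) by (simp add: nth_append)
    ultimately show "holds (Both (Same 2 3) (In 2 [1, 2])) (heads (?t r)) \<and>
        runs (moveR 2 ;; moveR 3) (?t r) 3 (?t (Suc r))" by blast
  next
    show "\<not> holds (Both (Same 2 3) (In 2 [1, 2])) (heads (?t c))"
      using rd [of c] c(4) by simp
  qed
  have 3: "runs (lit_start 2) (?t c) (2 * ?L + 5) ((?t c)(2 := zat ?w ?p))"
    by (rule runs_lit_start [where r = "Suc c" and i = i]) (use i c(1) in \<open>auto simp: body_def\<close>)
  have "((?t c)(2 := zat ?w ?p))(3 := zat ?w ?q) = ?s out"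
    by (auto simp: fun_eq_iff)
  with runs_lit_start [of "(?t c)(2 := zat ?w ?p)" 3 ls j "Suc c"] j c(2)
  have 4: "runs (lit_start 3) ((?t c)(2 := zat ?w ?p)) (2 * ?L + 5) (?s out)"
    by (simp add: body_def)
  show "runs conflict_test (?s out) (100 * size1 ls) (?s (out @ ?xl))"
  proof (cases "snd (ls ! i) = snd (ls ! j)")
    case True
    then have "?xl = []" by (simp add: enc_ext_def nx_conflict_def conflict_def)
    moreover have "runs conflict_test (?s out) (1 + 1) (?s out)"
      unfolding conflict_test_def
      by (rule runs_Branch) (use sgn True runs_Skip in simp)
    ultimately show ?thesis by (auto elim!: runs_mono)
  next
    case False
    have 5: "runs (Branch (Same 2 3) (lit_start 2 ;; lit_start 3 ;; emit_name False (0, 0, 5) (0, 0, 4))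
        (lit_start 2 ;; lit_start 3)) (?t c) (55 * size1 ls + 5 + 10) (?s (out @ ?xl))"
    proof (cases "?xs = ?ys")
      case True
      then have "fst (ls ! i) = fst (ls ! j)" by (rule inj_binary)
      with False have "?xl = enc_nat (nm (j, i) False)"
        by (simp add: enc_ext_def nx_conflict_def conflict_def)
      with emits_emit_name [of 5 j i j 4 i ls 0 0 0 0 w False] i j
      have "runs (emit_name False (0, 0, 5) (0, 0, 4)) (?s out) (50 * size1 ls) (?s (out @ ?xl))"
        by (simp add: emits_def)
      from runs_Seq [OF 3 runs_Seq [OF 4 this]] True rd [of c] c(5)
      have "runs (Branch (Same 2 3) (lit_start 2 ;; lit_start 3 ;; emit_name False (0, 0, 5) (0, 0, 4))
        (lit_start 2 ;; lit_start 3)) (?t c) (2 * ?L + 5 + (2 * ?L + 5 + 50 * size1 ls + 1) + 1 + 1) (?s (out @ ?xl))"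
        by (intro runs_Branch) simp
      then show ?thesis by (rule runs_mono) simp
    next
      case False
      then have "?xl = []"
        by (auto simp: enc_ext_def nx_conflict_def conflict_def)
      with runs_Seq [OF 3 4] False rd [of c] c(5)
      have "runs (Branch (Same 2 3) (lit_start 2 ;; lit_start 3 ;; emit_name False (0, 0, 5) (0, 0, 4))
        (lit_start 2 ;; lit_start 3)) (?t c) (2 * ?L + 5 + (2 * ?L + 5) + 1 + 1) (?s (out @ ?xl))"
        by (intro runs_Branch) simp
      then show ?thesis by (rule runs_mono) simp
    qed
    have "c \<le> ?L" using c(1) len(1) by (simp add: lit_tape_def)
    moreover have "runs conflict_test (?s out)
      (3 + (c * (3 + 1) + 1 + (55 * size1 ls + 5 + 10) + 1) + 1 + 1) (?s (out @ ?xl))"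
      unfolding conflict_test_def
      by (rule runs_Branch) (use sgn False runs_Seq [OF 1 runs_Seq [OF 2 5]] in simp)
    ultimately show ?thesis by (elim runs_mono) simp
  qed
qed

definition row_cell :: com where "row_cell = cell row_prev row_next"

lemma emits_row_cell:
  assumes "i < length ls" "j < length ls"
  shows "emits w ls i j row_cell
    (enc_list enc_nat (pref (nx_row (length ls)) (i, j) True) @
     enc_list enc_nat (pref (nx_row (length ls)) (i, j) False)) (500 * size1 ls)"
  unfolding row_cell_def
  by (rule emits_cell [where nx = "nx_row (length ls)", OF assms emits_row_prev [OF assms] emits_row_next [OF assms]])

definition conflict_cell :: com where "conflict_cell = cell Skip conflict_test"

lemma emits_conflict_cell:
  assumes "i < length ls" "j < length ls"
  shows "emits w ls i j conflict_cell
    (enc_list enc_nat (pref (nx_conflict ls) (i, j) True) @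
     enc_list enc_nat (pref (nx_conflict ls) (i, j) False)) (500 * size1 ls)"
  unfolding conflict_cell_def
proof (rule emits_cell [where nx = "nx_conflict ls", OF assms _ emits_conflict_test [OF assms]])
  show "emits w ls i j Skip (enc_ext (nx_conflict ls (i, j) True)) (100 * size1 ls)"
    using emits_Skip [of w ls i j] by (auto simp: nx_conflict_def enc_ext_def elim!: emits_mono)
qed

lemma st_upd:
  "(st w ls i j out)(2 := zat (lit_tape ls) (pos ls i'), 4 := ctr i') = st w ls i' j out"
  "(st w ls i j out)(3 := zat (lit_tape ls) (pos ls j'), 5 := ctr j') = st w ls i j' out"
  by (auto simp: st_def fun_eq_iff)

lemma emitsD: "emits w ls i j c xs T \<Longrightarrow> runs c (st w ls i j out) T (st w ls i j (out @ xs))"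
  by (simp add: emits_def)

section \<open>The loops over a row and over the grid\<close>

definition row :: "com \<Rightarrow> com" where
  "row c = While (In 3 [1, 2]) (c ;; next_lit 3 ;; inc 5) ;; rewind 3 ;; reset 5"

lemma length_le_size1: "length ls < size1 ls"
  using length_lit_word [of ls] by simp

text \<open>There are at most \<open>S\<close> rounds of at most \<open>510 * S\<close> steps.
  Rewinding and resetting are linear in \<open>S\<close> and fit into the gap up to 600.\<close>

lemma row_bound:
  fixes m L S :: nat
  assumes "m < S" "S = Suc L"
  shows "m * (500 * S + (2 * L + 3 + 1 + 1) + 1 + 1) + 1 + (2 * L + 5 + (2 * m + 5) + 1) + 1 \<le> 600 * S ^ 2"
proof -
  have "m * (500 * S + (2 * L + 3 + 1 + 1) + 1 + 1) \<le> S * (510 * S)"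
    using assms by (intro mult_mono) linarith+
  also have "\<dots> = 510 * S ^ 2" by (simp add: power2_eq_square)
  finally have "m * (500 * S + (2 * L + 3 + 1 + 1) + 1 + 1) \<le> 510 * S ^ 2" .
  moreover have "S \<le> S ^ 2" by (simp add: power2_eq_square)
  ultimately show ?thesis using assms by linarith
qed

lemma emits_row:
  assumes "\<And>j. j < length ls \<Longrightarrow> emits w ls i j c (g j) (500 * size1 ls)"
  shows "emits w ls i 0 (row c) (concat (map g [0..<length ls])) (600 * size1 ls ^ 2)"
  unfolding emits_def
proof
  fix out
  let ?m = "length ls" and ?L = "length (lit_word ls)" and ?S = "size1 ls"
  let ?s = "\<lambda>j. st w ls i j (out @ concat (map g [0..<j]))"
  let ?T = "500 * ?S + (2 * ?L + 3 + 1 + 1) + 1"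
  let ?w = "lit_tape ls"
  have 1: "runs (While (In 3 [1, 2]) (c ;; next_lit 3 ;; inc 5)) (?s 0) (?m * (?T + 1) + 1) (?s ?m)"
  proof (rule runs_While)
    fix j assume j: "j < ?m"
    let ?t = "st w ls i j (out @ concat (map g [0..<Suc j]))"
    have "runs c (?s j) (500 * ?S) ?t"
      using emitsD [OF assms [OF j], of "out @ concat (map g [0..<j])"] by simp
    moreover have "runs (next_lit 3) ?t (2 * ?L + 3) (?t(3 := zat ?w (pos ls (Suc j))))"
      by (rule runs_next_lit) (use j in auto)
    moreover have "runs (inc 5) (?t(3 := zat ?w (pos ls (Suc j)))) 1
        (?t(3 := zat ?w (pos ls (Suc j)), 5 := ctr (Suc j)))"
      by (rule runs_inc) simp
    ultimately have "runs (c ;; next_lit 3 ;; inc 5) (?s j) ?T (?s (Suc j))"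
      unfolding st_upd by (intro runs_Seq)
    moreover have "holds (In 3 [1, 2]) (heads (?s j))"
      using zread_pos [of j ls] j by simp
    ultimately show "holds (In 3 [1, 2]) (heads (?s j)) \<and> runs (c ;; next_lit 3 ;; inc 5) (?s j) ?T (?s (Suc j))"
      by blast
  next
    show "\<not> holds (In 3 [1, 2]) (heads (?s ?m))"
      using zread_pos [of ?m ls] by simp
  qed
  have 2: "runs (rewind 3) (?s ?m) (2 * ?L + 5) ((?s ?m)(3 := zat ?w (pos ls 0)))"
    unfolding pos_0 by (rule runs_rewind) (simp add: pos_length)
  have 3: "runs (reset 5) ((?s ?m)(3 := zat ?w (pos ls 0))) (2 * ?m + 5)
      ((?s ?m)(3 := zat ?w (pos ls 0), 5 := ctr 0))"
    by (rule runs_reset) simp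
  have "runs (row c) (?s 0) (?m * (?T + 1) + 1 + (2 * ?L + 5 + (2 * ?m + 5) + 1) + 1)
      (st w ls i 0 (out @ concat (map g [0..<?m])))"
    using runs_Seq [OF 1 runs_Seq [OF 2 3]] unfolding st_upd row_def .
  moreover have "?m * (?T + 1) + 1 + (2 * ?L + 5 + (2 * ?m + 5) + 1) + 1 \<le> 600 * ?S ^ 2"
    by (rule row_bound [OF length_le_size1 refl])
  ultimately show "runs (row c) (st w ls i 0 out) (600 * ?S ^ 2)
      (st w ls i 0 (out @ concat (map g [0..<?m])))"
    by (auto elim: runs_mono)
qed

definition grid_step :: "com \<Rightarrow> com" where
  "grid_step c = row c ;; next_lit 2 ;; inc 4"

text \<open>Unrolling three rows per round makes the position of a literal in its clause known
  statically. The end of tape 2 is tested once per clause, hence the divisibility by 3 in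
  \<open>emits_grid\<close>.\<close>

definition grid :: "(nat \<Rightarrow> com) \<Rightarrow> com" where
  "grid c = While (In 2 [1, 2]) (grid_step (c 0) ;; grid_step (c 1) ;; grid_step (c 2)) ;;
     rewind 2 ;; reset 4"

lemma runs_grid_step:
  assumes "i < length ls"
    and "\<And>j. j < length ls \<Longrightarrow> emits w ls i j c (g j) (500 * size1 ls)"
  shows "runs (grid_step c) (st w ls i 0 out) (610 * size1 ls ^ 2)
    (st w ls (Suc i) 0 (out @ concat (map g [0..<length ls])))"
proof -
  let ?L = "length (lit_word ls)" and ?S = "size1 ls"
  let ?t = "st w ls i 0 (out @ concat (map g [0..<length ls]))"
  let ?w = "lit_tape ls"
  have 1: "runs (row c) (st w ls i 0 out) (600 * ?S ^ 2) ?t"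
    using emits_row [of ls w i c g] assms(2) by (auto simp: emits_def)
  have 2: "runs (next_lit 2) ?t (2 * ?L + 3) (?t(2 := zat ?w (pos ls (Suc i))))"
    by (rule runs_next_lit) (use assms(1) in auto)
  have 3: "runs (inc 4) (?t(2 := zat ?w (pos ls (Suc i)))) 1 (?t(2 := zat ?w (pos ls (Suc i)), 4 := ctr (Suc i)))"
    by (rule runs_inc) simp
  have "?S \<le> ?S ^ 2" by (simp add: power2_eq_square)
  then have "600 * ?S ^ 2 + (2 * ?L + 3 + 1 + 1) + 1 \<le> 610 * ?S ^ 2" by simp
  with runs_Seq [OF 1 runs_Seq [OF 2 3]] show ?thesis
    unfolding st_upd grid_step_def by (rule runs_mono)
qed

definition cells :: "nat \<Rightarrow> idx list" where
  "cells m = List.product [0..<m] [0..<m]"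

lemma concat_cells:
  "concat (map (\<lambda>i. concat (map (\<lambda>j. g (i, j)) [0..<m])) [0..<m]) = concat (map g (cells m))"
proof -
  have "concat (map (\<lambda>i. concat (map (\<lambda>j. g (i, j)) ys)) xs) = concat (map g (List.product xs ys))" for xs ys
    by (induction xs) (auto simp: o_def)
  then show ?thesis by (simp add: cells_def)
qed

lemma grid_bound:
  fixes n m L S :: nat
  assumes "m < S" "n \<le> m" "S = Suc L"
  shows "n * (610 * S ^ 2 + (610 * S ^ 2 + 610 * S ^ 2 + 1) + 1 + 1) + 1 +
    (2 * L + 5 + (2 * m + 5) + 1) + 1 \<le> 1900 * S ^ 3"
proof -
  have s: "1 \<le> S ^ 2" using assms by simp
  have "n * (610 * S ^ 2 + (610 * S ^ 2 + 610 * S ^ 2 + 1) + 1 + 1) \<le> S * (1840 * S ^ 2)"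
    using assms s by (intro mult_mono) linarith+
  also have "\<dots> = 1840 * S ^ 3" by (simp add: power2_eq_square power3_eq_cube)
  finally have "n * (610 * S ^ 2 + (610 * S ^ 2 + 610 * S ^ 2 + 1) + 1 + 1) \<le> 1840 * S ^ 3" .
  moreover have "S \<le> S ^ 3" by (simp add: power3_eq_cube)
  ultimately show ?thesis using assms by linarith
qed

lemma emits_grid:
  assumes "3 dvd length ls"
    and "\<And>i j. i < length ls \<Longrightarrow> j < length ls \<Longrightarrow>
      emits w ls i j (c (i mod 3)) (g (i, j)) (500 * size1 ls)"
  shows "emits w ls 0 0 (grid c) (concat (map g (cells (length ls)))) (1900 * size1 ls ^ 3)"
  unfolding emits_def
proof
  fix out
  let ?m = "length ls" and ?L = "length (lit_word ls)" and ?S = "size1 ls"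
  let ?r = "\<lambda>i. concat (map (\<lambda>j. g (i, j)) [0..<?m])"
  let ?s = "\<lambda>i. st w ls i 0 (out @ concat (map ?r [0..<i]))"
  let ?T = "610 * ?S ^ 2 + (610 * ?S ^ 2 + 610 * ?S ^ 2 + 1) + 1"
  let ?w = "lit_tape ls"
  let ?c = "grid_step (c 0) ;; grid_step (c 1) ;; grid_step (c 2)"
  obtain n where n: "?m = 3 * n" using assms(1) by (elim dvdE)
  have step: "runs (grid_step (c (i mod 3))) (?s i) (610 * ?S ^ 2) (?s (Suc i))" if "i < ?m" for i
    using runs_grid_step [OF that assms(2) [OF that], of "out @ concat (map ?r [0..<i])"] by simp
  have "runs (While (In 2 [1, 2]) ?c) (?s (3 * 0)) (n * (?T + 1) + 1) (?s (3 * n))"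
  proof (rule runs_While [where s = "\<lambda>k. ?s (3 * k)"])
    fix k assume k: "k < n"
    have mods: "3 * k mod 3 = 0" "Suc (3 * k) mod 3 = 1" "Suc (Suc (3 * k)) mod 3 = 2"
      by presburger+
    have lt: "3 * k < ?m" "Suc (3 * k) < ?m" "Suc (Suc (3 * k)) < ?m"
      using k n by linarith+
    have "3 * Suc k = Suc (Suc (Suc (3 * k)))" by simp
    with runs_Seq [OF step [OF lt(1), unfolded mods] runs_Seq [OF step [OF lt(2), unfolded mods]
        step [OF lt(3), unfolded mods]]]
    have "runs ?c (?s (3 * k)) ?T (?s (3 * Suc k))" by (simp only:)
    moreover have "holds (In 2 [1, 2]) (heads (?s (3 * k)))"
      using zread_pos [of "3 * k" ls] k n by simp
    ultimately show "holds (In 2 [1, 2]) (heads (?s (3 * k))) \<and> runs ?c (?s (3 * k)) ?T (?s (3 * Suc k))"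
      by blast
  next
    show "\<not> holds (In 2 [1, 2]) (heads (?s (3 * n)))"
      using zread_pos [of ?m ls] n by simp
  qed
  then have 1: "runs (While (In 2 [1, 2]) ?c) (?s 0) (n * (?T + 1) + 1) (?s ?m)"
    by (simp only: n mult_0_right)
  have 2: "runs (rewind 2) (?s ?m) (2 * ?L + 5) ((?s ?m)(2 := zat ?w (pos ls 0)))"
    unfolding pos_0 by (rule runs_rewind) (simp add: pos_length)
  have 3: "runs (reset 4) ((?s ?m)(2 := zat ?w (pos ls 0))) (2 * ?m + 5)
      ((?s ?m)(2 := zat ?w (pos ls 0), 4 := ctr 0))"
    by (rule runs_reset) simp
  have "runs (grid c) (?s 0) (n * (?T + 1) + 1 + (2 * ?L + 5 + (2 * ?m + 5) + 1) + 1)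
      (st w ls 0 0 (out @ concat (map ?r [0..<?m])))"
    using runs_Seq [OF 1 runs_Seq [OF 2 3]] unfolding st_upd grid_def .
  moreover have "n * (?T + 1) + 1 + (2 * ?L + 5 + (2 * ?m + 5) + 1) + 1 \<le> 1900 * ?S ^ 3"
    using n by (intro grid_bound [OF length_le_size1 _ refl]) simp
  ultimately have "runs (grid c) (?s 0) (1900 * ?S ^ 3) (st w ls 0 0 (out @ concat (map ?r [0..<?m])))"
    by (rule runs_mono)
  then show "runs (grid c) (st w ls 0 0 out) (1900 * ?S ^ 3)
      (st w ls 0 0 (out @ concat (map g (cells ?m))))"
    by (simp add: concat_cells)
qed

section \<open>Reading the formula\<close>

definition copy_literals :: com where
  "copy_literals = While (In 0 [1, 2, 3, 4, 5])
     (Branch (In 0 [1, 2, 3]) (Put 2 (Read 0) Go_Right ;; Put 3 (Read 0) Go_Right) Skip ;; moveR 0)"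

definition init :: com where
  "init = Put 2 (Const 4) Go_Right ;; Put 3 (Const 4) Go_Right ;; Put 4 (Const 4) Go_Right ;;
     Put 5 (Const 4) Go_Right ;; copy_literals ;; rewind 2 ;; rewind 3"

text \<open>Codes of literals use only the symbols 1 to 3, so dropping the brackets leaves exactly
  the literals. For clauses of length 3 the boundaries are recovered from the indices.\<close>

lemma filter_enc_cnf: "filter (\<lambda>x. x \<in> {1, 2, 3}) (enc_cnf \<phi>) = lit_word (concat \<phi>)"
proof -
  let ?P = "\<lambda>x :: nat. x \<in> {1, 2, 3}"
  have lit: "filter ?P (enc_literal l) = enc_literal l" for l
    using set_enc_literal by (intro filter_True) blast
  have "filter ?P (concat (map enc_literal C)) = lit_word C" for C
    by (induction C) (simp_all add: lit_word_def lit del: insert_iff One_nat_def)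
  then have clause: "filter ?P (enc_list enc_literal C) = lit_word C" for C
    by (simp add: enc_list_def)
  have "filter ?P (concat (map (enc_list enc_literal) \<phi>)) = lit_word (concat \<phi>)"
    by (induction \<phi>) (simp_all add: clause lit_word_def del: insert_iff One_nat_def)
  then show ?thesis by (simp add: enc_cnf_def enc_list_def)
qed

lemma set_enc_cnf: "set (enc_cnf \<phi>) \<subseteq> {1, 2, 3, 4, 5}"
  by (auto simp: enc_cnf_def enc_list_def dest!: subsetD [OF set_enc_literal])

lemma runs_copy_literals:
  fixes \<phi> :: cnf
  assumes "\<sigma> 0 = zat (enc_cnf \<phi>) 0" "\<sigma> 2 = ([4], [])" "\<sigma> 3 = ([4], [])"
  defines "w \<equiv> enc_cnf \<phi>" and "t \<equiv> lit_tape (concat \<phi>)"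
  shows "runs copy_literals \<sigma> (7 * length w + 1)
    (\<sigma>(0 := zat w (length w), 2 := zat t (length t), 3 := zat t (length t)))"
proof -
  define P where "P = (\<lambda>x :: nat. x \<in> {1, 2, 3})"
  let ?z = "\<lambda>n. (rev (filter P (take n w)) @ [4], [])"
  let ?s = "\<lambda>n. \<sigma>(0 := zat w n, 2 := ?z n, 3 := ?z n)"
  have nz: "0 \<notin> set w" using set_enc_cnf [of \<phi>] by (auto simp: w_def)
  have "runs copy_literals (?s 0) (length w * (6 + 1) + 1) (?s (length w))"
    unfolding copy_literals_def
  proof (rule runs_While)
    fix n assume n: "n < length w"
    have w: "w ! n \<in> {1, 2, 3, 4, 5}"
      using n set_enc_cnf [of \<phi>] nth_mem unfolding w_def by blast
    have zr: "zread (zat w n) = w ! n" using n by (simp add: zread_zat)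
    then have rd: "heads (?s n) 0 = w ! n" by simp
    let ?t = "\<sigma>(0 := zat w n, 2 := ?z (Suc n), 3 := ?z (Suc n))"
    have copy: "runs (Branch (In 0 [1, 2, 3]) (Put 2 (Read 0) Go_Right ;; Put 3 (Read 0) Go_Right) Skip) (?s n) (3 + 1) ?t"
    proof (rule runs_Branch)
      show "runs (if holds (In 0 [1, 2, 3]) (heads (?s n))
          then Put 2 (Read 0) Go_Right ;; Put 3 (Read 0) Go_Right else Skip) (?s n) 3 ?t"
      proof (cases "P (w ! n)")
        case True
        let ?u = "\<sigma>(0 := zat w n, 2 := ?z (Suc n), 3 := ?z n)"
        have w0: "w ! n \<noteq> 0" using True by (auto simp: P_def)
        have z: "filter P (take (Suc n) w) = filter P (take n w) @ [w ! n]"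
          using True n by (simp add: take_Suc_conv_app_nth)
        have "runs (Put 2 (Read 0) Go_Right) (?s n) 1 ?u"
          by (rule runs_Put) (simp_all add: fun_eq_iff z zr w0)
        moreover have "runs (Put 3 (Read 0) Go_Right) ?u 1 ?t"
          by (rule runs_Put) (simp_all add: fun_eq_iff z zr w0)
        ultimately have "runs (Put 2 (Read 0) Go_Right ;; Put 3 (Read 0) Go_Right) (?s n) (1 + 1 + 1) ?t"
          by (rule runs_Seq)
        then have "runs (Put 2 (Read 0) Go_Right ;; Put 3 (Read 0) Go_Right) (?s n) 3 ?t"
          by (rule runs_mono) simp
        with True rd show ?thesis by (simp add: P_def)
      next
        case False
        with n have "?s n = ?t" by (simp add: take_Suc_conv_app_nth)
        then have "runs Skip (?s n) 3 ?t"
          using runs_mono [OF runs_Skip [of "?s n"], of 3] by simp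
        with False rd show ?thesis by (simp add: P_def)
      qed
    qed
    have advance: "runs (moveR 0) ?t 1 (?t(0 := zat w (Suc n)))"
      by (rule runs_moveR) (use n nz in auto)
    have eq: "?t(0 := zat w (Suc n)) = ?s (Suc n)"
      by (auto simp: fun_eq_iff)
    have "runs (Branch (In 0 [1, 2, 3]) (Put 2 (Read 0) Go_Right ;; Put 3 (Read 0) Go_Right) Skip ;; moveR 0)
        (?s n) 6 (?s (Suc n))"
      by (rule runs_mono [OF runs_Seq [OF copy advance, unfolded eq]]) simp
    with rd w show "holds (In 0 [1, 2, 3, 4, 5]) (heads (?s n)) \<and>
      runs (Branch (In 0 [1, 2, 3]) (Put 2 (Read 0) Go_Right ;; Put 3 (Read 0) Go_Right) Skip ;; moveR 0)
        (?s n) 6 (?s (Suc n))"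
      by simp
  next
    show "\<not> holds (In 0 [1, 2, 3, 4, 5]) (heads (?s (length w)))"
      by (simp add: zread_zat)
  qed
  moreover have "?s 0 = \<sigma>" using assms by (auto simp: fun_eq_iff)
  moreover have "?z (length w) = zat t (length t)"
    using filter_enc_cnf [of \<phi>] by (simp only: w_def t_def lit_tape_def zat_def P_def) simp
  ultimately show ?thesis by (simp add: mult.commute)
qed

lemma length_lit_word_enc_cnf: "length (lit_word (concat \<phi>)) \<le> length (enc_cnf \<phi>)"
  using length_filter_le [of "\<lambda>x. x \<in> {1, 2, 3}" "enc_cnf \<phi>"] by (simp only: filter_enc_cnf)

lemma runs_init:
  fixes \<phi> :: cnf
  defines "w \<equiv> enc_cnf \<phi>"
  shows "runs init (initial w) (30 * Suc (length w)) (st (zat w (length w)) (concat \<phi>) 0 0 [])"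
proof -
  let ?t = "lit_tape (concat \<phi>)"
  let ?\<sigma> = "(initial w)(2 := ([4], []), 3 := ([4], []), 4 := ([4], []), 5 := ([4], []))"
  have init4: "runs (Put 2 (Const 4) Go_Right) (initial w) 1 ((initial w)(2 := ([4], [])))"
    "runs (Put 3 (Const 4) Go_Right) ((initial w)(2 := ([4], []))) 1 ((initial w)(2 := ([4], []), 3 := ([4], [])))"
    "runs (Put 4 (Const 4) Go_Right) ((initial w)(2 := ([4], []), 3 := ([4], []))) 1
       ((initial w)(2 := ([4], []), 3 := ([4], []), 4 := ([4], [])))"
    "runs (Put 5 (Const 4) Go_Right) ((initial w)(2 := ([4], []), 3 := ([4], []), 4 := ([4], []))) 1 ?\<sigma>"
    by (rule runs_Put; simp add: initial_def)+
  let ?\<tau> = "?\<sigma>(0 := zat w (length w), 2 := zat ?t (length ?t), 3 := zat ?t (length ?t))"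
  have c: "runs copy_literals ?\<sigma> (7 * length w + 1) ?\<tau>"
    unfolding w_def by (rule runs_copy_literals) (simp_all add: initial_def zat_def w_def)
  have r2: "runs (rewind 2) ?\<tau> (2 * length (lit_word (concat \<phi>)) + 5) (?\<tau>(2 := zat ?t 1))"
    by (rule runs_rewind) simp
  have r3: "runs (rewind 3) (?\<tau>(2 := zat ?t 1)) (2 * length (lit_word (concat \<phi>)) + 5)
      (?\<tau>(2 := zat ?t 1, 3 := zat ?t 1))"
    by (rule runs_rewind) simp
  have "?\<tau>(2 := zat ?t 1, 3 := zat ?t 1) = st (zat w (length w)) (concat \<phi>) 0 0 []"
    by (auto simp: fun_eq_iff st_def initial_def ctr_def zat_def)
  with runs_Seq [OF init4(1) runs_Seq [OF init4(2) runs_Seq [OF init4(3) runs_Seq [OF init4(4)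
    runs_Seq [OF c runs_Seq [OF r2 r3]]]]]]
  show ?thesis
    unfolding init_def
    using length_lit_word_enc_cnf [of \<phi>] by (auto simp: w_def elim!: runs_mono)
qed

section \<open>Assembling the encoded instance\<close>

definition node_names :: "nat \<Rightarrow> nat list" where
  "node_names m = concat (map (\<lambda>o1. [nm o1 True, nm o1 False]) (cells m))"

definition node_prefs :: "nat \<Rightarrow> (idx \<Rightarrow> bool \<Rightarrow> idx option) \<Rightarrow> nat list list" where
  "node_prefs m nx = concat (map (\<lambda>o1. [pref nx o1 True, pref nx o1 False]) (cells m))"

text \<open>As the list of agent 0 these items make the maximal length exactly 3 even for the empty
  formula, whose grid has no cells.\<close>

abbreviation "spare_items \<equiv> [0, 1, 2 :: nat]"

definition layer :: "com \<Rightarrow> (nat \<Rightarrow> com) \<Rightarrow> com" where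
  "layer z c = emit [4] ;; z ;; grid c ;; emit [5]"

definition name_list :: "nat list \<Rightarrow> com" where
  "name_list xs = emit (4 # concat (map enc_nat xs)) ;; grid (\<lambda>_. names) ;; emit [5]"

lemma concat_map_pairs:
  "concat (map f (concat (map (\<lambda>x. [g x, h x]) xs))) = concat (map (\<lambda>x. f (g x) @ f (h x)) xs)"
  by (induction xs) auto

lemma concat_enc_node_names:
  "concat (map enc_nat (node_names m)) =
    concat (map (\<lambda>o1. enc_nat (nm o1 True) @ enc_nat (nm o1 False)) (cells m))"
  by (simp add: node_names_def concat_map_pairs)

lemma enc_nat_nz: "0 \<notin> set (enc_nat n)"
  using set_binary [of n] by (auto simp: enc_nat_def)

lemma emits_grid_names:
  assumes "3 dvd length ls"
  shows "emits w ls 0 0 (grid (\<lambda>_. names)) (concat (map enc_nat (node_names (length ls)))) (1900 * size1 ls ^ 3)"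
  unfolding concat_enc_node_names
  by (rule emits_grid [OF assms]) (erule (1) emits_names)

lemma one_le_cube: "1 \<le> size1 ls ^ 3"
  by simp

lemma emits_emit_single: "x \<noteq> 0 \<Longrightarrow> emits w ls i j (emit [x]) [x] 3"
  using emits_emit [of "[x]" w ls i j] by (simp del: emit.simps)

lemma emits_name_list:
  assumes "3 dvd length ls" "set xs \<subseteq> {0, 1, 2}" "length xs \<le> 3"
  shows "emits w ls 0 0 (name_list xs) (enc_list enc_nat (xs @ node_names (length ls))) (2000 * size1 ls ^ 3)"
proof -
  let ?e = "concat (map enc_nat xs)"
  have "length (enc_nat x) \<le> 3" if "x \<in> set xs" for x
    using that assms(2) by (auto simp: enc_nat_def binary.simps)
  then have "sum_list (map (\<lambda>x. length (enc_nat x)) xs) \<le> sum_list (map (\<lambda>_. 3) xs)"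
    by (intro sum_list_mono)
  then have len: "length ?e \<le> 9"
    using assms(3) by (simp add: length_concat o_def sum_list_triv)
  have "emits w ls 0 0 (emit (4 # ?e)) (4 # ?e) (2 * length (4 # ?e) + 1)"
    by (rule emits_emit) (use enc_nat_nz in auto)
  then have 1: "emits w ls 0 0 (emit (4 # ?e)) (4 # ?e) 21"
    by (rule emits_mono) (use len in simp)
  have 2: "emits w ls 0 0 (emit [5]) [5] 3"
    by (rule emits_emit_single) simp
  have le: "21 + (1900 * size1 ls ^ 3 + 3 + 1) + 1 \<le> 2000 * size1 ls ^ 3"
    using one_le_cube [of ls] by linarith
  have eq: "enc_list enc_nat (xs @ node_names (length ls)) =
      (4 # ?e) @ concat (map enc_nat (node_names (length ls))) @ [5]"
    by (simp add: enc_list_def)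
  show ?thesis
    unfolding name_list_def eq
    by (rule emits_mono [OF emits_Seq [OF 1 emits_Seq [OF emits_grid_names [OF assms(1)] 2]] le])
qed

lemma concat_enc_node_prefs:
  "concat (map (enc_list enc_nat) (node_prefs m nx)) =
    concat (map (\<lambda>o1. enc_list enc_nat (pref nx o1 True) @ enc_list enc_nat (pref nx o1 False)) (cells m))"
  by (simp add: node_prefs_def concat_map_pairs)

lemma emits_layer:
  assumes "3 dvd length ls"
    and "emits w ls 0 0 z (enc_list enc_nat zs) (2000 * size1 ls ^ 3)"
    and "\<And>i j. i < length ls \<Longrightarrow> j < length ls \<Longrightarrow> emits w ls i j (c (i mod 3))
      (enc_list enc_nat (pref nx (i, j) True) @ enc_list enc_nat (pref nx (i, j) False)) (500 * size1 ls)"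
  shows "emits w ls 0 0 (layer z c)
    (enc_list (enc_list enc_nat) (zs # node_prefs (length ls) nx)) (5000 * size1 ls ^ 3)"
proof -
  have 1: "emits w ls 0 0 (emit [4]) [4] 3"
    by (rule emits_emit_single) simp
  have 2: "emits w ls 0 0 (emit [5]) [5] 3"
    by (rule emits_emit_single) simp
  have g: "emits w ls 0 0 (grid c) (concat (map (enc_list enc_nat) (node_prefs (length ls) nx))) (1900 * size1 ls ^ 3)"
    unfolding concat_enc_node_prefs by (rule emits_grid [OF assms(1)]) (rule assms(3))
  have le: "3 + (2000 * size1 ls ^ 3 + (1900 * size1 ls ^ 3 + 3 + 1) + 1) + 1 \<le> 5000 * size1 ls ^ 3"
    using one_le_cube [of ls] by linarith
  have eq: "enc_list (enc_list enc_nat) (zs # node_prefs (length ls) nx) =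
      [4] @ enc_list enc_nat zs @ concat (map (enc_list enc_nat) (node_prefs (length ls) nx)) @ [5]"
    by (simp add: enc_list_def)
  show ?thesis
    unfolding layer_def eq
    by (rule emits_mono [OF emits_Seq [OF 1 emits_Seq [OF assms(2) emits_Seq [OF g 2]]] le])
qed

definition spare_list :: com where
  "spare_list = emit (enc_list enc_nat spare_items)"

lemma emits_spare_list: "emits w ls 0 0 spare_list (enc_list enc_nat spare_items) (2000 * size1 ls ^ 3)"
proof -
  have "emits w ls 0 0 spare_list (enc_list enc_nat spare_items) (2 * length (enc_list enc_nat spare_items) + 1)"
    unfolding spare_list_def
    by (rule emits_emit) (use enc_nat_nz in \<open>auto simp: enc_list_def\<close>)
  moreover have "length (enc_list enc_nat spare_items) = 8"
    by (simp add: enc_list_def enc_nat_def binary.simps)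
  then have "2 * length (enc_list enc_nat spare_items) + 1 \<le> 2000 * size1 ls ^ 3"
    using one_le_cube [of ls] by linarith
  ultimately show ?thesis
    by (rule emits_mono)
qed

definition layers :: "literal list \<Rightarrow> nat list list list" where
  "layers ls = map (\<lambda>nx. spare_items # node_prefs (length ls) nx)
     [nx_clause, nx_row (length ls), nx_conflict ls]"

definition extra_layer :: "literal list \<Rightarrow> nat list list" where
  "extra_layer ls = (spare_items @ node_names (length ls)) # node_prefs (length ls) (nx_conflict ls)"

definition goa_word :: "literal list \<Rightarrow> nat list list list \<Rightarrow> nat \<Rightarrow> nat list" where
  "goa_word ls xs k = enc_list enc_nat (0 # node_names (length ls)) @
     enc_list enc_nat (spare_items @ node_names (length ls)) @
     enc_list (enc_list (enc_list enc_nat)) xs @ enc_nat k"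

text \<open>The bracket around the list of layers is opened here and closed in
  \<open>closing\<close>, so that a fourth layer can be inserted in between.\<close>

definition preamble :: com where
  "preamble = name_list [0] ;; name_list spare_items ;; emit [4] ;; layer spare_list clause_cell ;;
     layer spare_list (\<lambda>_. row_cell) ;; layer spare_list (\<lambda>_. conflict_cell)"

definition closing :: "nat \<Rightarrow> com" where
  "closing k = emit (5 # enc_nat k)"

lemma emits_preamble:
  assumes "3 dvd length ls"
  shows "emits w ls 0 0 preamble (enc_list enc_nat (0 # node_names (length ls)) @
     enc_list enc_nat (spare_items @ node_names (length ls)) @ [4] @
     concat (map (enc_list (enc_list enc_nat)) (layers ls))) (20000 * size1 ls ^ 3)"
proof -
  have 1: "emits w ls 0 0 (emit [4]) [4] 3"
    by (rule emits_emit_single) simp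
  have a: "emits w ls 0 0 (name_list [0]) (enc_list enc_nat (0 # node_names (length ls))) (2000 * size1 ls ^ 3)"
    using emits_name_list [OF assms, of "[0]" w] by simp
  have b: "emits w ls 0 0 (name_list spare_items) (enc_list enc_nat (spare_items @ node_names (length ls))) (2000 * size1 ls ^ 3)"
    by (rule emits_name_list [OF assms]) auto
  note l1 = emits_layer [OF assms emits_spare_list emits_clause_cell]
  note l2 = emits_layer [OF assms emits_spare_list emits_row_cell]
  note l3 = emits_layer [OF assms emits_spare_list emits_conflict_cell]
  define C where "C = size1 ls ^ 3"
  have "1 \<le> C" by (simp add: C_def)
  then have "2000 * C + (2000 * C + (3 + (5000 * C + (5000 * C + 5000 * C + 1) + 1) + 1) + 1) + 1 \<le> 20000 * C"
    by linarith
  note le = this [unfolded C_def]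
  note all = emits_Seq [OF a emits_Seq [OF b emits_Seq [OF 1 emits_Seq [OF l1 emits_Seq [OF l2 l3]]]]]
  have eq: "enc_list enc_nat (0 # node_names (length ls)) @
     enc_list enc_nat (spare_items @ node_names (length ls)) @ [4] @
     concat (map (enc_list (enc_list enc_nat)) (layers ls)) =
     enc_list enc_nat (0 # node_names (length ls)) @
     enc_list enc_nat (spare_items @ node_names (length ls)) @ [4] @
     enc_list (enc_list enc_nat) (spare_items # node_prefs (length ls) nx_clause) @
     enc_list (enc_list enc_nat) (spare_items # node_prefs (length ls) (nx_row (length ls))) @
     enc_list (enc_list enc_nat) (spare_items # node_prefs (length ls) (nx_conflict ls))"
    by (simp add: layers_def)
  show ?thesis
    unfolding preamble_def eq
    by (rule emits_mono [OF all le])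
qed

lemma emits_closing: "k \<le> 4 \<Longrightarrow> emits w ls 0 0 (closing k) (5 # enc_nat k) 11"
proof -
  assume "k \<le> 4"
  then have "k \<in> {0, 1, 2, 3, 4}" by auto
  then have len: "2 * length (5 # enc_nat k) + 1 \<le> 11"
    by (auto simp: enc_nat_def binary.simps)
  have "emits w ls 0 0 (closing k) (5 # enc_nat k) (2 * length (5 # enc_nat k) + 1)"
    unfolding closing_def by (rule emits_emit) (use enc_nat_nz in auto)
  then show ?thesis using len by (rule emits_mono)
qed

definition program3 :: com where
  "program3 = init ;; preamble ;; closing 3"

definition program4 :: com where
  "program4 = init ;; preamble ;; layer (name_list spare_items) (\<lambda>_. conflict_cell) ;; closing 4"

lemma emits_body3:
  assumes "3 dvd length ls"
  shows "emits w ls 0 0 (preamble ;; closing 3) (goa_word ls (layers ls) 3) (30000 * size1 ls ^ 3)"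
proof -
  have eq: "goa_word ls (layers ls) 3 = (enc_list enc_nat (0 # node_names (length ls)) @
     enc_list enc_nat (spare_items @ node_names (length ls)) @ [4] @
     concat (map (enc_list (enc_list enc_nat)) (layers ls))) @ 5 # enc_nat 3"
    by (simp add: goa_word_def enc_list_def [of _ "layers ls"])
  show ?thesis
    unfolding eq
    by (rule emits_mono [OF emits_Seq [OF emits_preamble [OF assms] emits_closing]])
      (use one_le_cube [of ls] in linarith)+
qed

lemma emits_body4:
  assumes "3 dvd length ls"
  shows "emits w ls 0 0 (preamble ;; layer (name_list spare_items) (\<lambda>_. conflict_cell) ;; closing 4)
    (goa_word ls (layers ls @ [extra_layer ls]) 4) (30000 * size1 ls ^ 3)"
proof -
  have n: "emits w ls 0 0 (name_list spare_items) (enc_list enc_nat (spare_items @ node_names (length ls))) (2000 * size1 ls ^ 3)"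
    by (rule emits_name_list [OF assms]) auto
  note l = emits_layer [OF assms n emits_conflict_cell]
  have eq: "goa_word ls (layers ls @ [extra_layer ls]) 4 = (enc_list enc_nat (0 # node_names (length ls)) @
     enc_list enc_nat (spare_items @ node_names (length ls)) @ [4] @
     concat (map (enc_list (enc_list enc_nat)) (layers ls))) @
     enc_list (enc_list enc_nat) (extra_layer ls) @ 5 # enc_nat 4"
    by (simp add: goa_word_def enc_list_def [of _ "layers ls @ [extra_layer ls]"])
  show ?thesis
    unfolding eq unfolding extra_layer_def
    by (rule emits_mono [OF emits_Seq [OF emits_preamble [OF assms] emits_Seq [OF l emits_closing]]])
      (use one_le_cube [of ls] in \<open>simp; linarith\<close>)+
qed

text \<open>Printing is cubic in the size of the literal word, which is at most the length of the
  input. Raising 30000 to 40000 absorbs the linear time of \<open>init\<close>.\<close>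

lemma runs_program:
  assumes "emits (zat (enc_cnf \<phi>) (length (enc_cnf \<phi>))) (concat \<phi>) 0 0 c xs (30000 * size1 (concat \<phi>) ^ 3)"
  shows "\<exists>\<sigma>. \<sigma> 1 = (rev xs, []) \<and>
    runs (init ;; c) (initial (enc_cnf \<phi>)) (poly ([:40000:] * [:1, 1:] ^ 3) (length (enc_cnf \<phi>))) \<sigma>"
proof (intro exI conjI)
  let ?n = "length (enc_cnf \<phi>)" and ?S = "size1 (concat \<phi>)"
  let ?w = "zat (enc_cnf \<phi>) ?n"
  define C D m where "C = ?S ^ 3" "D = Suc ?n ^ 3" "m = Suc ?n"
  have "C \<le> D"
    unfolding C_D_m_def using length_lit_word_enc_cnf [of \<phi>] by (intro power_mono) auto
  moreover have "m \<le> D" "1 \<le> m"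
    unfolding C_D_m_def by (simp_all add: power3_eq_cube)
  ultimately have "30 * m + 30000 * C + 1 \<le> 40000 * D"
    by linarith
  then have "30 * Suc ?n + 30000 * ?S ^ 3 + 1 \<le> 40000 * Suc ?n ^ 3"
    unfolding C_D_m_def .
  moreover have "poly ([:40000:] * [:1, 1:] ^ 3) ?n = 40000 * Suc ?n ^ 3"
    by (simp add: poly_power)
  ultimately show "runs (init ;; c) (initial (enc_cnf \<phi>)) (poly ([:40000:] * [:1, 1:] ^ 3) ?n) (st ?w (concat \<phi>) 0 0 xs)"
    using runs_Seq [OF runs_init emitsD [OF assms, of "[]"]] by (auto elim!: runs_mono)
qed simp

section \<open>Well-formedness over six tapes and six symbols\<close>

lemma wf_emit: "\<forall>x \<in> set xs. x < 6 \<Longrightarrow> wf_com 6 6 (emit xs)"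
  by (induction xs) auto

lemma wf_enc_nat: "x \<in> set (enc_nat n) \<Longrightarrow> x < 6"
  using set_binary [of n] by (auto simp: enc_nat_def)

lemma wf_lefts: "k < 6 \<Longrightarrow> wf_com 6 6 (lefts d k)"
  by (induction d) (auto simp: moveL_def)

lemma wf_emit_name: "k < 6 \<Longrightarrow> k' < 6 \<Longrightarrow> wf_com 6 6 (emit_name b (a, d, k) (a', d', k'))"
  by (auto simp: emit_ctr_def moveL_def moveR_def wf_lefts intro!: wf_emit)

lemma wf_grid: "wf_com 6 6 (c 0) \<Longrightarrow> wf_com 6 6 (c 1) \<Longrightarrow> wf_com 6 6 (c 2) \<Longrightarrow> wf_com 6 6 (grid c)"
  by (simp add: grid_def grid_step_def row_def next_lit_def inc_def rewind_def reset_def moveL_def moveR_def)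

lemma wf_cell: "wf_com 6 6 c \<Longrightarrow> wf_com 6 6 c' \<Longrightarrow> wf_com 6 6 (cell c c')"
  by (simp add: cell_def here_def wf_emit_name del: emit_name.simps)

lemma wf_clause_cell: "wf_com 6 6 (clause_cell p)"
  by (simp add: clause_cell_def wf_cell wf_emit_name del: emit_name.simps)

lemma wf_row_cell: "wf_com 6 6 row_cell"
  by (simp add: row_cell_def wf_cell row_prev_def row_next_def moveL_def moveR_def next_lit_def
    prev_lit_def lit_start_def wf_emit_name del: emit_name.simps)

lemma wf_conflict_cell: "wf_com 6 6 conflict_cell"
  by (simp add: conflict_cell_def wf_cell conflict_test_def moveL_def moveR_def lit_start_def
    wf_emit_name del: emit_name.simps)

lemma wf_name_list: "wf_com 6 6 (name_list xs)"
  unfolding name_list_def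
  by (auto simp: names_def here_def wf_emit_name wf_enc_nat simp del: emit.simps emit_name.simps
    intro!: wf_emit wf_grid)

lemma wf_layer:
  "wf_com 6 6 z \<Longrightarrow> wf_com 6 6 (c 0) \<Longrightarrow> wf_com 6 6 (c 1) \<Longrightarrow> wf_com 6 6 (c 2) \<Longrightarrow> wf_com 6 6 (layer z c)"
  unfolding layer_def by (simp add: wf_grid)

lemma wf_init: "wf_com 6 6 init"
  by (simp add: init_def copy_literals_def rewind_def moveL_def moveR_def)

lemma wf_spare_list: "wf_com 6 6 spare_list"
  unfolding spare_list_def by (rule wf_emit) (auto simp: enc_list_def wf_enc_nat)

lemma wf_closing: "wf_com 6 6 (closing k)"
  unfolding closing_def by (rule wf_emit) (auto simp: wf_enc_nat)

lemma wf_preamble: "wf_com 6 6 preamble"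
  by (simp add: preamble_def wf_name_list wf_layer wf_spare_list wf_clause_cell wf_row_cell wf_conflict_cell)

lemma wf_programs: "wf_com 6 6 program3" "wf_com 6 6 program4"
  by (simp_all add: program3_def program4_def wf_init wf_preamble wf_closing wf_layer wf_name_list wf_conflict_cell)

section \<open>The grid instance\<close>

lemma nm_inject [simp]: "nm o1 b = nm o2 b' \<longleftrightarrow> o1 = o2 \<and> b = b'"
proof
  obtain i j i' j' where o: "o1 = (i, j)" "o2 = (i', j')" by fastforce
  assume "nm o1 b = nm o2 b'"
  then have "binary (nm (i, j) b) = binary (nm (i', j') b')" by (simp add: o)
  then have b: "b = b'" and eq: "replicate i 1 @ 2 # replicate j 1 @ [2] = replicate i' 1 @ 2 # replicate j' 1 @ [2 :: nat]"
    by (auto simp: binary_nm split: if_splits)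
  \<comment> \<open>The symbol 1 is the digit zero, so the block in front of the first 2 has length
    \<open>i\<close>; what follows it determines \<open>j\<close>.\<close>
  have "takeWhile (\<lambda>x. x = 1) (replicate i 1 @ 2 # replicate j 1 @ [2 :: nat]) = replicate i 1" for i j
    by (subst takeWhile_append2) auto
  with eq have "replicate i (1 :: nat) = replicate i' 1" by metis
  then have "i = i'" by (metis length_replicate)
  with eq have "replicate j 1 @ [2 :: nat] = replicate j' 1 @ [2]" by simp
  then have "j = j'" by (metis append_same_eq length_replicate)
  with \<open>i = i'\<close> b o show "o1 = o2 \<and> b = b'" by simp
qed simp

lemma nm_gt: "2 < nm o1 b"
proof -
  obtain i j where o: "o1 = (i, j)" by fastforce
  have "1 * (1 + 2 * 1) \<le> 2 ^ i * (1 + 2 * 2 ^ j :: nat)"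
    by (intro mult_mono add_mono) auto
  then show ?thesis by (simp add: nm_def o)
qed

lemma nm_neq [simp]: "nm o1 b \<noteq> 0" "nm o1 b \<noteq> Suc 0" "nm o1 b \<noteq> 2"
  "0 \<noteq> nm o1 b" "Suc 0 \<noteq> nm o1 b" "2 \<noteq> nm o1 b"
  using nm_gt [of o1 b] by auto

definition un_nm :: "nat \<Rightarrow> idx \<times> bool" where
  "un_nm = inv (\<lambda>(o1, b). nm o1 b)"

lemma un_nm_nm [simp]: "un_nm (nm o1 b) = (o1, b)"
proof -
  have "inj (\<lambda>(o1, b). nm o1 b)" by (auto intro!: injI)
  from inv_f_f [OF this, of "(o1, b)"] show ?thesis by (simp add: un_nm_def)
qed

text \<open>\<open>un_nm\<close> is meaningful only on names; numbers that are neither 0 nor a name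
  never occur as agents.\<close>

definition prof :: "nat list \<Rightarrow> (idx \<Rightarrow> bool \<Rightarrow> idx option) \<Rightarrow> nat \<Rightarrow> nat list" where
  "prof zs nx a = (if a = 0 then zs else case un_nm a of (o1, b) \<Rightarrow> pref nx o1 b)"

lemma prof_simps [simp]: "prof zs nx 0 = zs" "prof zs nx (nm o1 b) = pref nx o1 b"
  by (simp_all add: prof_def)

lemma pref_less_irrefl: "distinct xs \<Longrightarrow> \<not> pref_less xs u u"
  by (auto simp: pref_less_def distinct_conv_nth)

lemma pref_le_top:
  assumes "pref_le (x # xs) (Some x) u" "distinct (x # xs)"
  shows "u = Some x"
proof (rule ccontr)
  assume "u \<noteq> Some x"
  with assms(1) have "pref_less (x # xs) (Some x) u" by (simp add: pref_le_def)
  then obtain i j where "i < j" "j < length (x # xs)" "Some x = Some ((x # xs) ! j)"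
    unfolding pref_less_def by blast
  with assms(2) show False by (cases j) auto
qed

lemma pref_le_None: "pref_le xs (Some x) u \<Longrightarrow> u \<noteq> None"
  by (auto simp: pref_le_def pref_less_def)

lemma pref_less_None: "x \<in> set xs \<Longrightarrow> pref_less xs None (Some x)"
  by (simp add: pref_less_def)

lemma pref_less_last:
  "ys @ [z] = xs \<Longrightarrow> y \<in> set ys \<Longrightarrow> pref_less xs (Some z) (Some y)"
  unfolding pref_less_def in_set_conv_nth
  by (metis length_append_singleton less_Suc_eq nth_append nth_append_length)

lemma pref_less_pref:
  "nx o1 b = Some o2 \<Longrightarrow> pref_less (pref nx o1 b) (Some (nm o1 False)) (Some (nm o2 False))"
  "pref_less (pref nx o1 b) (Some (nm o1 False)) (Some (nm o1 True))"
proof -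
  let ?ys = "nm o1 True # (case nx o1 b of None \<Rightarrow> [] | Some o2 \<Rightarrow> [nm o2 False])"
  have "?ys @ [nm o1 False] = pref nx o1 b" by (simp add: pref_def)
  from pref_less_last [OF this]
  show "nx o1 b = Some o2 \<Longrightarrow> pref_less (pref nx o1 b) (Some (nm o1 False)) (Some (nm o2 False))"
    "pref_less (pref nx o1 b) (Some (nm o1 False)) (Some (nm o1 True))"
    by auto
qed

lemma set_pref: "set (pref nx o1 b) = {nm o1 True, nm o1 False} \<union> (\<lambda>o2. nm o2 False) ` set_option (nx o1 b)"
  by (auto simp: pref_def split: option.splits)

lemma length_pref: "length (pref nx o1 b) \<le> 3"
  by (simp add: pref_def split: option.splits)

text \<open>Layers over a set \<open>C\<close> of cells. The two agents of cell \<open>o1\<close> share the items \<open>nm o1 True\<close>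
  (their favourite) and \<open>nm o1 False\<close>; in between, agent \<open>nm o1 b\<close> likes the second item of cell
  \<open>nx o1 b\<close>.\<close>

definition nodes :: "idx set \<Rightarrow> nat set" where
  "nodes C = (\<Union>o1 \<in> C. {nm o1 True, nm o1 False})"

lemma nm_nodes [simp]: "nm o1 b \<in> nodes C \<longleftrightarrow> o1 \<in> C"
  by (cases b) (auto simp: nodes_def)

lemma nodes_cases:
  assumes "a \<in> nodes C"
  obtains o1 b where "o1 \<in> C" "a = nm o1 b"
  using assms by (auto simp: nodes_def)

lemma spare_nodes [simp]: "0 \<notin> nodes C" "Suc 0 \<notin> nodes C" "2 \<notin> nodes C"
  by (auto simp: nodes_def)

definition over :: "idx set \<Rightarrow> (nat, nat) goa \<Rightarrow> bool" where
  "over C G \<longleftrightarrow> set (agents G) = insert 0 (nodes C) \<and> set (items G) = {0, 1, 2} \<union> nodes C"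

lemma over_agent_cases:
  assumes "over C G" "a \<in> set (agents G)"
  obtains "a = 0" | o1 b where "o1 \<in> C" "a = nm o1 b"
  using assms unfolding over_def by (metis insertE nodes_cases)

lemma over_mem:
  assumes "over C G"
  shows "0 \<in> set (agents G)" "o1 \<in> C \<Longrightarrow> nm o1 b \<in> set (agents G)"
    "0 \<in> set (items G)" "o1 \<in> C \<Longrightarrow> nm o1 b \<in> set (items G)"
  using assms unfolding over_def by simp_all

section \<open>Bit patterns, Pareto optimality and trading cycles\<close>

lemma legal_inj:
  "legal G P p \<Longrightarrow> a \<in> set (agents G) \<Longrightarrow> a' \<in> set (agents G) \<Longrightarrow> p a = Some x \<Longrightarrow> p a' = Some x \<Longrightarrow> a = a'"
  unfolding legal_def is_assignment_def by (metis option.distinct(1))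

text \<open>The condition \<open>o2 \<noteq> o1\<close> keeps the item inserted by
  \<open>pref\<close> different from the two items of the cell itself.\<close>

definition closed_on :: "idx set \<Rightarrow> (idx \<Rightarrow> bool \<Rightarrow> idx option) \<Rightarrow> bool" where
  "closed_on C nx \<longleftrightarrow> (\<forall>o1 \<in> C. \<forall>b o2. nx o1 b = Some o2 \<longrightarrow> o2 \<in> C \<and> o2 \<noteq> o1)"

text \<open>The bit names the satisfied agent: the one with \<open>b = s o1\<close> holds the
  favourite, the other one the second item.\<close>

definition state :: "idx set \<Rightarrow> (idx \<Rightarrow> bool) \<Rightarrow> (nat \<Rightarrow> nat option) \<Rightarrow> bool" where
  "state C s p \<longleftrightarrow> p 0 = Some 0 \<and> (\<forall>o1 \<in> C. \<forall>b. p (nm o1 b) = Some (nm o1 (b = s o1)))"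

lemma distinct_pref: "closed_on C nx \<Longrightarrow> o1 \<in> C \<Longrightarrow> distinct (pref nx o1 b)"
  by (auto simp: closed_on_def pref_def split: option.splits)

lemma legal_state:
  assumes "over C G" "closed_on C nx" "0 \<in> set zs" "state C s p"
  shows "legal G (prof zs nx) p"
proof -
  have p0: "p 0 = Some 0" and pn: "\<And>o1 b. o1 \<in> C \<Longrightarrow> p (nm o1 b) = Some (nm o1 (b = s o1))"
    using assms(4) by (auto simp: state_def)
  have "p a \<noteq> p a'" if a: "a \<in> set (agents G)" "a' \<in> set (agents G)" "a \<noteq> a'" for a a'
    by (rule over_agent_cases [OF assms(1) a(1)]; rule over_agent_cases [OF assms(1) a(2)])
      (use a(3) p0 pn in auto)
  moreover have "(\<exists>x \<in> set (items G). p a = Some x) \<and> (\<exists>x \<in> set (prof zs nx a). p a = Some x)"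
    if a: "a \<in> set (agents G)" for a
    by (rule over_agent_cases [OF assms(1) a])
      (use assms(3) p0 pn in \<open>auto simp: over_mem [OF assms(1)] set_pref\<close>)
  ultimately show ?thesis
    by (simp add: legal_def is_assignment_def)
qed

text \<open>Agents holding their favourite item never move. So the agent \<open>nm o1 (\<not> s o1)\<close> can only improve
  if the holder of the item of the next cell moves as well, which starts a walk along \<open>nx\<close> that
  cannot end.\<close>

lemma pareto_optimal_state:
  fixes rk :: "idx \<Rightarrow> nat"
  assumes G: "over C G" "closed_on C nx" and zs: "distinct (0 # zs)" and p: "state C s p"
    and rk: "\<And>o1 o2. o1 \<in> C \<Longrightarrow> nx o1 (\<not> s o1) = Some o2 \<Longrightarrow> rk o2 < rk o1"
  shows "pareto_optimal G (prof (0 # zs) nx) p"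
  unfolding pareto_optimal_def
proof (intro conjI notI)
  let ?P = "prof (0 # zs) nx"
  show "legal G ?P p" using legal_state [OF G _ p] by simp
  assume "\<exists>q. legal G ?P q \<and> (\<forall>a \<in> set (agents G). pref_le (?P a) (p a) (q a)) \<and>
    (\<exists>a \<in> set (agents G). pref_less (?P a) (p a) (q a))"
  then obtain q a where q: "legal G ?P q"
    and le: "\<And>a. a \<in> set (agents G) \<Longrightarrow> pref_le (?P a) (p a) (q a)"
    and a: "a \<in> set (agents G)" "pref_less (?P a) (p a) (q a)"
    by blast
  have ag: "0 \<in> set (agents G)" "\<And>o1 b. o1 \<in> C \<Longrightarrow> nm o1 b \<in> set (agents G)"
    using over_mem [OF G(1)] by blast+
  have inj: "a = a'" if "a \<in> set (agents G)" "a' \<in> set (agents G)" "q a = Some x" "q a' = Some x" for a a' x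
    using legal_inj [OF q] that by blast
  have q0: "q 0 = Some 0"
    using le [OF ag(1)] p zs by (auto simp: state_def intro: pref_le_top)
  have qt: "q (nm o1 (s o1)) = Some (nm o1 True)" if "o1 \<in> C" for o1
  proof -
    have "pref_le (pref nx o1 (s o1)) (Some (nm o1 True)) (q (nm o1 (s o1)))"
      using le [OF ag(2) [OF that, of "s o1"]] p that by (simp add: state_def)
    with distinct_pref [OF G(2) that, of "s o1"] show ?thesis
      unfolding pref_def by (rule pref_le_top [rotated])
  qed
  \<comment> \<open>Strong induction on the rank: the next cell has smaller rank, so its second item
    is already known to stay with its holder, and the favourite of the own cell is taken by
    \<open>qt\<close>.\<close>
  have qf: "q (nm o1 (\<not> s o1)) = Some (nm o1 False)" if "o1 \<in> C" for o1
    using that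
  proof (induction "rk o1" arbitrary: o1 rule: less_induct)
    case less
    let ?a = "nm o1 (\<not> s o1)"
    have pa: "p ?a = Some (nm o1 False)"
      using p less.prems by (simp add: state_def)
    have "q ?a \<noteq> None"
      using le [OF ag(2) [OF less.prems]] pa pref_le_None by metis
    moreover have "q ?a = None \<or> (\<exists>x \<in> set (?P ?a). q ?a = Some x)"
      using q ag(2) [OF less.prems] unfolding legal_def by blast
    ultimately obtain x where x: "x \<in> set (pref nx o1 (\<not> s o1))" "q ?a = Some x"
      by auto
    have "x \<noteq> nm o1 True"
      using inj [OF ag(2) ag(2), OF less.prems less.prems x(2), of "s o1"] qt [OF less.prems] by auto
    moreover have False if o2: "nx o1 (\<not> s o1) = Some o2" and "x = nm o2 False" for o2
    proof -
      have C: "o2 \<in> C" "o2 \<noteq> o1"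
        using G(2) less.prems o2 unfolding closed_on_def by blast+
      have "q (nm o2 (\<not> s o2)) = Some x"
        using less.hyps [OF rk [OF less.prems o2] C(1)] that(2) by simp
      with inj [OF ag(2) ag(2), OF less.prems C(1) x(2)] C(2) show False by auto
    qed
    ultimately show ?case using x by (auto simp: set_pref)
  qed
  have "q a = p a"
  proof (cases "a = 0")
    case False
    with over_agent_cases [OF G(1) a(1)] obtain o1 b where "a = nm o1 b" "o1 \<in> C" by metis
    with qt [of o1] qf [of o1] p show ?thesis
      by (cases "b = s o1") (auto simp: state_def)
  qed (use q0 p in \<open>simp add: state_def\<close>)
  moreover have "distinct (?P a)"
    using over_agent_cases [OF G(1) a(1)] zs distinct_pref [OF G(2)] by (metis prof_simps)
  ultimately show False using a(2) pref_less_irrefl by metis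
qed

text \<open>Handing a free item to an agent that prefers it would improve this agent and change
  nothing for the others.\<close>

lemma pareto_optimal_free_item:
  assumes "pareto_optimal G P p" "a \<in> set (agents G)" "x \<in> set (P a)" "x \<in> set (items G)"
    and "\<And>a'. a' \<in> set (agents G) \<Longrightarrow> a' \<noteq> a \<Longrightarrow> p a' \<noteq> Some x"
  shows "\<not> pref_less (P a) (p a) (Some x)"
proof
  assume less: "pref_less (P a) (p a) (Some x)"
  let ?q = "p(a := Some x)"
  have "legal G P ?q"
    using assms unfolding pareto_optimal_def legal_def is_assignment_def by auto
  moreover have "\<forall>a' \<in> set (agents G). pref_le (P a') (p a') (?q a')"
    using less by (simp add: pref_le_def)
  moreover have "\<exists>a' \<in> set (agents G). pref_less (P a') (p a') (?q a')"
    using less assms(2) by auto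
  ultimately show False using assms(1) unfolding pareto_optimal_def by blast
qed

text \<open>Legality for \<open>nx\<close> confines the agents with \<open>b = False\<close> to the
  items of their own cell, legality for \<open>nx'\<close> those with \<open>b = True\<close>. No
  agent outside the cell competes for these items, so a favourite without holder, or an agent left
  without item, contradicts \<open>pareto_optimal_free_item\<close>.\<close>

lemma state_exists:
  assumes G: "over C G" and p: "pareto_optimal G (prof spare_items nx) p" "legal G (prof spare_items nx') p"
    and nx: "\<And>o1. nx o1 False = None" "\<And>o1. nx' o1 True = None"
  shows "\<exists>s. state C s p"
proof -
  let ?P = "prof spare_items nx"
  have ag: "0 \<in> set (agents G)" "\<And>o1 b. o1 \<in> C \<Longrightarrow> nm o1 b \<in> set (agents G)"
    and it: "0 \<in> set (items G)" "\<And>o1 b. o1 \<in> C \<Longrightarrow> nm o1 b \<in> set (items G)"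
    using over_mem [OF G] by blast+
  have pl: "legal G ?P p" using p(1) by (simp add: pareto_optimal_def)
  have leg: "p a = None \<or> (\<exists>x \<in> set (?P a). p a = Some x)" "p a = None \<or> (\<exists>x \<in> set (prof spare_items nx' a). p a = Some x)"
    if "a \<in> set (agents G)" for a
    using pl p(2) that by (auto simp: legal_def)
  have own: "p (nm o1 b) \<in> {None, Some (nm o1 True), Some (nm o1 False)}" if "o1 \<in> C" for o1 b
    using leg [OF ag(2) [OF that, of b]] nx by (cases b) (auto simp: set_pref)
  have own0: "p 0 \<in> {None, Some 0, Some 1, Some 2}"
    using leg [OF ag(1)] by auto
  have ag_cases: "a = 0 \<or> (\<exists>o1 b. o1 \<in> C \<and> a = nm o1 b)" if "a \<in> set (agents G)" for a
    using over_agent_cases [OF G that] by metis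
  have inj: "a = a'" if "a \<in> set (agents G)" "a' \<in> set (agents G)" "p a = Some x" "p a' = Some x" for a a' x
    using legal_inj [OF pl] that by blast
  have other: "p a \<noteq> Some (nm o1 b)" if "a \<in> set (agents G)" "\<And>b'. a \<noteq> nm o1 b'" for a o1 b
  proof (cases "a = 0")
    case False
    with that ag_cases [OF that(1)] obtain o2 b2 where "o2 \<in> C" "a = nm o2 b2" by blast
    moreover from this that(2) have "o2 \<noteq> o1" by blast
    ultimately show ?thesis using own [of o2 b2] by auto
  qed (use own0 in auto)
  have p0: "p 0 = Some 0"
  proof (rule ccontr)
    assume n: "p 0 \<noteq> Some 0"
    have "\<not> pref_less (?P 0) (p 0) (Some 0)"
    proof (rule pareto_optimal_free_item [OF p(1) ag(1) _ it(1)])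
      fix a' assume "a' \<in> set (agents G)" "a' \<noteq> 0"
      with ag_cases obtain o1 b where "o1 \<in> C" "a' = nm o1 b" by blast
      with own [of o1 b] show "p a' \<noteq> Some 0" by auto
    qed simp
    moreover have "p 0 = None \<or> p 0 = Some 1 \<or> p 0 = Some 2"
      using own0 n by auto
    moreover have "pref_less spare_items (Some 1) (Some 0)" "pref_less spare_items (Some 2) (Some 0)"
      unfolding pref_less_def
      by (rule disjI2, rule exI [of _ 0], rule exI [of _ 1], simp)
        (rule disjI2, rule exI [of _ 0], rule exI [of _ 2], simp)
    ultimately show False by (auto simp: pref_less_None)
  qed
  define s where "s o1 = (p (nm o1 True) = Some (nm o1 True))" for o1
  have s1: "p (nm o1 (s o1)) = Some (nm o1 True)" if o1: "o1 \<in> C" for o1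
  proof (rule ccontr)
    assume n: "p (nm o1 (s o1)) \<noteq> Some (nm o1 True)"
    then have n': "p (nm o1 b) \<noteq> Some (nm o1 True)" for b
      by (cases b; cases "s o1") (auto simp: s_def)
    have "\<not> pref_less (?P (nm o1 True)) (p (nm o1 True)) (Some (nm o1 True))"
    proof (rule pareto_optimal_free_item [OF p(1) ag(2) [OF o1] _ it(2) [OF o1]])
      fix a' assume "a' \<in> set (agents G)" "a' \<noteq> nm o1 True"
      with other [of a' o1] n' show "p a' \<noteq> Some (nm o1 True)" by metis
    qed (simp add: set_pref)
    with own [OF o1, of True] n' [of True] pref_less_pref(2) [of nx o1 True] show False
      by (auto simp: set_pref pref_less_None)
  qed
  have s2: "p (nm o1 (\<not> s o1)) = Some (nm o1 False)" if o1: "o1 \<in> C" for o1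
  proof (rule ccontr)
    assume n: "p (nm o1 (\<not> s o1)) \<noteq> Some (nm o1 False)"
    have "p (nm o1 (\<not> s o1)) \<noteq> Some (nm o1 True)"
      using inj [OF ag(2) ag(2), OF o1 o1 s1 [OF o1], of "\<not> s o1"] by auto
    with n own [OF o1, of "\<not> s o1"] have none: "p (nm o1 (\<not> s o1)) = None" by auto
    have "\<not> pref_less (?P (nm o1 (\<not> s o1))) (p (nm o1 (\<not> s o1))) (Some (nm o1 False))"
    proof (rule pareto_optimal_free_item [OF p(1) ag(2) [OF o1] _ it(2) [OF o1]])
      fix a' assume a': "a' \<in> set (agents G)" "a' \<noteq> nm o1 (\<not> s o1)"
      show "p a' \<noteq> Some (nm o1 False)"
      proof (cases "a' = nm o1 (s o1)")
        case True
        with s1 [OF o1] show ?thesis by simp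
      next
        case False
        with a' have "a' \<noteq> nm o1 b'" for b' by (cases "b' = s o1") auto
        with other [of a' o1] a'(1) show ?thesis by blast
      qed
    qed (simp add: set_pref)
    with none show False by (simp add: set_pref pref_less_None)
  qed
  have "state C s p"
    unfolding state_def
  proof (intro conjI ballI allI)
    fix o1 b assume "o1 \<in> C"
    with s1 [of o1] s2 [of o1] show "p (nm o1 b) = Some (nm o1 (b = s o1))"
      by (cases "b = s o1") auto
  qed (rule p0)
  then show ?thesis by (rule exI [of "\<lambda>s. state C s p"])
qed

text \<open>All unsatisfied agents of \<open>D\<close> trade at once: that of \<open>o1\<close>
  receives the second item of \<open>g o1\<close>, which it ranks above its own. Items of
  \<open>D\<close> stay within \<open>D\<close> and \<open>g\<close> is injective, so no item is
  given twice.\<close>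

lemma no_trading_cycle:
  assumes G: "over C G" "closed_on C nx" and "0 \<in> set zs" and p: "state C s p"
    and po: "pareto_optimal G (prof zs nx) p"
    and D: "D \<subseteq> C" "o0 \<in> D" "inj_on g D" "g ` D \<subseteq> D"
    and cyc: "\<And>o1. o1 \<in> D \<Longrightarrow> nx o1 (\<not> s o1) = Some (g o1)"
  shows False
proof -
  let ?P = "prof zs nx"
  define q where "q a = (if a = 0 then Some 0 else case un_nm a of (o1, b) \<Rightarrow>
      if o1 \<in> D \<and> b \<noteq> s o1 then Some (nm (g o1) False) else Some (nm o1 (b = s o1)))" for a
  have q0: "q 0 = Some 0" by (simp add: q_def)
  have qn: "q (nm o1 b) =
      (if o1 \<in> D \<and> b \<noteq> s o1 then Some (nm (g o1) False) else Some (nm o1 (b = s o1)))" for o1 b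
    by (simp add: q_def)
  have gC: "g o1 \<in> C" "g o1 \<in> D" if "o1 \<in> D" for o1 using that D by auto
  have qinj: "o1 = o2 \<and> b = b'" if "q (nm o1 b) = q (nm o2 b')" for o1 o2 b b'
    using that gC(2) [of o1] gC(2) [of o2] inj_onD [OF D(3), of o1 o2]
    by (auto simp: qn split: if_splits)
  have cyc': "nx o1 b = Some (g o1)" if "o1 \<in> D" "b \<noteq> s o1" for o1 b
    using cyc [OF that(1)] that(2) by (cases b) auto
  have "is_assignment G q"
    unfolding is_assignment_def
  proof (intro conjI ballI impI)
    fix a assume "a \<in> set (agents G)"
    then show "q a = None \<or> (\<exists>b \<in> set (items G). q a = Some b)"
      by (rule over_agent_cases [OF G(1)]) (auto simp: q0 qn gC over_mem [OF G(1)])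
  next
    fix a a' assume a: "a \<in> set (agents G)" "a' \<in> set (agents G)" "a \<noteq> a' \<and> q a \<noteq> None"
    have n: "q (nm o1 b) \<noteq> q 0" for o1 b by (simp add: qn q0)
    show "q a \<noteq> q a'"
      by (rule over_agent_cases [OF G(1) a(1)]; rule over_agent_cases [OF G(1) a(2)])
        (use a(3) n n [symmetric] in \<open>auto dest: qinj\<close>)
  qed
  moreover have "\<exists>x \<in> set (?P a). q a = Some x" if "a \<in> set (agents G)" for a
    using G(1) that
  proof (cases rule: over_agent_cases)
    case (2 o1 b)
    with cyc' [of o1 b] show ?thesis
      by (cases "o1 \<in> D \<and> b \<noteq> s o1") (auto simp: qn set_pref)
  qed (use q0 assms(3) in simp)
  ultimately have "legal G ?P q"
    by (simp add: legal_def)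
  moreover have "pref_le (?P a) (p a) (q a)" if "a \<in> set (agents G)" for a
  proof (cases "a = 0")
    case True
    with q0 p show ?thesis by (simp add: state_def pref_le_def)
  next
    case False
    with over_agent_cases [OF G(1) that] obtain o1 b where a: "a = nm o1 b" "o1 \<in> C" by metis
    with p cyc' [of o1 b] pref_less_pref(1) [of nx o1 b "g o1"] show ?thesis
      by (auto simp: state_def qn pref_le_def)
  qed
  moreover have "pref_less (?P (nm o0 (\<not> s o0))) (p (nm o0 (\<not> s o0))) (q (nm o0 (\<not> s o0)))"
    using p D cyc [OF D(2)] pref_less_pref(1) [of nx o0 "\<not> s o0" "g o0"]
    by (auto simp: state_def qn)
  moreover have "nm o0 (\<not> s o0) \<in> set (agents G)"
    using over_mem [OF G(1)] D by blast
  ultimately show False using po unfolding pareto_optimal_def by blast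
qed

section \<open>The instance belonging to a list of literals\<close>

lemma set_cells: "set (cells m) = {..<m} \<times> {..<m}"
  by (auto simp: cells_def)

lemma set_node_names: "set (node_names m) = nodes (set (cells m))"
  by (auto simp: node_names_def nodes_def)

lemma distinct_node_names: "distinct (node_names m)"
proof -
  have "distinct (concat (map (\<lambda>o1. [nm o1 True, nm o1 False]) xs))" if "distinct xs" for xs
    using that by (induction xs) auto
  moreover have "distinct (cells m)" by (simp add: cells_def distinct_product)
  ultimately show ?thesis unfolding node_names_def by blast
qed

definition instance_of :: "literal list \<Rightarrow> (nat, nat) profile list \<Rightarrow> (nat, nat) goa" where
  "instance_of ls Ps = \<lparr>agents = 0 # node_names (length ls),
     items = spare_items @ node_names (length ls), profiles = Ps, alpha = length Ps\<rparr>"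

definition profs :: "literal list \<Rightarrow> (nat, nat) profile list" where
  "profs ls = map (prof spare_items) [nx_clause, nx_row (length ls), nx_conflict ls]"

definition extra_prof :: "literal list \<Rightarrow> (nat, nat) profile" where
  "extra_prof ls = prof (spare_items @ node_names (length ls)) (nx_conflict ls)"

lemma over_instance_of: "over (set (cells (length ls))) (instance_of ls Ps)"
  by (simp add: over_def instance_of_def set_node_names)

lemma cnext_simps: "cnext (3 * k) = 3 * k + 1" "cnext (3 * k + 1) = 3 * k + 2" "cnext (3 * k + 2) = 3 * k"
proof -
  have "3 * k mod 3 = 0" "(3 * k + 1) mod 3 = 1" "(3 * k + 2) mod 3 = 2" by presburger+
  then show "cnext (3 * k) = 3 * k + 1" "cnext (3 * k + 1) = 3 * k + 2" "cnext (3 * k + 2) = 3 * k"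
    by (simp_all add: cnext_def)
qed

lemma mod3_cases:
  obtains k :: nat where "i = 3 * k" | k where "i = 3 * k + 1" | k where "i = 3 * k + 2"
proof -
  have "\<exists>k. i = 3 * k \<or> i = 3 * k + 1 \<or> i = 3 * k + 2" by presburger
  then show ?thesis using that by blast
qed

lemma cnext_less: "3 dvd m \<Longrightarrow> i < m \<Longrightarrow> cnext i < m"
  by (cases i rule: mod3_cases; simp only: cnext_simps; presburger)

lemma cnext_neq: "cnext i \<noteq> i"
  by (cases i rule: mod3_cases; simp only: cnext_simps; presburger)

lemma cnext_cycle: "cnext (cnext (cnext i)) = i"
  by (cases i rule: mod3_cases; simp only: cnext_simps)

lemma closed_on_layers:
  assumes "3 dvd length ls" "nx \<in> {nx_clause, nx_row (length ls), nx_conflict ls}"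
  shows "closed_on (set (cells (length ls))) nx"
  unfolding closed_on_def
proof (intro ballI allI impI)
  fix o1 b o2
  assume "o1 \<in> set (cells (length ls))" and o2: "nx o1 b = Some o2"
  then obtain i j where o1: "o1 = (i, j)" "i < length ls" "j < length ls"
    by (auto simp: set_cells)
  consider "nx = nx_clause" | "nx = nx_row (length ls)" | "nx = nx_conflict ls"
    using assms(2) by blast
  then show "o2 \<in> set (cells (length ls)) \<and> o2 \<noteq> o1"
  proof cases
    case 1
    with o1 o2 cnext_less [OF assms(1), of i] cnext_neq [of i] show ?thesis
      by (auto simp: nx_clause_def set_cells split: if_splits)
  next
    case 2
    with o1 o2 show ?thesis by (auto simp: nx_row_def set_cells split: if_splits)
  next
    case 3
    with o1 o2 show ?thesis by (auto simp: nx_conflict_def conflict_def set_cells split: if_splits)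
  qed
qed

lemma map_prof: "map (prof zs nx) (node_names m) = node_prefs m nx"
  by (simp add: node_names_def node_prefs_def map_concat o_def)

text \<open>This joins the two halves of the development: the encodings a reduction has to produce
  are the words printed by the programs.\<close>

lemma enc_instance_of:
  "enc_goa (instance_of ls (profs ls)) = goa_word ls (layers ls) 3"
  "enc_goa (instance_of ls (profs ls @ [extra_prof ls])) = goa_word ls (layers ls @ [extra_layer ls]) 4"
  by (simp_all add: enc_goa_def instance_of_def goa_word_def profs_def extra_prof_def layers_def
    extra_layer_def map_prof eval_nat_numeral)

lemma goa_instance_of:
  assumes "Ps \<noteq> []"
    and "\<And>P. P \<in> set Ps \<Longrightarrow> \<exists>zs nx. P = prof zs nx \<and> distinct zs \<and>
      set zs \<subseteq> set (spare_items @ node_names (length ls)) \<and> closed_on (set (cells (length ls))) nx"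
  shows "goa_instance (instance_of ls Ps)"
proof -
  let ?C = "set (cells (length ls))"
  have "distinct (P a) \<and> set (P a) \<subseteq> set (items (instance_of ls Ps))"
    if "P \<in> set Ps" "a \<in> set (agents (instance_of ls Ps))" for P a
  proof -
    from assms(2) [OF that(1)] obtain zs nx where P: "P = prof zs nx" "distinct zs"
      "set zs \<subseteq> set (spare_items @ node_names (length ls))" "closed_on ?C nx"
      by blast
    show ?thesis
      using over_instance_of that(2)
    proof (cases rule: over_agent_cases)
      case 1
      with P show ?thesis by (simp add: instance_of_def)
    next
      case (2 o1 b)
      have "o2 \<in> ?C" if "nx o1 b = Some o2" for o2
        using P(4) 2(1) that unfolding closed_on_def by blast
      then have "set (pref nx o1 b) \<subseteq> nodes ?C"
        using 2(1) unfolding set_pref by auto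
      then show ?thesis
        using distinct_pref [OF P(4) 2(1)] unfolding P(1) 2(2)
        by (auto simp: instance_of_def set_node_names)
    qed
  qed
  moreover have "distinct (node_names (length ls))" "set (node_names (length ls)) \<inter> {0, 1, 2} = {}"
    by (auto simp: distinct_node_names set_node_names)
  ultimately show ?thesis
    using assms(1) by (auto simp: goa_instance_def instance_of_def Suc_le_eq)
qed

lemma max_pref_length_eqI:
  assumes "\<And>P a. P \<in> set (profiles G) \<Longrightarrow> a \<in> set (agents G) \<Longrightarrow> length (P a) \<le> L"
    and "P0 \<in> set (profiles G)" "a0 \<in> set (agents G)" "length (P0 a0) = L"
  shows "max_pref_length G = L"
  unfolding max_pref_length_def
proof (rule Max_eqI)
  have "{length (P a) |P a. P \<in> set (profiles G) \<and> a \<in> set (agents G)} =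
      (\<lambda>(P, a). length (P a)) ` (set (profiles G) \<times> set (agents G))"
    by auto
  then show "finite (insert 0 {length (P a) |P a. P \<in> set (profiles G) \<and> a \<in> set (agents G)})"
    by simp
qed (use assms in auto)

lemma length_prof:
  assumes "a \<in> set (agents (instance_of ls Ps))" "3 \<le> length zs"
  shows "length (prof zs nx a) \<le> length zs"
  using over_instance_of assms(1)
proof (cases rule: over_agent_cases)
  case (2 o1 b)
  with assms(2) length_pref [of nx o1 b] show ?thesis by simp
qed simp

lemma max_pref_length_instances:
  "max_pref_length (instance_of ls (profs ls)) = 3"
  "max_pref_length (instance_of ls (profs ls @ [extra_prof ls])) =
     length (items (instance_of ls (profs ls @ [extra_prof ls])))"
proof -
  show "max_pref_length (instance_of ls (profs ls)) = 3"
  proof (rule max_pref_length_eqI [where ?P0.0 = "prof spare_items nx_clause" and ?a0.0 = 0])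
    fix P a assume "P \<in> set (profiles (instance_of ls (profs ls)))" and a: "a \<in> set (agents (instance_of ls (profs ls)))"
    then obtain nx where "P = prof spare_items nx" by (auto simp: instance_of_def profs_def)
    with length_prof [OF a, of spare_items nx] show "length (P a) \<le> 3" by (simp add: numeral_3_eq_3)
  qed (simp_all add: instance_of_def profs_def)
  let ?G = "instance_of ls (profs ls @ [extra_prof ls])"
  let ?zs = "spare_items @ node_names (length ls)"
  show "max_pref_length ?G = length (items ?G)"
  proof (rule max_pref_length_eqI [where ?P0.0 = "extra_prof ls" and ?a0.0 = 0])
    fix P a assume "P \<in> set (profiles ?G)" and a: "a \<in> set (agents ?G)"
    then obtain nx where "P = prof spare_items nx \<or> P = prof ?zs nx"
      by (auto simp: instance_of_def profs_def extra_prof_def)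
    with length_prof [OF a, of spare_items nx] length_prof [OF a, of ?zs nx]
    show "length (P a) \<le> length (items ?G)" by (auto simp: instance_of_def)
  qed (simp_all add: instance_of_def extra_prof_def)
qed

section \<open>Satisfying assignments and Pareto optima\<close>

definition true_lit :: "(nat \<Rightarrow> bool) \<Rightarrow> literal \<Rightarrow> bool" where
  "true_lit \<beta> l \<longleftrightarrow> \<beta> (fst l) = snd l"

text \<open>Ranging over literals instead of clauses states every clause three times, once from each
  of its literals, in the form in which walks along \<open>cnext\<close> traverse it.\<close>

definition clauses_hold :: "nat \<Rightarrow> (nat \<Rightarrow> bool) \<Rightarrow> bool" where
  "clauses_hold m \<tau> \<longleftrightarrow> (\<forall>i < m. \<tau> i \<or> \<tau> (cnext i) \<or> \<tau> (cnext (cnext i)))"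

lemma length_concat3: "\<forall>C \<in> set \<phi>. length C = 3 \<Longrightarrow> length (concat \<phi>) = 3 * length \<phi>"
  by (induction \<phi>) auto

lemma concat3_nth:
  "\<forall>C \<in> set \<phi>. length C = 3 \<Longrightarrow> k < length \<phi> \<Longrightarrow> r < 3 \<Longrightarrow> concat \<phi> ! (3 * k + r) = \<phi> ! k ! r"
proof (induction \<phi> arbitrary: k)
  case (Cons C \<phi>)
  show ?case
  proof (cases k)
    case 0
    with Cons.prems show ?thesis by (simp add: nth_append)
  next
    case (Suc k')
    then have "3 * k + r = length C + (3 * k' + r)" using Cons.prems by simp
    with Suc Cons show ?thesis by (simp add: nth_append)
  qed
qed simp

lemma satisfies_concat:
  assumes "\<forall>C \<in> set \<phi>. length C = 3"
  shows "satisfies \<beta> \<phi> \<longleftrightarrow> clauses_hold (length (concat \<phi>)) (\<lambda>i. true_lit \<beta> (concat \<phi> ! i))"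
proof -
  let ?t = "\<lambda>i. true_lit \<beta> (concat \<phi> ! i)"
  have len: "length (concat \<phi>) = 3 * length \<phi>" using assms by (rule length_concat3)
  have "satisfies \<beta> \<phi> \<longleftrightarrow> (\<forall>k < length \<phi>. \<exists>l \<in> set (\<phi> ! k). true_lit \<beta> l)"
    unfolding satisfies_def true_lit_def all_set_conv_all_nth by (simp add: case_prod_beta)
  also have "\<dots> \<longleftrightarrow> (\<forall>k < length \<phi>. ?t (3 * k) \<or> ?t (3 * k + 1) \<or> ?t (3 * k + 2))"
  proof (intro all_cong)
    fix k assume k: "k < length \<phi>"
    with assms have "length (\<phi> ! k) = 3" by simp
    then have "set (\<phi> ! k) = {\<phi> ! k ! 0, \<phi> ! k ! 1, \<phi> ! k ! 2}"
      by (auto simp: set_conv_nth numeral_3_eq_3 less_Suc_eq numeral_2_eq_2)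
    then show "(\<exists>l \<in> set (\<phi> ! k). true_lit \<beta> l) \<longleftrightarrow> ?t (3 * k) \<or> ?t (3 * k + 1) \<or> ?t (3 * k + 2)"
      using concat3_nth [OF assms k, of 0] concat3_nth [OF assms k, of 1] concat3_nth [OF assms k, of 2]
      by simp
  qed
  also have "\<dots> \<longleftrightarrow> clauses_hold (length (concat \<phi>)) ?t"
    unfolding clauses_hold_def len
  proof (intro iffI allI impI)
    fix i assume a: "\<forall>k < length \<phi>. ?t (3 * k) \<or> ?t (3 * k + 1) \<or> ?t (3 * k + 2)" and i: "i < 3 * length \<phi>"
    show "?t i \<or> ?t (cnext i) \<or> ?t (cnext (cnext i))"
    proof (cases i rule: mod3_cases)
      case (1 k)
      with a i have "?t (3 * k) \<or> ?t (3 * k + 1) \<or> ?t (3 * k + 2)" by simp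
      with 1 show ?thesis by (simp only: cnext_simps)
    next
      case (2 k)
      with i have "k < length \<phi>" by simp
      with a have "?t (3 * k) \<or> ?t (3 * k + 1) \<or> ?t (3 * k + 2)" by simp
      with 2 show ?thesis by (simp only: cnext_simps) blast
    next
      case (3 k)
      with i have "k < length \<phi>" by simp
      with a have "?t (3 * k) \<or> ?t (3 * k + 1) \<or> ?t (3 * k + 2)" by simp
      with 3 show ?thesis by (simp only: cnext_simps) blast
    qed
  next
    fix k assume a: "\<forall>i < 3 * length \<phi>. ?t i \<or> ?t (cnext i) \<or> ?t (cnext (cnext i))" and "k < length \<phi>"
    then have "?t (3 * k) \<or> ?t (cnext (3 * k)) \<or> ?t (cnext (cnext (3 * k)))" by simp
    then show "?t (3 * k) \<or> ?t (3 * k + 1) \<or> ?t (3 * k + 2)" by (simp only: cnext_simps)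
  qed
  finally show ?thesis .
qed

text \<open>The bits are constant along rows. In the clause layer the rank counts the steps to the
  next true literal. In the row layer walks run to the right in rows of true literals and to the
  left in the others, and the rank measures the way to that border. In the conflict layer an edge
  leads from a true literal to its complement, whose cell has no active edge.\<close>

lemma pareto_optimal_of_assignment:
  fixes ls :: "literal list"
  defines "C \<equiv> set (cells (length ls))"
  assumes "3 dvd length ls" "clauses_hold (length ls) (\<lambda>i. true_lit \<beta> (ls ! i))"
    and p: "state C (\<lambda>o1. true_lit \<beta> (ls ! fst o1)) p"
    and nx: "nx \<in> {nx_clause, nx_row (length ls), nx_conflict ls}"
    and zs: "distinct (0 # zs)"
  shows "pareto_optimal (instance_of ls Ps) (prof (0 # zs) nx) p"
proof -
  let ?m = "length ls" and ?t = "\<lambda>i. true_lit \<beta> (ls ! i)"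
  let ?G = "instance_of ls Ps"
  have G: "over C ?G" unfolding C_def by (rule over_instance_of)
  have cl: "closed_on C nx" unfolding C_def using assms(2) nx by (rule closed_on_layers)
  note po = pareto_optimal_state [OF G cl zs p]
  consider "nx = nx_clause" | "nx = nx_row ?m" | "nx = nx_conflict ls"
    using nx by blast
  then show ?thesis
  proof cases
    case 1
    let ?rk = "\<lambda>o1 :: idx. if ?t (fst o1) then 0 else if ?t (cnext (fst o1)) then 1 else 2 :: nat"
    show ?thesis
    proof (rule po [where rk = ?rk])
      fix o1 o2 assume "o1 \<in> C" and o2: "nx o1 (\<not> ?t (fst o1)) = Some o2"
      then obtain i j where i: "o1 = (i, j)" "i < ?m" by (auto simp: C_def set_cells)
      with o2 1 have "\<not> ?t i" "o2 = (cnext i, j)"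
        by (auto simp: nx_clause_def split: if_splits)
      with i assms(3) show "?rk o2 < ?rk o1"
        by (auto simp: clauses_hold_def)
    qed
  next
    case 2
    show ?thesis
    proof (rule po [where rk = "\<lambda>o1. if ?t (fst o1) then ?m - snd o1 else snd o1"])
      fix o1 o2 assume "o1 \<in> C" "nx o1 (\<not> ?t (fst o1)) = Some o2"
      with 2 show "(if ?t (fst o2) then ?m - snd o2 else snd o2) < (if ?t (fst o1) then ?m - snd o1 else snd o1)"
        by (auto simp: nx_row_def C_def set_cells split: if_splits)
    qed
  next
    case 3
    show ?thesis
    proof (rule po [where rk = "\<lambda>o1. if ?t (fst o1) then 1 else 0"])
      fix o1 o2 assume "nx o1 (\<not> ?t (fst o1)) = Some o2"
      moreover obtain i j where "o1 = (i, j)" by fastforce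
      ultimately show "(if ?t (fst o2) then 1 else 0) < (if ?t (fst o1) then 1 else 0 :: nat)"
        using 3 by (auto simp: nx_conflict_def conflict_def true_lit_def split: if_splits)
    qed
  qed
qed

lemma assignment_of_pareto_optimal:
  assumes m: "3 dvd length ls"
    and po: "\<And>P. P \<in> set (profs ls) \<Longrightarrow> pareto_optimal (instance_of ls Ps) P p"
  shows "\<exists>\<beta>. clauses_hold (length ls) (\<lambda>i. true_lit \<beta> (ls ! i))"
proof -
  let ?m = "length ls" and ?G = "instance_of ls Ps"
  let ?C = "set (cells ?m)"
  have G: "over ?C ?G" by (rule over_instance_of)
  have po': "pareto_optimal ?G (prof spare_items nx) p" and cl: "closed_on ?C nx"
    if "nx \<in> {nx_clause, nx_row ?m, nx_conflict ls}" for nx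
    using that po closed_on_layers [OF m] by (auto simp: profs_def)
  have C: "(i, j) \<in> ?C \<longleftrightarrow> i < ?m \<and> j < ?m" for i j by (auto simp: set_cells)
  have "legal ?G (prof spare_items (nx_conflict ls)) p"
    using po' [of "nx_conflict ls"] by (simp add: pareto_optimal_def)
  from state_exists [OF G po' [of nx_clause] this]
  obtain s where s: "state ?C s p" by (auto simp: nx_clause_def nx_conflict_def)
  have cyc: False if "nx \<in> {nx_clause, nx_row ?m, nx_conflict ls}" "D \<subseteq> ?C" "o0 \<in> D" "inj_on g D" "g ` D \<subseteq> D"
    "\<And>o1. o1 \<in> D \<Longrightarrow> nx o1 (\<not> s o1) = Some (g o1)" for nx D o0 g
    using no_trading_cycle [OF G cl [OF that(1)] _ s po' [OF that(1)] that(2-5)] that(6) by auto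
  \<comment> \<open>Otherwise the unsatisfied agents of the two cells would exchange their second
    items in the row layer.\<close>
  have row: "s (i, Suc j)" if "s (i, j)" "i < ?m" "Suc j < ?m" for i j
  proof (rule ccontr)
    assume n: "\<not> s (i, Suc j)"
    let ?g = "\<lambda>o1. if o1 = (i, j) then (i, Suc j) else (i, j)"
    show False
      by (rule cyc [of "nx_row ?m" "{(i, j), (i, Suc j)}" "(i, j)" ?g])
        (use that n in \<open>auto simp: C nx_row_def\<close>)
  qed
  have all: "s (i, j)" if "s (i, 0)" "i < ?m" "j < ?m" for i j
    using that(3)
  proof (induction j)
    case (Suc j)
    with row [of i j] that show ?case by simp
  qed (use that in simp)
  \<comment> \<open>With all three bits false the clause layer contains a triangle in column 0;
    \<open>cnext_cycle\<close> makes the step along it injective.\<close>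
  have clause: "s (i, 0) \<or> s (cnext i, 0) \<or> s (cnext (cnext i), 0)" if i: "i < ?m" for i
  proof (rule ccontr)
    assume n: "\<not> ?thesis"
    let ?D = "{(i, 0), (cnext i, 0), (cnext (cnext i), 0)} :: idx set"
    have "cnext i < ?m" "cnext (cnext i) < ?m" "0 < ?m" using cnext_less [OF m] i by auto
    with i have sub: "?D \<subseteq> ?C" by (simp add: C)
    have inj: "inj_on (\<lambda>o1. (cnext (fst o1), 0 :: nat)) ?D"
      using cnext_cycle by (intro inj_onI) (metis Pair_inject insertE prod.collapse singletonD snd_conv)
    show False
      by (rule cyc [OF _ sub _ inj, of nx_clause "(i, 0)"])
        (use n cnext_cycle in \<open>auto simp: nx_clause_def\<close>)
  qed
  \<comment> \<open>The bits of column 0 are first carried to columns \<open>j\<close> and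
    \<open>i\<close>, where the two copies reserved for this conflict can trade.\<close>
  have compatible: "\<not> conflict (ls ! i) (ls ! j)" if ij: "s (i, 0)" "s (j, 0)" "i < ?m" "j < ?m" for i j
  proof
    assume c: "conflict (ls ! i) (ls ! j)"
    moreover have "conflict (ls ! j) (ls ! i)" using c by (auto simp: conflict_def)
    moreover have "s (i, j)" "s (j, i)" using all ij by auto
    ultimately have step: "nx_conflict ls o1 (\<not> s o1) = Some (prod.swap o1)" if "o1 \<in> {(i, j), (j, i)}" for o1
      using that by (auto simp: nx_conflict_def)
    have sub: "{(i, j), (j, i)} \<subseteq> ?C" using ij by (simp add: C)
    have inj: "inj_on prod.swap {(i, j), (j, i)}" by (rule inj_on_subset [OF inj_swap subset_UNIV])
    have im: "prod.swap ` {(i, j), (j, i)} \<subseteq> {(i, j), (j, i)}" by simp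
    show False
      by (rule cyc [of "nx_conflict ls" "{(i, j), (j, i)}" "(i, j)" prod.swap])
        (simp, rule sub, simp, rule inj, rule im, erule step)
  qed
  \<comment> \<open>Variables without a chosen positive literal become false. A chosen negative
    literal is then true, as \<open>compatible\<close> excludes a chosen positive literal of the
    same variable.\<close>
  define \<beta> where "\<beta> v \<longleftrightarrow> (\<exists>i < ?m. s (i, 0) \<and> fst (ls ! i) = v \<and> snd (ls ! i))" for v
  have "true_lit \<beta> (ls ! i)" if "s (i, 0)" "i < ?m" for i
  proof (cases "snd (ls ! i)")
    case True
    with that show ?thesis unfolding true_lit_def \<beta>_def by blast
  next
    case False
    have "\<not> \<beta> (fst (ls ! i))"
    proof
      assume "\<beta> (fst (ls ! i))"
      then obtain j where j: "j < ?m" "s (j, 0)" "fst (ls ! j) = fst (ls ! i)" "snd (ls ! j)"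
        unfolding \<beta>_def by blast
      with compatible [OF that(1) j(2) that(2) j(1)] False show False by (simp add: conflict_def)
    qed
    with False show ?thesis by (simp add: true_lit_def)
  qed
  moreover have "cnext i < ?m" if "i < ?m" for i using cnext_less [OF m that] .
  ultimately have "clauses_hold ?m (\<lambda>i. true_lit \<beta> (ls ! i))"
    using clause unfolding clauses_hold_def by blast
  then show ?thesis by (rule exI [of "\<lambda>\<beta>. clauses_hold ?m (\<lambda>i. true_lit \<beta> (ls ! i))"])
qed

text \<open>A set of \<open>alpha G\<close> indices out of \<open>alpha G\<close> many contains all
  of them.\<close>

lemma globally_optimal_all_layers:
  assumes "length (profiles G) = alpha G"
  shows "globally_optimal G p \<longleftrightarrow> is_assignment G p \<and> (\<forall>P \<in> set (profiles G). pareto_optimal G P p)"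
proof -
  have "J = {..<length (profiles G)}" if "J \<subseteq> {..<length (profiles G)}" "card J = alpha G" for J
    using that assms by (intro card_subset_eq) auto
  then have "(\<exists>J \<subseteq> {..<length (profiles G)}. card J = alpha G \<and> (\<forall>j \<in> J. pareto_optimal G (profiles G ! j) p))
      \<longleftrightarrow> (\<forall>j < length (profiles G). pareto_optimal G (profiles G ! j) p)"
    using assms by (metis card_lessThan lessThan_iff subset_refl)
  then show ?thesis
    by (simp add: globally_optimal_def all_set_conv_all_nth)
qed

section \<open>Correctness and the two reductions\<close>

text \<open>Both instances contain the three layers of \<open>profs\<close>, from which a satisfying
  assignment is extracted. Conversely, the long list of the extra layer is distinct and starts with
  item 0, so \<open>pareto_optimal_of_assignment\<close> covers it as well.\<close>

lemma reduction_correct: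
  assumes \<phi>: "\<forall>C \<in> set \<phi>. length C = 3" and Ps: "Ps = profs (concat \<phi>) \<or> Ps = profs (concat \<phi>) @ [extra_prof (concat \<phi>)]"
  shows "(\<exists>\<beta>. satisfies \<beta> \<phi>) \<longleftrightarrow> (\<exists>p. globally_optimal (instance_of (concat \<phi>) Ps) p)"
proof -
  let ?ls = "concat \<phi>"
  let ?G = "instance_of ?ls Ps" and ?C = "set (cells (length ?ls))"
  have m: "3 dvd length ?ls" using length_concat3 [OF \<phi>] by simp
  have glob: "globally_optimal ?G p \<longleftrightarrow> is_assignment ?G p \<and> (\<forall>P \<in> set Ps. pareto_optimal ?G P p)" for p
    using globally_optimal_all_layers [of ?G] by (simp add: instance_of_def)
  show ?thesis
  proof
    assume "\<exists>\<beta>. satisfies \<beta> \<phi>"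
    then obtain \<beta> where \<beta>: "clauses_hold (length ?ls) (\<lambda>i. true_lit \<beta> (?ls ! i))"
      using satisfies_concat [OF \<phi>] by blast
    let ?s = "\<lambda>o1 :: idx. true_lit \<beta> (?ls ! fst o1)"
    define p where "p a = (if a = 0 then Some 0 else case un_nm a of (o1, b) \<Rightarrow> Some (nm o1 (b = ?s o1)))" for a
    have st: "state ?C ?s p" by (simp add: state_def p_def)
    have po: "pareto_optimal ?G P p" if "P \<in> set Ps" for P
    proof -
      have "distinct (0 # [1, 2 :: nat])" "distinct (0 # ([1, 2] @ node_names (length ?ls)))"
        by (auto simp: distinct_node_names set_node_names)
      note d = this [THEN pareto_optimal_of_assignment [OF m \<beta> st, rotated]]
      from that Ps consider nx where "nx \<in> {nx_clause, nx_row (length ?ls), nx_conflict ?ls}"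
          "P = prof (0 # [1, 2]) nx"
        | "P = prof (0 # ([1, 2] @ node_names (length ?ls))) (nx_conflict ?ls)"
        unfolding profs_def extra_prof_def by fastforce
      then show ?thesis
      proof cases
        case (1 nx)
        with d(1) show ?thesis by blast
      next
        case 2
        with d(2) show ?thesis by blast
      qed
    qed
    have "is_assignment ?G p"
      using po [of "hd Ps"] Ps by (auto simp: pareto_optimal_def legal_def profs_def)
    with po show "\<exists>p. globally_optimal ?G p" using glob by blast
  next
    assume "\<exists>p. globally_optimal ?G p"
    then obtain p where "\<forall>P \<in> set Ps. pareto_optimal ?G P p" using glob by blast
    then have "\<And>P. P \<in> set (profs ?ls) \<Longrightarrow> pareto_optimal ?G P p" using Ps by auto
    from assignment_of_pareto_optimal [OF m this] show "\<exists>\<beta>. satisfies \<beta> \<phi>"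
      using satisfies_concat [OF \<phi>] by blast
  qed
qed

lemma goa_instances:
  assumes "3 dvd length ls"
  shows "goa_instance (instance_of ls (profs ls))" "goa_instance (instance_of ls (profs ls @ [extra_prof ls]))"
proof -
  have spare: "\<exists>zs nx. P = prof zs nx \<and> distinct zs \<and> set zs \<subseteq> set (spare_items @ node_names (length ls)) \<and>
      closed_on (set (cells (length ls))) nx" if P: "P \<in> set (profs ls)" for P
  proof -
    from P obtain nx where "P = prof spare_items nx" "nx \<in> {nx_clause, nx_row (length ls), nx_conflict ls}"
      by (auto simp: profs_def)
    with closed_on_layers [OF assms, of nx] show ?thesis
      by (intro exI [of _ spare_items] exI [of _ nx]) auto
  qed
  have extra: "\<exists>zs nx. P = prof zs nx \<and> distinct zs \<and> set zs \<subseteq> set (spare_items @ node_names (length ls)) \<and>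
      closed_on (set (cells (length ls))) nx" if P: "P = extra_prof ls" for P
    using closed_on_layers [OF assms, of "nx_conflict ls"] P
    by (intro exI [of _ "spare_items @ node_names (length ls)"] exI [of _ "nx_conflict ls"])
      (auto simp: extra_prof_def distinct_node_names set_node_names)
  show "goa_instance (instance_of ls (profs ls))"
    by (rule goa_instance_of) (use spare in \<open>auto simp: profs_def\<close>)
  show "goa_instance (instance_of ls (profs ls @ [extra_prof ls]))"
    by (rule goa_instance_of) (use spare extra in auto)
qed

text \<open>The restriction \<open>R\<close>, the profiles and the printing program \<open>c\<close>
  are parameters, so that one argument yields both reductions.\<close>

lemma reducible:
  assumes "wf_com 6 6 (init ;; c)"
    and Ps: "\<And>ls. Ps ls = profs ls \<or> Ps ls = profs ls @ [extra_prof ls]"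
    and R: "\<And>ls. R (instance_of ls (Ps ls))"
    and run: "\<And>w ls. 3 dvd length ls \<Longrightarrow> emits w ls 0 0 c (enc_goa (instance_of ls (Ps ls))) (30000 * size1 ls ^ 3)"
  shows "three_sat \<le>\<^sub>p goa_restricted_to R"
  unfolding poly_time_reducible_def
proof (intro exI conjI ballI)
  let ?f = "\<lambda>\<phi> :: cnf. instance_of (concat \<phi>) (Ps (concat \<phi>))"
  fix \<phi> :: cnf assume "\<phi> \<in> instances three_sat"
  then have \<phi>: "\<forall>C \<in> set \<phi>. length C = 3" by (simp add: three_sat_def)
  then have m: "3 dvd length (concat \<phi>)" using length_concat3 by fastforce
  show "?f \<phi> \<in> instances (goa_restricted_to R)"
    using goa_instances [OF m] Ps [of "concat \<phi>"] R [of "concat \<phi>"] by (auto simp: goa_restricted_to_def)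
  show "is_yes three_sat \<phi> \<longleftrightarrow> is_yes (goa_restricted_to R) (?f \<phi>)"
    using reduction_correct [OF \<phi> Ps] by (simp add: three_sat_def goa_restricted_to_def)
next
  show "poly_time_computable three_sat (goa_restricted_to R) (\<lambda>\<phi>. instance_of (concat \<phi>) (Ps (concat \<phi>)))"
  proof (rule poly_time_computable_runs [OF assms(1)])
    fix \<phi> assume "\<phi> \<in> instances three_sat"
    then have "\<forall>C \<in> set \<phi>. length C = 3" by (simp add: three_sat_def)
    then have m: "3 dvd length (concat \<phi>)" using length_concat3 by fastforce
    have "set (enc_cnf \<phi>) \<subseteq> {..<6}" using set_enc_cnf [of \<phi>] by auto
    with runs_program [OF run [OF m]]
    show "set (encode three_sat \<phi>) \<subseteq> {..<6} \<and>
      (\<exists>\<sigma>. \<sigma> 1 = (rev (encode (goa_restricted_to R) (instance_of (concat \<phi>) (Ps (concat \<phi>)))), []) \<and>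
        runs (init ;; c) (initial (encode three_sat \<phi>))
          (poly ([:40000:] * [:1, 1:] ^ 3) (length (encode three_sat \<phi>))) \<sigma>)"
      by (simp add: three_sat_def goa_restricted_to_def)
  qed simp_all
qed

theorem theorem10:
  shows "three_sat \<le>\<^sub>p goa_restricted_to
           (\<lambda>G. alpha G = 3 \<and> length (profiles G) = 3 \<and> max_pref_length G = 3) \<and>
         three_sat \<le>\<^sub>p goa_restricted_to
           (\<lambda>G. alpha G = 4 \<and> length (profiles G) = 4 \<and> max_pref_length G = length (items G))"
proof
  have len: "length (profs ls) = 3" for ls by (simp add: profs_def)
  show "three_sat \<le>\<^sub>p goa_restricted_to
      (\<lambda>G. alpha G = 3 \<and> length (profiles G) = 3 \<and> max_pref_length G = 3)"
  proof (rule reducible [where Ps = profs, OF wf_programs(1) [unfolded program3_def]])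
    show "emits w ls 0 0 (preamble ;; closing 3) (enc_goa (instance_of ls (profs ls))) (30000 * size1 ls ^ 3)"
      if "3 dvd length ls" for w ls
      unfolding enc_instance_of by (rule emits_body3 [OF that])
  qed (simp_all add: max_pref_length_instances, simp_all add: instance_of_def len)
  show "three_sat \<le>\<^sub>p goa_restricted_to
      (\<lambda>G. alpha G = 4 \<and> length (profiles G) = 4 \<and> max_pref_length G = length (items G))"
  proof (rule reducible [where Ps = "\<lambda>ls. profs ls @ [extra_prof ls]", OF wf_programs(2) [unfolded program4_def]])
    show "emits w ls 0 0 (preamble ;; layer (name_list spare_items) (\<lambda>_. conflict_cell) ;; closing 4)
        (enc_goa (instance_of ls (profs ls @ [extra_prof ls]))) (30000 * size1 ls ^ 3)"
      if "3 dvd length ls" for w ls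
      unfolding enc_instance_of by (rule emits_body4 [OF that])
  qed (simp_all add: max_pref_length_instances, simp_all add: instance_of_def len)
qed

end
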